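(* Let $n\ge 2$ be an integer and let $X$ be an $n$-Hausdorff topological space. Then $X$ can be embedded in a homogeneous topological space that is the union of countably many $n$-H-closed (sub)spaces.
   Context: No separation axioms are assumed unless stated. The Hausdorff number $H(X)$ of a topological space $X$ is the least cardinal $\kappa$ (finite or infinite) such that for every $A\subseteq X$ with $|A|\ge\kappa$ there are open neighbourhoods $U_a$ of $a$, for $a\in A$, with $\bigcap_{a\in A}U_a=\emptyset$. $X$ is $n$-Hausdorff if $H(X)\le n$. An $n$-Hausdorff space $X$ is $n$-H-closed if $X$ is closed in every $n$-Hausdorff space $Y$ in which $X$ is embedded. A space $X$ is homogeneous if for all $x,y\in X$ there is a homeomorphism $h:X\to X$ with $h(x)=y$. *)

theory Defs
  imports "HOL-Analysis.Analysis"
begin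

unbundle cardinal_syntax

section \<open>Hausdorff number\<close>

text \<open>Cardinals are cardinal orders in the sense of the HOL library, compared by \<open>\<le>o\<close> across
  types.\<close>

definition separates_families :: "'a topology \<Rightarrow> 'k rel \<Rightarrow> bool" where
  "separates_families X \<kappa> \<longleftrightarrow>
     (\<forall>A. A \<subseteq> topspace X \<and> \<kappa> \<le>o |A| \<longrightarrow>
        (\<exists>U. (\<forall>a\<in>A. openin X (U a) \<and> a \<in> U a) \<and> topspace X \<inter> (\<Inter>a\<in>A. U a) = {}))"

text \<open>The least such cardinal is at most the cardinality of the powerset of the space, because no
  subset of the space is that large. It is therefore represented on the type \<open>'a set\<close>, and is
  unique up to \<open>=o\<close>.\<close>

definition is_hausdorff_number :: "'a topology \<Rightarrow> 'a set rel \<Rightarrow> bool" where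
  "is_hausdorff_number X \<kappa> \<longleftrightarrow>
     Card_order \<kappa> \<and> separates_families X \<kappa> \<and>
     (\<forall>\<mu> :: 'a set rel. Card_order \<mu> \<and> separates_families X \<mu> \<longrightarrow> \<kappa> \<le>o \<mu>)"

definition hausdorff_number :: "'a topology \<Rightarrow> 'a set rel" where
  "hausdorff_number X = (SOME \<kappa>. is_hausdorff_number X \<kappa>)"

definition n_Hausdorff :: "nat \<Rightarrow> 'a topology \<Rightarrow> bool" where
  "n_Hausdorff n X \<longleftrightarrow> hausdorff_number X \<le>o |{..<n}|"

lemma separates_families_mono:
  assumes "separates_families X \<kappa>" and "\<kappa> \<le>o \<mu>"
  shows "separates_families X \<mu>"
  using assms unfolding separates_families_def by (meson ordLeq_transitive)

lemma separates_families_UNIV: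
  fixes X :: "'a topology"
  shows "separates_families X |UNIV :: 'a set set|"
proof -
  have "\<not> |UNIV :: 'a set set| \<le>o |A|" for A :: "'a set"
  proof
    assume "|UNIV :: 'a set set| \<le>o |A|"
    moreover have "|A| \<le>o |UNIV :: 'a set|" by (rule card_of_mono1) simp
    ultimately have "|UNIV :: 'a set set| \<le>o |UNIV :: 'a set|"
      by (rule ordLeq_transitive)
    then show False
      using card_of_Pow[of "UNIV :: 'a set"] not_ordLess_ordLeq by (metis Pow_UNIV)
  qed
  then show ?thesis unfolding separates_families_def by blast
qed

lemma is_hausdorff_number_hausdorff_number:
  fixes X :: "'a topology"
  shows "is_hausdorff_number X (hausdorff_number X)"
proof -
  let ?R = "{\<kappa> :: 'a set rel. Card_order \<kappa> \<and> separates_families X \<kappa>}"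
  have "?R \<noteq> {}"
    using separates_families_UNIV[of X] card_of_Card_order by blast
  then have "\<exists>\<kappa>\<in>?R. \<forall>\<mu>\<in>?R. \<kappa> \<le>o \<mu>"
    by (rule exists_minim_Card_order) simp
  then have "\<exists>\<kappa>. is_hausdorff_number X \<kappa>"
    unfolding is_hausdorff_number_def by blast
  then show ?thesis unfolding hausdorff_number_def by (rule someI_ex)
qed

lemma n_Hausdorff_iff_separates_families:
  fixes X :: "'a topology"
  shows "n_Hausdorff n X \<longleftrightarrow> separates_families X |{..<n}|"
proof
  assume "n_Hausdorff n X"
  then show "separates_families X |{..<n}|"
    using is_hausdorff_number_hausdorff_number[of X] separates_families_mono
    unfolding n_Hausdorff_def is_hausdorff_number_def by blast
next
  assume sep: "separates_families X |{..<n}|"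
  have least: "hausdorff_number X \<le>o \<mu>"
    if "Card_order \<mu>" "separates_families X \<mu>" for \<mu> :: "'a set rel"
    using that is_hausdorff_number_hausdorff_number[of X]
    unfolding is_hausdorff_number_def by blast
  show "n_Hausdorff n X"
  proof (cases "|{..<n}| \<le>o |UNIV :: 'a set set|")
    case True
    then obtain f :: "nat \<Rightarrow> 'a set" where "inj_on f {..<n}"
      using card_of_ordLeq[of "{..<n}" "UNIV :: 'a set set"] by blast
    then have iso: "|{..<n}| =o |f ` {..<n}|"
      by (meson card_of_ordIso inj_on_imp_bij_betw)
    then have "separates_families X |f ` {..<n}|"
      using sep separates_families_mono ordIso_imp_ordLeq by blast
    then have "hausdorff_number X \<le>o |f ` {..<n}|"
      using least card_of_Card_order by blast
    then show ?thesis
      unfolding n_Hausdorff_def using iso ordIso_symmetric ordLeq_ordIso_trans by blast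
  next
    case False
    then have "|UNIV :: 'a set set| \<le>o |{..<n}|"
      using ordLeq_total[OF card_of_Well_order card_of_Well_order] by blast
    moreover have "hausdorff_number X \<le>o |UNIV :: 'a set set|"
      by (rule least[OF card_of_Card_order separates_families_UNIV])
    ultimately show ?thesis
      unfolding n_Hausdorff_def by (rule ordLeq_transitive[rotated])
  qed
qed

lemma card_of_lessThan_ordLeq_iff: "|{..<n}| \<le>o |A| \<longleftrightarrow> infinite A \<or> n \<le> card A"
proof (cases "finite A")
  case True
  then show ?thesis
    using card_of_ordLeq[of "{..<n}" A] inj_on_iff_card_le[of "{..<n}" A] by auto
next
  case False
  then have "|UNIV :: nat set| \<le>o |A|"
    by (simp add: infinite_iff_card_of_nat)
  then have "|{..<n}| \<le>o |A|"
    by (rule ordLeq_transitive[OF card_of_mono1[OF subset_UNIV]])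
  then show ?thesis using False by blast
qed

lemma n_Hausdorff_iff:
  "n_Hausdorff n X \<longleftrightarrow>
     (\<forall>A. A \<subseteq> topspace X \<and> (infinite A \<or> n \<le> card A) \<longrightarrow>
        (\<exists>U. (\<forall>a\<in>A. openin X (U a) \<and> a \<in> U a) \<and> topspace X \<inter> (\<Inter>a\<in>A. U a) = {}))"
  unfolding n_Hausdorff_iff_separates_families separates_families_def
    card_of_lessThan_ordLeq_iff ..

lemma n_Hausdorff_injective_preimage:
  assumes Y: "n_Hausdorff n Y" and f: "continuous_map X Y f" and inj: "inj_on f (topspace X)"
  shows "n_Hausdorff n X"
  unfolding n_Hausdorff_iff
proof (intro allI impI, elim conjE)
  fix A assume A: "A \<subseteq> topspace X" "infinite A \<or> n \<le> card A"
  have "inj_on f A" using inj A(1) inj_on_subset by blast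
  then have "infinite (f ` A) \<or> n \<le> card (f ` A)"
    using A(2) by (simp add: card_image finite_image_iff)
  moreover have "f ` A \<subseteq> topspace Y"
    using A(1) continuous_map_image_subset_topspace[OF f] by blast
  ultimately obtain U where U: "\<And>b. b \<in> f ` A \<Longrightarrow> openin Y (U b) \<and> b \<in> U b"
    "topspace Y \<inter> (\<Inter>b\<in>f ` A. U b) = {}"
    using Y unfolding n_Hausdorff_iff by metis
  let ?V = "\<lambda>a. {x \<in> topspace X. f x \<in> U (f a)}"
  have "openin X (?V a) \<and> a \<in> ?V a" if "a \<in> A" for a
    using that U(1) A(1) openin_continuous_map_preimage[OF f] by blast
  moreover have "topspace X \<inter> (\<Inter>a\<in>A. ?V a) = {}"
    using U(2) continuous_map_image_subset_topspace[OF f] by fastforce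
  ultimately show
    "\<exists>V. (\<forall>a\<in>A. openin X (V a) \<and> a \<in> V a) \<and> topspace X \<inter> (\<Inter>a\<in>A. V a) = {}"
    by (intro exI[of _ ?V]) blast
qed

section \<open>n-H-closed spaces\<close>

text \<open>A definition cannot quantify over the types carrying the ambient spaces \<open>Y\<close>. Spaces on
  \<open>'a option\<close>, one point more than the type of \<open>X\<close>, suffice: lemma \<open>n_H_closed_imp_closedin\<close>
  recovers closedness in spaces \<open>Y\<close> on every type.\<close>

definition n_H_closed :: "nat \<Rightarrow> 'a topology \<Rightarrow> bool" where
  "n_H_closed n X \<longleftrightarrow>
     n_Hausdorff n X \<and>
     (\<forall>(Y :: 'a option topology) f.
        n_Hausdorff n Y \<and> embedding_map X Y f \<longrightarrow> closedin Y (f ` topspace X))"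

lemma n_H_closed_imp_closedin:
  fixes X :: "'a topology" and Y :: "'b topology"
  assumes X: "n_H_closed n X" and Y: "n_Hausdorff n Y" and f: "embedding_map X Y f"
  shows "closedin Y (f ` topspace X)"
proof (rule ccontr)
  assume ncl: "\<not> closedin Y (f ` topspace X)"
  have contf: "continuous_map X Y f"
    using f homeomorphic_imp_continuous_map continuous_map_in_subtopology
    unfolding embedding_map_def by blast
  then have sub: "f ` topspace X \<subseteq> topspace Y"
    by (rule continuous_map_image_subset_topspace)
  have "\<not> Y closure_of (f ` topspace X) \<subseteq> f ` topspace X"
    using ncl sub closure_of_subset closure_of_eq by (metis subset_antisym)
  then obtain p where p: "p \<in> Y closure_of (f ` topspace X)" "p \<notin> f ` topspace X"
    by blast
  have pY: "p \<in> topspace Y" using p(1) by (simp add: in_closure_of)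
  have inj: "inj_on f (topspace X)"
    using f by (metis embedding_map_def homeomorphic_imp_injective_map)
  define g where "g = (\<lambda>z. case z of None \<Rightarrow> p | Some x \<Rightarrow> f x)"
  define S where "S = insert None (Some ` topspace X)"
  define Z where "Z = pullback_topology S g Y"
  have topZ: "topspace Z = S"
    using sub pY unfolding Z_def topspace_pullback_topology S_def g_def by auto
  have injg: "inj_on g S"
    using inj p(2) unfolding S_def g_def inj_on_def by auto
  have contg: "continuous_map Z Y g"
    using continuous_map_pullback[of Y Y id S g] unfolding Z_def by simp
  have "n_Hausdorff n Z"
    using n_Hausdorff_injective_preimage[OF Y contg] injg topZ by simp
  moreover have "embedding_map X Z Some"
  proof -
    obtain f' where f': "homeomorphic_maps X (subtopology Y (f ` topspace X)) f f'"
      using f unfolding embedding_map_def homeomorphic_map_maps by blast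
    have "continuous_map X Y (g \<circ> Some)"
      using contf by (simp add: g_def comp_def)
    then have "continuous_map X Z Some"
      unfolding Z_def by (rule continuous_map_pullback') (auto simp: S_def)
    then have 1: "continuous_map X (subtopology Z (Some ` topspace X)) Some"
      by (simp add: continuous_map_in_subtopology)
    have "continuous_map (subtopology Z (Some ` topspace X)) (subtopology Y (f ` topspace X)) g"
      using contg by (auto simp: continuous_map_in_subtopology continuous_map_from_subtopology g_def)
    then have 2: "continuous_map (subtopology Z (Some ` topspace X)) X (f' \<circ> g)"
      using f' unfolding homeomorphic_maps_def by (blast intro: continuous_map_compose)
    have "homeomorphic_maps X (subtopology Z (Some ` topspace X)) Some (f' \<circ> g)"
      using 1 2 f' unfolding homeomorphic_maps_def by (auto simp: g_def)
    then show ?thesis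
      unfolding embedding_map_def by (rule homeomorphic_maps_imp_map)
  qed
  ultimately have "closedin Z (Some ` topspace X)"
    using X unfolding n_H_closed_def by blast
  then have "openin Z (S - Some ` topspace X)"
    using topZ unfolding closedin_def by simp
  then obtain W where W: "openin Y W" "S - Some ` topspace X = g -` W \<inter> S"
    unfolding Z_def openin_pullback_topology by blast
  have "None \<in> g -` W" using W(2) unfolding S_def by auto
  then have "p \<in> W" unfolding g_def by simp
  then obtain x where x: "x \<in> topspace X" "f x \<in> W"
    using p(1) W(1) unfolding in_closure_of by blast
  then have "Some x \<in> g -` W \<inter> S" unfolding S_def g_def by simp
  then show False using W(2) x(1) by blast
qed

section \<open>Homogeneous spaces\<close>

definition homogeneous_space :: "'a topology \<Rightarrow> bool" where
  "homogeneous_space X \<longleftrightarrow>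
     (\<forall>x\<in>topspace X. \<forall>y\<in>topspace X. \<exists>h. homeomorphic_map X X h \<and> h x = y)"

text \<open>HOL cannot assert the existence of a space on an unspecified type, so a type for the points
  of the homogeneous space has to be named. This one is infinite and has the cardinality of the
  fourth iterated powerset of \<open>'a + nat\<close>.\<close>

type_synonym 'a ambient = "('a + nat) set set set set"

unbundle no cardinal_syntax

end

theory Submission
  imports Defs "HOL-Library.Sublist"
begin

text \<open>If every open ultrafilter of a space has exactly \<open>n - 1\<close> limits, then the space is
  \<open>n\<close>-H-closed: an \<open>n\<close>-Hausdorff extension in which it were not closed would give some ultrafilter
  an \<open>n\<close>-th limit. Such spaces can be collected: a discrete family of them, together with \<open>n - 1\<close>
  points whose neighbourhoods contain almost all members, is again of this kind.

  First \<open>X\<close> is made \<open>T\<^sub>0\<close> and enlarged to a space of letters, which contains the limits missing from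
  open ultrafilters on open subsets of \<open>X\<close>, and some isolated link letters. The homogeneous space
  consists of the reduced words over these letters, that is, of the free product of groups of order
  2, one for each letter. It is a tree of copies \<open>g A\<close> of the letter space \<open>A\<close>, glued at points, with
  a topology invariant under left multiplication. The links make certain words limits of almost all
  branches at a vertex, so that the pieces found in the branches can be collected level by level,
  starting from the empty word. Because \<open>A\<close> need not be \<open>T\<^sub>1\<close>, a step from the position \<open>a\<close> of a copy
  to the position \<open>b\<close> has to be distinguished according to whether \<open>b\<close> lies in the closure of \<open>a\<close> (a
  bad step) or not.\<close>

section \<open>Open ultrafilters\<close>

text \<open>Countability is the obstacle. A vertex can have uncountably many branches, so pieces
  cannot be chosen branch by branch. They are therefore functions of the vertex: a function for the
  next vertices yields one for the present vertex by collecting all its values at once, and only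
  countably many functions arise. Collecting requires open sets that keep the pieces in different
  branches apart, although neighbouring letters themselves cannot be kept apart. A piece whose words
  make a good step beyond its vertex has the open set \<open>good_part\<close> of its branch to
  itself. For a piece behind a bad step, the neighbouring branches are cut at their first bad step,
  which is possible because \<open>cl a - {a}\<close> is finite and closed. For the bare vertices of
  one copy neither device works; there the completions \<open>I a\<close> are pieces of their own.

  A word may end in the letter that a link would cancel with, so \<open>n\<close> links of each kind
  are provided for \<open>n - 1\<close> limits. Points of the given space that lie in the same open
  sets are merged at the start; blowing up restores them, and each slice of the result is a copy of
  the word space.\<close>

definition open_ultrafilter :: "'a topology \<Rightarrow> 'a set set \<Rightarrow> bool" where
  "open_ultrafilter X \<U> \<longleftrightarrow>
     (\<forall>P\<in>\<U>. openin X P) \<and> {} \<notin> \<U> \<and> (\<forall>P\<in>\<U>. \<forall>Q\<in>\<U>. P \<inter> Q \<in> \<U>) \<and>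
     (\<forall>P. openin X P \<longrightarrow> P \<in> \<U> \<or> (\<exists>Q\<in>\<U>. P \<inter> Q = {}))"

definition lims :: "'a topology \<Rightarrow> 'a set set \<Rightarrow> 'a set" where
  "lims X \<U> = {x \<in> topspace X. \<forall>P. openin X P \<and> x \<in> P \<longrightarrow> P \<in> \<U>}"

lemma open_ultrafilterD:
  assumes "open_ultrafilter X \<U>"
  shows "P \<in> \<U> \<Longrightarrow> openin X P" "{} \<notin> \<U>" "P \<in> \<U> \<Longrightarrow> Q \<in> \<U> \<Longrightarrow> P \<inter> Q \<in> \<U>"
    "openin X P \<Longrightarrow> P \<notin> \<U> \<Longrightarrow> \<exists>Q\<in>\<U>. P \<inter> Q = {}"
  using assms unfolding open_ultrafilter_def by blast+

lemma open_ultrafilter_upward: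
  assumes U: "open_ultrafilter X \<U>" and "P \<in> \<U>" "P \<subseteq> Q" "openin X Q"
  shows "Q \<in> \<U>"
proof (rule ccontr)
  assume "Q \<notin> \<U>"
  then obtain R where R: "R \<in> \<U>" "Q \<inter> R = {}"
    using open_ultrafilterD(4)[OF U \<open>openin X Q\<close>] by blast
  then have "P \<inter> R \<in> \<U>" using open_ultrafilterD(3)[OF U] assms by blast
  moreover have "P \<inter> R = {}" using R assms by blast
  ultimately show False using open_ultrafilterD(2)[OF U] by simp
qed

lemma open_ultrafilter_topspace:
  assumes U: "open_ultrafilter X \<U>" shows "topspace X \<in> \<U>"
proof (rule ccontr)
  assume n: "topspace X \<notin> \<U>"
  then obtain Q where Q: "Q \<in> \<U>" "topspace X \<inter> Q = {}"
    using open_ultrafilterD(4)[OF U openin_topspace] by blast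
  then have "Q = {}" using open_ultrafilterD(1)[OF U Q(1)] openin_subset by blast
  then show False using Q(1) open_ultrafilterD(2)[OF U] by simp
qed

lemma open_ultrafilter_Inter:
  assumes U: "open_ultrafilter X \<U>" and "finite \<F>" "\<F> \<subseteq> \<U>"
  shows "topspace X \<inter> \<Inter>\<F> \<in> \<U>"
  using assms(2,3)
proof (induction \<F> rule: finite_induct)
  case empty
  then show ?case using open_ultrafilter_topspace[OF U] by simp
next
  case (insert F \<F>)
  then have "F \<inter> (topspace X \<inter> \<Inter>\<F>) \<in> \<U>"
    using open_ultrafilterD(3)[OF U] by simp
  then show ?case by (simp add: Int_left_commute)
qed

lemma open_ultrafilter_maximal:
  assumes U: "open_ultrafilter X \<U>" and V: "open_ultrafilter X \<V>" and "\<U> \<subseteq> \<V>"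
  shows "\<U> = \<V>"
proof
  show "\<V> \<subseteq> \<U>"
  proof
    fix P assume P: "P \<in> \<V>"
    show "P \<in> \<U>"
    proof (rule ccontr)
      assume "P \<notin> \<U>"
      then obtain Q where "Q \<in> \<U>" "P \<inter> Q = {}"
        using open_ultrafilterD(4)[OF U open_ultrafilterD(1)[OF V P]] by blast
      then show False using open_ultrafilterD(2,3)[OF V] P assms(3) by (metis subsetD)
    qed
  qed
qed (fact assms)

text \<open>Zorn's lemma for families of open sets with the finite intersection property. A maximal
  family contains every open set that meets all its finite intersections, which gives both closure
  under intersection and the disjoint member for each missing open set.\<close>

lemma ex_open_ultrafilter:
  assumes op: "\<And>P. P \<in> \<B> \<Longrightarrow> openin X P"
    and fip: "\<And>\<F>. finite \<F> \<Longrightarrow> \<F> \<subseteq> \<B> \<Longrightarrow> topspace X \<inter> \<Inter>\<F> \<noteq> {}"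
  obtains \<U> where "open_ultrafilter X \<U>" "\<B> \<subseteq> \<U>"
proof -
  define good where "good = {\<C>. \<B> \<subseteq> \<C> \<and> (\<forall>P\<in>\<C>. openin X P) \<and>
    (\<forall>\<F>. finite \<F> \<and> \<F> \<subseteq> \<C> \<longrightarrow> topspace X \<inter> \<Inter>\<F> \<noteq> {})}"
  have "\<exists>\<M>\<in>good. \<forall>\<C>\<in>good. \<M> \<subseteq> \<C> \<longrightarrow> \<C> = \<M>"
  proof (rule subset_Zorn_nonempty)
    show "good \<noteq> {}" using op fip unfolding good_def by blast
    fix \<K> assume "\<K> \<noteq> {}" and ch: "subset.chain good \<K>"
    then have sub: "\<K> \<subseteq> good" by (simp add: subset.chain_def)
    have "topspace X \<inter> \<Inter>\<F> \<noteq> {}" if F: "finite \<F>" "\<F> \<subseteq> \<Union>\<K>" for \<F>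
    proof -
      obtain \<C> where "\<C> \<in> \<K>" "\<F> \<subseteq> \<C>"
        using finite_subset_Union_chain[OF F \<open>\<K> \<noteq> {}\<close> ch] by blast
      then have "\<C> \<in> good" using sub by blast
      then show ?thesis using \<open>\<F> \<subseteq> \<C>\<close> F(1) unfolding good_def by simp
    qed
    moreover have K: "\<B> \<subseteq> \<C> \<and> (\<forall>P\<in>\<C>. openin X P)" if "\<C> \<in> \<K>" for \<C>
      using subsetD[OF sub that] unfolding good_def by simp
    moreover have "\<B> \<subseteq> \<Union>\<K>" "\<forall>P\<in>\<Union>\<K>. openin X P"
      using K \<open>\<K> \<noteq> {}\<close> by blast+
    ultimately show "\<Union>\<K> \<in> good" unfolding good_def by simp
  qed
  then obtain \<M> where M: "\<M> \<in> good" and max: "\<And>\<C>. \<C> \<in> good \<Longrightarrow> \<M> \<subseteq> \<C> \<Longrightarrow> \<C> = \<M>" by blast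
  have opM: "openin X P" if "P \<in> \<M>" for P using M that unfolding good_def by blast
  have fipM: "topspace X \<inter> \<Inter>\<F> \<noteq> {}" if "finite \<F>" "\<F> \<subseteq> \<M>" for \<F>
    using M that unfolding good_def by blast
  have mem: "P \<in> \<M>" if P: "openin X P" 
    and m: "\<And>\<F>. finite \<F> \<Longrightarrow> \<F> \<subseteq> \<M> \<Longrightarrow> topspace X \<inter> \<Inter>\<F> \<inter> P \<noteq> {}" for P
  proof -
    have "topspace X \<inter> \<Inter>\<F> \<noteq> {}" if F: "finite \<F>" "\<F> \<subseteq> insert P \<M>" for \<F>
    proof -
      have "topspace X \<inter> \<Inter>(\<F> - {P}) \<inter> P \<noteq> {}" using F by (intro m) auto
      then show ?thesis by blast
    qed
    moreover have "\<B> \<subseteq> \<M>" using M unfolding good_def by simp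
    ultimately have "insert P \<M> \<in> good" using opM P unfolding good_def by auto
    then show ?thesis using max by blast
  qed
  have disj: "\<exists>Q\<in>\<M>. P \<inter> Q = {}" if P: "openin X P" "P \<notin> \<M>" for P
  proof -
    obtain \<F> where F: "finite \<F>" "\<F> \<subseteq> \<M>" "topspace X \<inter> \<Inter>\<F> \<inter> P = {}"
      using mem[OF P(1)] P(2) by blast
    have "openin X (topspace X \<inter> \<Inter>\<F>)"
    proof (cases "\<F> = {}")
      case False
      then have "openin X (\<Inter>\<F>)" using F opM by (intro openin_Inter) auto
      then show ?thesis by (intro openin_Int) auto
    qed auto
    moreover have "topspace X \<inter> \<Inter>\<G> \<inter> (topspace X \<inter> \<Inter>\<F>) \<noteq> {}" if "finite \<G>" "\<G> \<subseteq> \<M>" for \<G>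
      using fipM[of "\<F> \<union> \<G>"] F that by (simp add: Inter_Un_distrib Int_ac)
    ultimately have "topspace X \<inter> \<Inter>\<F> \<in> \<M>" by (rule mem)
    then show ?thesis using F(3) by blast
  qed
  have "P \<inter> Q \<in> \<M>" if PQ: "P \<in> \<M>" "Q \<in> \<M>" for P Q
  proof (rule mem)
    show "openin X (P \<inter> Q)" using that opM by blast
    show "topspace X \<inter> \<Inter>\<F> \<inter> (P \<inter> Q) \<noteq> {}" if "finite \<F>" "\<F> \<subseteq> \<M>" for \<F>
      using fipM[of "insert P (insert Q \<F>)"] that PQ by (simp add: Int_ac)
  qed
  moreover have "{} \<notin> \<M>" using fipM[of "{{}}"] by auto
  ultimately have "open_ultrafilter X \<M>"
    using opM disj unfolding open_ultrafilter_def by blast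
  moreover have "\<B> \<subseteq> \<M>" using M unfolding good_def by simp
  ultimately show thesis by (rule that)
qed

lemma lims_nbhds_meet:
  assumes U: "open_ultrafilter X \<U>" and "finite A" "A \<subseteq> lims X \<U>"
    and V: "\<And>a. a \<in> A \<Longrightarrow> openin X (V a) \<and> a \<in> V a"
  shows "topspace X \<inter> (\<Inter>a\<in>A. V a) \<noteq> {}"
proof -
  have "topspace X \<inter> \<Inter>(V ` A) \<in> \<U>"
    using assms by (intro open_ultrafilter_Inter[OF U]) (auto simp: lims_def)
  then show ?thesis using open_ultrafilterD(2)[OF U] by metis
qed

text \<open>Among \<open>n\<close> limits, any choice of neighbourhoods has an intersection that
  belongs to the ultrafilter, so it cannot be empty.\<close>

lemma card_lims_less:
  assumes X: "n_Hausdorff n X" and U: "open_ultrafilter X \<U>" and "n > 0"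
  shows "finite (lims X \<U>)" "card (lims X \<U>) < n"
proof -
  have "finite (lims X \<U>) \<and> card (lims X \<U>) < n"
  proof (rule ccontr)
    assume "\<not> ?thesis"
    then obtain A where A: "A \<subseteq> lims X \<U>" "finite A" "card A = n"
      by (metis infinite_arbitrarily_large not_less obtain_subset_with_card_n finite_subset card_ge_0_finite assms(3))
    then have "A \<subseteq> topspace X" unfolding lims_def by blast
    then obtain V where "\<forall>a\<in>A. openin X (V a) \<and> a \<in> V a" "topspace X \<inter> (\<Inter>a\<in>A. V a) = {}"
      using X A unfolding n_Hausdorff_iff by (meson order_refl)
    then show False using lims_nbhds_meet[OF U A(2,1)] by metis
  qed
  then show "finite (lims X \<U>)" "card (lims X \<U>) < n" by auto
qed

text \<open>Allows the limits of an ultrafilter that contains a whole piece to be counted inside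
  that piece.\<close>

lemma open_ultrafilter_subtopology:
  assumes U: "open_ultrafilter X \<U>" and E: "E \<in> \<U>"
  shows "open_ultrafilter (subtopology X E) {P \<in> \<U>. P \<subseteq> E}"
    and "lims (subtopology X E) {P \<in> \<U>. P \<subseteq> E} = lims X \<U> \<inter> E"
proof -
  have oE: "openin X E" using open_ultrafilterD(1)[OF U E] .
  then have op: "openin (subtopology X E) P \<longleftrightarrow> openin X P \<and> P \<subseteq> E" for P
    by (rule openin_open_subtopology)
  show "open_ultrafilter (subtopology X E) {P \<in> \<U>. P \<subseteq> E}"
    unfolding open_ultrafilter_def op
  proof (intro conjI allI ballI impI)
    fix P assume P: "openin X P \<and> P \<subseteq> E"
    show "P \<in> {P \<in> \<U>. P \<subseteq> E} \<or> (\<exists>Q\<in>{P \<in> \<U>. P \<subseteq> E}. P \<inter> Q = {})"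
    proof (cases "P \<in> \<U>")
      case False
      then obtain Q where "Q \<in> \<U>" "P \<inter> Q = {}" using open_ultrafilterD(4)[OF U] P by blast
      then have "Q \<inter> E \<in> {P \<in> \<U>. P \<subseteq> E}" "P \<inter> (Q \<inter> E) = {}"
        using open_ultrafilterD(3)[OF U] E by blast+
      then show ?thesis by blast
    qed (use P in simp)
  qed (use open_ultrafilterD[OF U] in auto)
  show "lims (subtopology X E) {P \<in> \<U>. P \<subseteq> E} = lims X \<U> \<inter> E" (is "?L = ?R")
  proof
    show "?L \<subseteq> ?R"
    proof
      fix x assume x: "x \<in> ?L"
      have "P \<in> \<U>" if P: "openin X P" "x \<in> P" for P
      proof -
        have "P \<inter> E \<in> \<U>" using x P oE unfolding lims_def op by auto
        then show ?thesis using open_ultrafilter_upward[OF U _ _ P(1)] by blast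
      qed
      then show "x \<in> ?R" using x unfolding lims_def by auto
    qed
    show "?R \<subseteq> ?L" unfolding lims_def op by auto
  qed
qed

text \<open>Since \<open>card\<close> of an infinite set is 0, for \<open>n \<ge> 2\<close> the
  equation includes the finiteness of the set of limits.\<close>

definition full_limits :: "nat \<Rightarrow> 'a topology \<Rightarrow> bool" where
  "full_limits n X \<longleftrightarrow> (\<forall>\<U>. open_ultrafilter X \<U> \<longrightarrow> card (lims X \<U>) = n - 1)"

text \<open>If the points of \<open>A\<close> cannot be separated, the open sets that contain at
  least one of \<open>n\<close> chosen points of \<open>A\<close> have the finite intersection
  property. An open ultrafilter above them converges to all \<open>n\<close> points, one too
  many.\<close>

lemma full_limits_imp_n_Hausdorff:
  assumes X: "full_limits n X" and "n \<ge> 2"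
  shows "n_Hausdorff n X"
  unfolding n_Hausdorff_iff
proof (intro allI impI, elim conjE, rule ccontr)
  fix A assume A: "A \<subseteq> topspace X" "infinite A \<or> n \<le> card A"
    and no: "\<nexists>U. (\<forall>a\<in>A. openin X (U a) \<and> a \<in> U a) \<and> topspace X \<inter> (\<Inter>a\<in>A. U a) = {}"
  obtain S where S: "S \<subseteq> A" "finite S" "card S = n"
    using A(2) \<open>n \<ge> 2\<close> by (metis infinite_arbitrarily_large obtain_subset_with_card_n finite_subset card_ge_0_finite not_numeral_le_zero gr0I)
  define \<B> where "\<B> = {P. openin X P \<and> P \<inter> S \<noteq> {}}"
  have opB: "openin X P" if "P \<in> \<B>" for P using that unfolding \<B>_def by blast
  have "topspace X \<inter> \<Inter>\<F> \<noteq> {}" if F: "finite \<F>" "\<F> \<subseteq> \<B>" for \<F>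
  proof
    assume e: "topspace X \<inter> \<Inter>\<F> = {}"
    \<comment> \<open>Every member of \<open>\<F>\<close> contains a point of \<open>S\<close>, so
      it is a factor of some \<open>U a\<close>; a common point of all \<open>U a\<close> thus lies
      in all members of \<open>\<F>\<close>.\<close>
    define U where "U a = topspace X \<inter> \<Inter>{P\<in>\<F>. a \<in> P}" for a
    have "openin X (U a) \<and> a \<in> U a" if "a \<in> A" for a
    proof
      show "openin X (U a)"
      proof (cases "{P\<in>\<F>. a \<in> P} = {}")
        case True then show ?thesis unfolding U_def by (simp add: Int_absorb2 True)
      next
        case False
        then have "openin X (\<Inter>{P\<in>\<F>. a \<in> P})" using F unfolding \<B>_def by (intro openin_Inter) auto
        then show ?thesis unfolding U_def by (intro openin_Int) auto
      qed
      show "a \<in> U a" using that A(1) unfolding U_def by auto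
    qed
    moreover have "topspace X \<inter> (\<Inter>a\<in>A. U a) \<subseteq> topspace X \<inter> \<Inter>\<F>"
      using F S(1) unfolding U_def \<B>_def by blast
    ultimately show False using no e by blast
  qed
  with opB obtain \<U> where U: "open_ultrafilter X \<U>" "\<B> \<subseteq> \<U>"
    by (rule ex_open_ultrafilter)
  then have sub: "S \<subseteq> lims X \<U>" using S(1) A(1) unfolding lims_def \<B>_def by blast
  have c: "card (lims X \<U>) = n - 1" using X U(1) unfolding full_limits_def by blast
  then have "finite (lims X \<U>)" using \<open>n \<ge> 2\<close> by (intro card_ge_0_finite) simp
  then have "n \<le> n - 1" using card_mono[OF _ sub] c S(3) by simp
  then show False using \<open>n \<ge> 2\<close> by simp
qed

lemma full_limits_imp_n_H_closed:
  fixes X :: "'a topology"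
  assumes X: "full_limits n X" and n: "n \<ge> 2"
  shows "n_H_closed n X"
  unfolding n_H_closed_def
proof (intro conjI allI impI)
  show "n_Hausdorff n X" by (rule full_limits_imp_n_Hausdorff[OF assms])
  fix Y :: "'a option topology" and f
  assume Yf: "n_Hausdorff n Y \<and> embedding_map X Y f"
  then have f: "embedding_map X Y f" by simp
  have contf: "continuous_map X Y f"
    using f homeomorphic_imp_continuous_map continuous_map_in_subtopology
    unfolding embedding_map_def by blast
  then have sub: "f ` topspace X \<subseteq> topspace Y"
    by (rule continuous_map_image_subset_topspace)
  have inj: "inj_on f (topspace X)"
    using f by (metis embedding_map_def homeomorphic_imp_injective_map)
  show "closedin Y (f ` topspace X)"
  proof (rule ccontr)
    assume ncl: "\<not> closedin Y (f ` topspace X)"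
    have "\<not> Y closure_of (f ` topspace X) \<subseteq> f ` topspace X"
      using ncl sub closure_of_subset closure_of_eq by (metis subset_antisym)
    then obtain p where p: "p \<in> Y closure_of (f ` topspace X)" "p \<notin> f ` topspace X"
      by blast
    have pY: "p \<in> topspace Y" using p(1) by (simp add: in_closure_of)
    define pre where "pre W = {x \<in> topspace X. f x \<in> W}" for W
    have opre: "openin X (pre W)" if "openin Y W" for W
      unfolding pre_def using openin_continuous_map_preimage[OF contf that] .
    define \<B> where "\<B> = pre ` {W. openin Y W \<and> p \<in> W}"
    have "topspace X \<inter> \<Inter>\<F> \<noteq> {}" if F: "finite \<F>" "\<F> \<subseteq> \<B>" for \<F>
    proof -
      obtain \<W> where W: "finite \<W>" "\<W> \<subseteq> {W. openin Y W \<and> p \<in> W}" "\<F> = pre ` \<W>"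
        using finite_subset_image[OF F(1) F(2)[unfolded \<B>_def]] by blast
      have "openin Y (topspace Y \<inter> \<Inter>\<W>)"
      proof (cases "\<W> = {}")
        case False
        then have "openin Y (\<Inter>\<W>)" using W by (intro openin_Inter) auto
        then show ?thesis by (intro openin_Int) auto
      qed auto
      moreover have "p \<in> topspace Y \<inter> \<Inter>\<W>" using W pY by blast
      ultimately obtain x where "x \<in> topspace X" "f x \<in> topspace Y \<inter> \<Inter>\<W>"
        using p(1) unfolding in_closure_of by blast
      then show ?thesis using W(3) unfolding pre_def by blast
    qed
    note fipB = this
    have "openin X P" if "P \<in> \<B>" for P using that opre unfolding \<B>_def by blast
    then obtain \<U> where U: "open_ultrafilter X \<U>" "\<B> \<subseteq> \<U>"
      using fipB by (rule ex_open_ultrafilter)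
    let ?L = "lims X \<U>"
    have cL: "card ?L = n - 1" using X U(1) unfolding full_limits_def by blast
    then have fL: "finite ?L" using n by (intro card_ge_0_finite) simp
    have LX: "?L \<subseteq> topspace X" unfolding lims_def by blast
    let ?A = "insert p (f ` ?L)"
    have "card (f ` ?L) = n - 1" using inj LX cL card_image inj_on_subset by metis
    then have "card ?A = n" using p(2) LX fL n by (subst card_insert_disjoint) auto
    moreover have "?A \<subseteq> topspace Y" using pY LX sub by blast
    ultimately obtain V where V: "\<And>a. a \<in> ?A \<Longrightarrow> openin Y (V a) \<and> a \<in> V a"
      "topspace Y \<inter> (\<Inter>a\<in>?A. V a) = {}"
      using Yf unfolding n_Hausdorff_iff by (metis order_refl)
    have "pre (V a) \<in> \<U>" if a: "a \<in> ?A" for a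
    proof (cases "a = p")
      case True
      then show ?thesis using U(2) V(1)[OF a] unfolding \<B>_def by blast
    next
      case False
      then obtain l where l: "l \<in> ?L" "a = f l" using a by blast
      then have "l \<in> pre (V a)" using V(1)[OF a] LX unfolding pre_def by blast
      then show ?thesis using l opre[of "V a"] V(1)[OF a] unfolding lims_def by blast
    qed
    then have "topspace X \<inter> \<Inter>((\<lambda>a. pre (V a)) ` ?A) \<in> \<U>"
      using fL by (intro open_ultrafilter_Inter[OF U(1)]) auto
    moreover have "topspace X \<inter> \<Inter>((\<lambda>a. pre (V a)) ` ?A) = {}"
      using V(2) sub unfolding pre_def by blast
    ultimately show False using open_ultrafilterD(2)[OF U(1)] by simp
  qed
qed

lemma full_limits_homeomorphic_map:
  assumes h: "homeomorphic_map X Y h" and X: "full_limits n X"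
  shows "full_limits n Y"
  unfolding full_limits_def
proof (intro allI impI)
  fix \<U> assume U: "open_ultrafilter Y \<U>"
  have inj: "inj_on h (topspace X)" and im: "h ` topspace X = topspace Y"
    using h by (auto simp: homeomorphic_imp_injective_map homeomorphic_imp_surjective_map)
  have op: "openin Y (h ` P) \<longleftrightarrow> openin X P" if "P \<subseteq> topspace X" for P
    using homeomorphic_map_openness[OF h that] .
  define \<V> where "\<V> = {P. P \<subseteq> topspace X \<and> h ` P \<in> \<U>}"
  have "open_ultrafilter X \<V>"
    unfolding open_ultrafilter_def
  proof (intro conjI allI ballI impI)
    fix P assume "P \<in> \<V>" then show "openin X P"
      using open_ultrafilterD(1)[OF U] op unfolding \<V>_def by blast
  next
    show "{} \<notin> \<V>" using open_ultrafilterD(2)[OF U] unfolding \<V>_def by simp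
  next
    fix P Q assume PQ: "P \<in> \<V>" "Q \<in> \<V>"
    then have "h ` (P \<inter> Q) = h ` P \<inter> h ` Q"
      using inj unfolding \<V>_def by (simp add: inj_on_image_Int)
    then show "P \<inter> Q \<in> \<V>" using PQ open_ultrafilterD(3)[OF U] unfolding \<V>_def by auto
  next
    fix P assume P: "openin X P"
    then have PX: "P \<subseteq> topspace X" by (rule openin_subset)
    show "P \<in> \<V> \<or> (\<exists>Q\<in>\<V>. P \<inter> Q = {})"
    proof (cases "h ` P \<in> \<U>")
      case True then show ?thesis using PX unfolding \<V>_def by simp
    next
      case False
      then obtain Q where Q: "Q \<in> \<U>" "h ` P \<inter> Q = {}"
        using open_ultrafilterD(4)[OF U, of "h ` P"] op[OF PX] P by blast
      have "Q \<subseteq> h ` topspace X" using open_ultrafilterD(1)[OF U Q(1)] openin_subset im by metis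
      then obtain R where "R \<subseteq> topspace X" "Q = h ` R" by (auto simp: subset_image_iff)
      then show ?thesis using Q unfolding \<V>_def by blast
    qed
  qed
  then have c: "card (lims X \<V>) = n - 1" using X unfolding full_limits_def by blast
  have "h ` lims X \<V> = lims Y \<U>"
  proof
    show "h ` lims X \<V> \<subseteq> lims Y \<U>"
    proof clarify
      fix x assume x: "x \<in> lims X \<V>"
      have "P \<in> \<U>" if P: "openin Y P" "h x \<in> P" for P
      proof -
        have "P \<subseteq> h ` topspace X" using openin_subset[OF P(1)] im by simp
        then obtain R where R: "R \<subseteq> topspace X" "P = h ` R" by (auto simp: subset_image_iff)
        then have "x \<in> R" using P(2) x inj unfolding lims_def inj_on_def by blast
        then show ?thesis using R x P op unfolding lims_def \<V>_def by blast
      qed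
      then show "h x \<in> lims Y \<U>" using x im unfolding lims_def by blast
    qed
    show "lims Y \<U> \<subseteq> h ` lims X \<V>"
    proof
      fix y assume y: "y \<in> lims Y \<U>"
      then obtain x where x: "x \<in> topspace X" "y = h x" using im unfolding lims_def by blast
      have "P \<in> \<V>" if P: "openin X P" "x \<in> P" for P
        using y x P openin_subset[OF P(1)] op unfolding lims_def \<V>_def by blast
      then show "y \<in> h ` lims X \<V>" using x unfolding lims_def by blast
    qed
  qed
  moreover have "inj_on h (lims X \<V>)" by (rule inj_on_subset[OF inj]) (auto simp: lims_def)
  ultimately show "card (lims Y \<U>) = n - 1" using c card_image by metis
qed

text \<open>The points of \<open>S\<close> catch the ultrafilters that leave every piece. With finitely many
  nonempty pieces there is no such ultrafilter, and \<open>S\<close> has to be left out.\<close>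

lemma full_limits_collect:
  assumes n: "n \<ge> 2"
    and C: "C = (\<Union>i\<in>T. E i) \<union> S" "C \<subseteq> topspace X"
    and S1: "infinite {i\<in>T. E i \<noteq> {}} \<Longrightarrow> card S = n - 1"
    and S2: "finite {i\<in>T. E i \<noteq> {}} \<Longrightarrow> S = {}"
    and E: "\<And>i. i \<in> T \<Longrightarrow> full_limits n (subtopology X (E i))"
    and opE: "\<And>i. i \<in> T \<Longrightarrow> E i \<noteq> {} \<Longrightarrow> \<exists>P. openin X P \<and> P \<inter> C = E i"
    and disj: "\<And>i k. i \<in> T \<Longrightarrow> k \<in> T \<Longrightarrow> i \<noteq> k \<Longrightarrow> E i \<inter> E k = {}"
    and av: "\<And>i. i \<in> T \<Longrightarrow> E i \<noteq> {} \<Longrightarrow> S \<noteq> {} \<Longrightarrow> \<exists>P. openin X P \<and> S \<subseteq> P \<and> P \<inter> E i = {}"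
    and lk: "\<And>P p. openin X P \<Longrightarrow> p \<in> S \<Longrightarrow> p \<in> P \<Longrightarrow> finite {i\<in>T. \<not> E i \<subseteq> P}"
  shows "full_limits n (subtopology X C)"
  unfolding full_limits_def
proof (intro allI impI)
  let ?Y = "subtopology X C"
  fix \<U> assume U: "open_ultrafilter ?Y \<U>"
  have tY: "topspace ?Y = C" using C by auto
  have oE: "openin ?Y (E i)" if "i \<in> T" for i
  proof (cases "E i = {}")
    case False
    then show ?thesis using opE[OF that] unfolding openin_subtopology by blast
  qed simp
  have EC: "E i \<subseteq> C" if "i \<in> T" for i using that C(1) by blast
  show "card (lims ?Y \<U>) = n - 1"
  proof (cases "\<exists>i\<in>T. E i \<in> \<U>")
    case True
    then obtain i where i: "i \<in> T" "E i \<in> \<U>" by blast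
    then have ne: "E i \<noteq> {}" using open_ultrafilterD(2)[OF U] by metis
    have st: "subtopology ?Y (E i) = subtopology X (E i)"
      using EC[OF i(1)] by (simp add: subtopology_subtopology Int_absorb1)
    have "card (lims ?Y \<U> \<inter> E i) = n - 1"
      using open_ultrafilter_subtopology[OF U i(2)] E[OF i(1)] unfolding st full_limits_def by metis
    moreover have "lims ?Y \<U> \<subseteq> E i"
    proof
      fix y assume y: "y \<in> lims ?Y \<U>"
      show "y \<in> E i"
      proof (rule ccontr)
        assume nE: "y \<notin> E i"
        have "y \<in> C" using y tY unfolding lims_def by blast
        have "\<exists>P. openin ?Y P \<and> y \<in> P \<and> P \<inter> E i = {}"
        proof (cases "y \<in> S")
          case True
          then obtain P where "openin X P" "S \<subseteq> P" "P \<inter> E i = {}" using av[OF i(1) ne] by blast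
          then have "openin ?Y (P \<inter> C)" "y \<in> P \<inter> C" "P \<inter> C \<inter> E i = {}"
            using True \<open>y \<in> C\<close> unfolding openin_subtopology by blast+
          then show ?thesis by blast
        next
          case False
          then obtain k where "k \<in> T" "y \<in> E k" using \<open>y \<in> C\<close> C(1) by blast
          then show ?thesis using oE disj[of k i] nE i(1) by blast
        qed
        then show False using y i(2) open_ultrafilterD(2,3)[OF U] unfolding lims_def by force
      qed
    qed
    ultimately show ?thesis by (simp add: Int_absorb2)
  next
    case False
    \<comment> \<open>From here on the ultrafilter leaves every single piece, hence any finite
      number of them.\<close>
    have esc: "\<exists>Q\<in>\<U>. Q \<inter> E i = {}" if "i \<in> T" for i
      using open_ultrafilterD(4)[OF U oE[OF that]] that False by blast
    then obtain R where R: "\<And>i. i \<in> T \<Longrightarrow> R i \<in> \<U> \<and> R i \<inter> E i = {}" by metis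
    have fin_esc: "\<exists>Q\<in>\<U>. Q \<subseteq> Q0 \<and> (\<forall>i\<in>K. Q \<inter> E i = {})"
      if K: "finite K" "K \<subseteq> T" and Q0: "Q0 \<in> \<U>" for K Q0
    proof -
      let ?Q = "topspace ?Y \<inter> \<Inter>(insert Q0 (R ` K))"
      have "?Q \<in> \<U>" using K Q0 R by (intro open_ultrafilter_Inter[OF U]) auto
      moreover have "?Q \<inter> E i = {}" if "i \<in> K" for i using R[of i] that K(2) by blast
      ultimately show ?thesis by (intro bexI[of _ ?Q]) auto
    qed
    show ?thesis
    proof (cases "finite {i\<in>T. E i \<noteq> {}}")
      case True
      then obtain Q where Q: "Q \<in> \<U>" "\<forall>i\<in>{i\<in>T. E i \<noteq> {}}. Q \<inter> E i = {}"
        using fin_esc[OF True _ open_ultrafilter_topspace[OF U]] by blast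
      have "Q \<subseteq> C" using open_ultrafilterD(1)[OF U Q(1)] openin_subset tY by metis
      then have "Q = {}" using Q(2) S2[OF True] C(1) by blast
      then show ?thesis using Q(1) open_ultrafilterD(2)[OF U] by simp
    next
      case inf: False
      have "lims ?Y \<U> = S"
      proof
        show "lims ?Y \<U> \<subseteq> S"
        proof
          fix y assume y: "y \<in> lims ?Y \<U>"
          then have "y \<in> C" using tY unfolding lims_def by blast
          moreover have "y \<notin> E i" if "i \<in> T" for i
            using y that oE[OF that] False unfolding lims_def by blast
          ultimately show "y \<in> S" using C(1) by blast
        qed
        show "S \<subseteq> lims ?Y \<U>"
        proof
          fix p assume p: "p \<in> S"
          have "P \<in> \<U>" if P: "openin ?Y P" "p \<in> P" for P
          proof (rule ccontr)
            assume "P \<notin> \<U>"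
            then obtain Q where Q: "Q \<in> \<U>" "P \<inter> Q = {}" using open_ultrafilterD(4)[OF U P(1)] by blast
            have almost: "finite {i\<in>T. \<not> E i \<subseteq> P'}" if P': "openin ?Y P'" "q \<in> P'" "q \<in> S" for P' q
            proof -
              obtain W where W: "openin X W" "P' = W \<inter> C" using P'(1) unfolding openin_subtopology by blast
              have "{i\<in>T. \<not> E i \<subseteq> P'} \<subseteq> {i\<in>T. \<not> E i \<subseteq> W}" using EC W(2) by blast
              then show ?thesis using lk[OF W(1) P'(3)] P'(2) W(2) finite_subset by blast
            qed
            obtain Q' where Q': "Q' \<in> \<U>" "Q' \<subseteq> Q" "\<And>i. i \<in> T \<Longrightarrow> \<not> E i \<subseteq> P \<Longrightarrow> Q' \<inter> E i = {}"
              using fin_esc[OF almost[OF P p] _ Q(1)] by blast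
            have em: "Q' \<inter> E i = {}" if "i \<in> T" for i using Q'(2,3)[of ] Q(2) that by blast
            \<comment> \<open>\<open>Q'\<close> misses every piece, so it is an open set of points
              of \<open>S\<close> only. But a neighbourhood of such a point swallows almost all
              pieces, and infinitely many of them are nonempty.\<close>
            have oQ': "openin ?Y Q'" using open_ultrafilterD(1)[OF U Q'(1)] .
            then have "Q' \<subseteq> S" using em C(1) openin_subset tY by blast
            moreover have "Q' \<noteq> {}" using Q'(1) open_ultrafilterD(2)[OF U] by metis
            ultimately obtain q where "q \<in> Q'" "q \<in> S" by blast
            then have "finite {i\<in>T. \<not> E i \<subseteq> Q'}" using almost[OF oQ'] by blast
            moreover have "{i\<in>T. E i \<noteq> {}} \<subseteq> {i\<in>T. \<not> E i \<subseteq> Q'}" using em by blast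
            ultimately show False using inf finite_subset by blast
          qed
          then show "p \<in> lims ?Y \<U>" using p C(1) tY unfolding lims_def by blast
        qed
      qed
      then show ?thesis using S1[OF inf] by simp
    qed
  qed
qed

text \<open>Vacuous, because the empty space has no open ultrafilter. The empty set serves as the
  piece where a link would cancel.\<close>

lemma full_limits_empty: "full_limits n (subtopology X {})"
  unfolding full_limits_def
proof (intro allI impI)
  fix \<U> assume U: "open_ultrafilter (subtopology X {}) \<U>"
  have "{} \<in> \<U>" using open_ultrafilter_topspace[OF U] by simp
  then show "card (lims (subtopology X {}) \<U>) = n - 1" using open_ultrafilterD(2)[OF U] by blast
qed

section \<open>Reduced words over a space of letters\<close>

text \<open>\<open>LD\<close> yields the limits at a centre. The pairs \<open>LS\<close>,
  \<open>LT\<close> and \<open>LB\<close>, \<open>LC\<close> yield limits two letters away from a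
  point. The step from \<open>LS j\<close> to \<open>LT j\<close> is good and that from
  \<open>LB j\<close> to \<open>LC j\<close> is bad, so each kind of limit lies among words of the
  kind that it collects.\<close>

datatype link = LD nat | LS nat | LT nat | LB nat | LC nat

fun idx :: "link \<Rightarrow> nat" where
  "idx (LD j) = j" | "idx (LS j) = j" | "idx (LT j) = j" | "idx (LB j) = j" | "idx (LC j) = j"

definition mul :: "'l list \<Rightarrow> 'l \<Rightarrow> 'l list" where
  "mul g a = (if g \<noteq> [] \<and> hd g = a then tl g else a # g)"

text \<open>The first letter of the group element is the last entry of the list, so multiplication
  on the left acts at the far end.\<close>

definition lmul :: "'l \<Rightarrow> 'l list \<Rightarrow> 'l list" where
  "lmul c w = (if w \<noteq> [] \<and> last w = c then butlast w else w @ [c])"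

lemma lmul_mul: "lmul c (mul g a) = mul (lmul c g) a"
  by (cases g) (auto simp: mul_def lmul_def)

lemma lmul_append: "g \<noteq> [] \<or> a \<noteq> c \<Longrightarrow> lmul c (u @ a # g) = u @ a # lmul c g"
  by (auto simp: lmul_def butlast_append)

text \<open>\<open>B\<close> stands for the letters of the given space; by
  \<open>open_insert_B\<close> the other letters that are not links are discrete relative to each
  other. \<open>I a\<close> contains the letters of \<open>B\<close> outside the closure of
  \<open>a\<close>, enlarged so that it is a piece by itself.\<close>

locale letters =
  fixes A :: "'l topology" and n :: nat and lk :: "link \<Rightarrow> 'l" and B :: "'l set"
    and I :: "'l \<Rightarrow> 'l set"
  assumes n2: "n \<ge> 2"
    and inj_lk: "inj lk"
    and lk_in: "idx l < n \<Longrightarrow> lk l \<in> topspace A"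
    and open_lk: "idx l < n \<Longrightarrow> (\<And>j. l \<noteq> LC j) \<Longrightarrow> openin A {lk l}"
    and open_LC: "j < n \<Longrightarrow> openin A {lk (LB j), lk (LC j)}"
    and cl_lk: "idx l < n \<Longrightarrow> (\<And>j. l \<noteq> LB j) \<Longrightarrow> A closure_of {lk l} = {lk l}"
    and cl_LB: "j < n \<Longrightarrow> A closure_of {lk (LB j)} = {lk (LB j), lk (LC j)}"
    and open_nonlk: "openin A (topspace A - lk ` {l. idx l < n})"
    and fin_cl: "a \<in> topspace A \<Longrightarrow> finite (A closure_of {a})"
    and T0: "a \<in> A closure_of {b} \<Longrightarrow> b \<in> A closure_of {a} \<Longrightarrow> a = b"
    and B_sub: "B \<subseteq> topspace A - lk ` {l. idx l < n}"
    and open_insert_B: "b \<in> topspace A - lk ` {l. idx l < n} \<Longrightarrow> openin A (insert b B)"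
    and I_sub: "a \<in> topspace A \<Longrightarrow> I a \<subseteq> topspace A - lk ` {l. idx l < n} - A closure_of {a}"
    and B_I: "a \<in> topspace A \<Longrightarrow> B - A closure_of {a} \<subseteq> I a"
    and I_full: "a \<in> topspace A \<Longrightarrow> full_limits n (subtopology A (I a))"
begin

abbreviation cl :: "'l \<Rightarrow> 'l set" where "cl a \<equiv> A closure_of {a}"

definition Lk :: "'l set" where "Lk = lk ` {l. idx l < n}"

definition W :: "'l list set" where "W = {w. set w \<subseteq> topspace A \<and> distinct_adj w}"

definition branch :: "bool \<Rightarrow> 'l list \<Rightarrow> 'l list set" where
  "branch p y = {w \<in> W. suffix y w \<and> even (length w) = p}"

text \<open>Two letters \<open>b # a\<close> make one step between points: into a copy at its
  position \<open>a\<close>, out of it at the position \<open>b\<close>. Lists of even length are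
  whole sequences of steps; in a list of odd length the last entry is unpaired and imposes
  nothing.\<close>

fun allbad :: "'l list \<Rightarrow> bool" where
  "allbad (b # a # u) \<longleftrightarrow> b \<in> cl a \<and> allbad u"
| "allbad u \<longleftrightarrow> True"

definition mbranch :: "'l list \<Rightarrow> 'l \<Rightarrow> 'l list set" where
  "mbranch h a = {u @ a # h | u. u @ a # h \<in> W \<and> odd (length u) \<and> \<not> allbad (u @ [a])}"

definition bbranch :: "'l list \<Rightarrow> 'l \<Rightarrow> 'l list set" where
  "bbranch h a = (\<Union>b\<in>cl a - {a}. branch (even (length h)) (b # a # h))"

text \<open>The head of a list is the letter added last. A word \<open>g\<close> is a point and also the centre of the
  copy \<open>{mul g a | a. a \<in> topspace A}\<close>, which consists of points of the other parity. The last three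
  conditions make \<open>g \<cdot> LD j\<close> a limit of almost all branches at the centre \<open>g\<close>, and \<open>h \<cdot> LS j \<cdot> LT j\<close> and
  \<open>h \<cdot> LB j \<cdot> LC j\<close> limits of almost all branches at the point \<open>h\<close>, restricted to the words that are
  reached from \<open>h\<close> by some good step, respectively by a bad first step. In a branch over \<open>a\<close> the
  direction back to the empty word is missing, which does not matter for "almost all".\<close>

definition word_open :: "'l list set \<Rightarrow> bool" where
  "word_open U \<longleftrightarrow> U \<subseteq> W \<and>
     (\<forall>g\<in>W. openin A {a \<in> topspace A. mul g a \<in> U}) \<and>
     (\<forall>g\<in>W. \<forall>j<n. mul g (lk (LD j)) \<in> U \<longrightarrow>
        finite {b. b # g \<in> W \<and> \<not> branch (odd (length g)) (b # g) \<subseteq> U}) \<and>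
     (\<forall>h\<in>W. \<forall>j<n. mul (mul h (lk (LS j))) (lk (LT j)) \<in> U \<longrightarrow>
        finite {a. a # h \<in> W \<and> \<not> mbranch h a \<subseteq> U}) \<and>
     (\<forall>h\<in>W. \<forall>j<n. mul (mul h (lk (LB j))) (lk (LC j)) \<in> U \<longrightarrow>
        finite {a. a # h \<in> W \<and> \<not> bbranch h a \<subseteq> U})"

definition Z :: "'l list topology" where "Z = topology word_open"

lemma word_openI:
  assumes "U \<subseteq> W"
    and "\<And>g. g \<in> W \<Longrightarrow> openin A {a \<in> topspace A. mul g a \<in> U}"
    and "\<And>g j. g \<in> W \<Longrightarrow> j < n \<Longrightarrow> mul g (lk (LD j)) \<in> U \<Longrightarrow>
        finite {b. b # g \<in> W \<and> \<not> branch (odd (length g)) (b # g) \<subseteq> U}"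
    and "\<And>h j. h \<in> W \<Longrightarrow> j < n \<Longrightarrow> mul (mul h (lk (LS j))) (lk (LT j)) \<in> U \<Longrightarrow>
        finite {a. a # h \<in> W \<and> \<not> mbranch h a \<subseteq> U}"
    and "\<And>h j. h \<in> W \<Longrightarrow> j < n \<Longrightarrow> mul (mul h (lk (LB j))) (lk (LC j)) \<in> U \<Longrightarrow>
        finite {a. a # h \<in> W \<and> \<not> bbranch h a \<subseteq> U}"
  shows "word_open U"
  using assms unfolding word_open_def by simp

lemma word_openD:
  assumes "word_open U"
  shows "U \<subseteq> W"
    and "g \<in> W \<Longrightarrow> openin A {a \<in> topspace A. mul g a \<in> U}"
    and "g \<in> W \<Longrightarrow> j < n \<Longrightarrow> mul g (lk (LD j)) \<in> U \<Longrightarrow>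
        finite {b. b # g \<in> W \<and> \<not> branch (odd (length g)) (b # g) \<subseteq> U}"
    and "h \<in> W \<Longrightarrow> j < n \<Longrightarrow> mul (mul h (lk (LS j))) (lk (LT j)) \<in> U \<Longrightarrow>
        finite {a. a # h \<in> W \<and> \<not> mbranch h a \<subseteq> U}"
    and "h \<in> W \<Longrightarrow> j < n \<Longrightarrow> mul (mul h (lk (LB j))) (lk (LC j)) \<in> U \<Longrightarrow>
        finite {a. a # h \<in> W \<and> \<not> bbranch h a \<subseteq> U}"
  using assms unfolding word_open_def by simp_all

lemma istopology_word_open: "istopology word_open"
  unfolding istopology_def
proof (intro conjI allI impI)
  fix S T assume ST: "word_open S" "word_open T"
  have fin: "finite {x. P x \<and> \<not> F x \<subseteq> S \<inter> T}"
    if "finite {x. P x \<and> \<not> F x \<subseteq> S}" "finite {x. P x \<and> \<not> F x \<subseteq> T}" for P and F :: "'l \<Rightarrow> 'l list set"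
  proof (rule finite_subset)
    show "{x. P x \<and> \<not> F x \<subseteq> S \<inter> T} \<subseteq> {x. P x \<and> \<not> F x \<subseteq> S} \<union> {x. P x \<and> \<not> F x \<subseteq> T}" by blast
  qed (use that in simp)
  show "word_open (S \<inter> T)"
  proof (rule word_openI)
    fix g assume "g \<in> W"
    have "{a \<in> topspace A. mul g a \<in> S \<inter> T} = {a \<in> topspace A. mul g a \<in> S} \<inter> {a \<in> topspace A. mul g a \<in> T}"
      by blast
    then show "openin A {a \<in> topspace A. mul g a \<in> S \<inter> T}"
      using word_openD(2)[OF ST(1) \<open>g \<in> W\<close>] word_openD(2)[OF ST(2) \<open>g \<in> W\<close>] by (simp add: openin_Int)
  qed (use word_openD[OF ST(1)] word_openD[OF ST(2)] fin in auto)
next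
  fix \<K> assume K: "\<forall>K\<in>\<K>. word_open K"
  have fin: "finite {x. P x \<and> \<not> F x \<subseteq> \<Union>\<K>}"
    if "finite {x. P x \<and> \<not> F x \<subseteq> K}" "K \<in> \<K>" for P K and F :: "'l \<Rightarrow> 'l list set"
    by (rule finite_subset[OF _ that(1)]) (use that(2) in blast)
  show "word_open (\<Union>\<K>)"
  proof (rule word_openI)
    fix g assume "g \<in> W"
    have "{a \<in> topspace A. mul g a \<in> \<Union>\<K>} = (\<Union>K\<in>\<K>. {a \<in> topspace A. mul g a \<in> K})" by blast
    then show "openin A {a \<in> topspace A. mul g a \<in> \<Union>\<K>}"
      using K word_openD(2) \<open>g \<in> W\<close> by auto
  next
    fix g j assume a: "g \<in> W" "j < n" "mul g (lk (LD j)) \<in> \<Union>\<K>"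
    then obtain K where "K \<in> \<K>" "mul g (lk (LD j)) \<in> K" by blast
    then show "finite {b. b # g \<in> W \<and> \<not> branch (odd (length g)) (b # g) \<subseteq> \<Union>\<K>}"
      using word_openD(3)[of K g j] K a by (intro fin) auto
  next
    fix g j assume a: "g \<in> W" "j < n" "mul (mul g (lk (LS j))) (lk (LT j)) \<in> \<Union>\<K>"
    then obtain K where "K \<in> \<K>" "mul (mul g (lk (LS j))) (lk (LT j)) \<in> K" by blast
    then show "finite {a. a # g \<in> W \<and> \<not> mbranch g a \<subseteq> \<Union>\<K>}"
      using word_openD(4)[of K g j] K a by (intro fin) auto
  next
    fix g j assume a: "g \<in> W" "j < n" "mul (mul g (lk (LB j))) (lk (LC j)) \<in> \<Union>\<K>"
    then obtain K where "K \<in> \<K>" "mul (mul g (lk (LB j))) (lk (LC j)) \<in> K" by blast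
    then show "finite {a. a # g \<in> W \<and> \<not> bbranch g a \<subseteq> \<Union>\<K>}"
      using word_openD(5)[of K g j] K a by (intro fin) auto
  qed (use K word_openD(1) in blast)
qed

lemma openin_Z: "openin Z U \<longleftrightarrow> word_open U"
  unfolding Z_def by (simp add: topology_inverse'[OF istopology_word_open])

lemma W_Cons: "b # g \<in> W \<longleftrightarrow> b \<in> topspace A \<and> g \<in> W \<and> (g = [] \<or> b \<noteq> hd g)"
  unfolding W_def by (cases g) auto

lemma W_suffix: "suffix y w \<Longrightarrow> w \<in> W \<Longrightarrow> y \<in> W"
  unfolding W_def suffix_def by (auto simp: distinct_adj_append_iff)

lemma W_Nil [simp]: "[] \<in> W" by (simp add: W_def)

lemma mul_in: "g \<in> W \<Longrightarrow> a \<in> topspace A \<Longrightarrow> mul g a \<in> W"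
  unfolding mul_def by (cases g) (auto simp: W_Cons)

lemma even_length_mul: "even (length (mul g a)) \<longleftrightarrow> odd (length g)"
  by (cases g) (auto simp: mul_def)

lemma branch_sub: "branch p y \<subseteq> W"
  by (auto simp: branch_def)

lemma mbranch_sub: "mbranch h a \<subseteq> W"
  by (auto simp: mbranch_def)

lemma bbranch_sub: "bbranch h a \<subseteq> W"
  by (auto simp: bbranch_def branch_def)

lemma topspace_Z [simp]: "topspace Z = W"
proof -
  have "word_open W"
  proof (rule word_openI)
    fix g assume "g \<in> W"
    then have "{a \<in> topspace A. mul g a \<in> W} = topspace A" using mul_in by auto
    then show "openin A {a \<in> topspace A. mul g a \<in> W}" by simp
  qed (simp_all add: branch_sub mbranch_sub bbranch_sub)
  then have "W \<subseteq> topspace Z" using openin_subset[of Z W] openin_Z by simp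
  moreover have "topspace Z \<subseteq> W" using word_openD(1)[of "topspace Z"] openin_Z[of "topspace Z"] by simp
  ultimately show ?thesis by (rule subset_antisym[rotated])
qed

section \<open>Left multiplication and homogeneity\<close>

lemma lmul_in: "w \<in> W \<Longrightarrow> c \<in> topspace A \<Longrightarrow> lmul c w \<in> W"
  unfolding W_def lmul_def
  by (auto simp: distinct_adj_append_iff dest: in_set_butlastD)
     (metis append_butlast_last_id distinct_adj_append_iff)

lemma lmul_lmul: "w \<in> W \<Longrightarrow> lmul c (lmul c w) = w"
  by (cases w rule: rev_cases) (auto simp: lmul_def W_def distinct_adj_append_iff butlast_append)

lemma even_length_lmul: "even (length (lmul c w)) \<longleftrightarrow> odd (length w)"
  by (cases w rule: rev_cases) (auto simp: lmul_def)

text \<open>The topology is described by heads of words, and left multiplication changes the far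
  end, so branches go to branches. Only where cancellation reaches the vertex itself can a reduced
  \<open>b # g\<close> become unreduced, and this happens for the single letter
  \<open>b = hd (lmul c g)\<close>, which "almost all" ignores.\<close>

lemma word_open_lmul:
  assumes c: "c \<in> topspace A" and U: "word_open U"
  shows "word_open {w \<in> W. lmul c w \<in> U}" (is "word_open ?V")
proof -
  have step: "lmul c (u @ b # g) = u @ b # lmul c g" if "b # g \<in> W" "b # lmul c g \<in> W" for u b g
    using that by (intro lmul_append) (auto simp: lmul_def W_Cons split: if_splits)
  have tr: "finite {b. b # g \<in> W \<and> \<not> F g b \<subseteq> ?V}"
    if g: "g \<in> W" and fin: "finite {b. b # lmul c g \<in> W \<and> \<not> F (lmul c g) b \<subseteq> U}"
      and F: "\<And>b w. w \<in> F g b \<Longrightarrow> b # g \<in> W \<Longrightarrow> b # lmul c g \<in> W \<Longrightarrow> lmul c w \<in> F (lmul c g) b"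
      and FW: "\<And>b. F g b \<subseteq> W" for g F
  proof (rule finite_subset)
    show "{b. b # g \<in> W \<and> \<not> F g b \<subseteq> ?V} \<subseteq>
        {b. b # lmul c g \<in> W \<and> \<not> F (lmul c g) b \<subseteq> U} \<union> {hd (lmul c g)}"
    proof (intro subsetI, rule ccontr)
      fix b assume b: "b \<in> {b. b # g \<in> W \<and> \<not> F g b \<subseteq> ?V}"
        and nb: "b \<notin> {b. b # lmul c g \<in> W \<and> \<not> F (lmul c g) b \<subseteq> U} \<union> {hd (lmul c g)}"
      have bW: "b # lmul c g \<in> W" using b nb lmul_in[OF g c] by (auto simp: W_Cons)
      then have "F (lmul c g) b \<subseteq> U" using nb by blast
      then have "F g b \<subseteq> ?V" using F[OF _ _ bW] FW b by blast
      then show False using b by blast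
    qed
  qed (use fin in simp)
  show ?thesis
  proof (rule word_openI)
    fix g assume g: "g \<in> W"
    have "{a \<in> topspace A. mul g a \<in> ?V} = {a \<in> topspace A. mul (lmul c g) a \<in> U}"
      using g mul_in by (auto simp: lmul_mul)
    then show "openin A {a \<in> topspace A. mul g a \<in> ?V}" using word_openD(2)[OF U lmul_in[OF g c]] by simp
  next
    fix g j assume g: "g \<in> W" "j < n" "mul g (lk (LD j)) \<in> ?V"
    show "finite {b. b # g \<in> W \<and> \<not> branch (odd (length g)) (b # g) \<subseteq> ?V}"
    proof (rule tr[of g "\<lambda>g b. branch (odd (length g)) (b # g)", OF g(1)])
      show "finite {b. b # lmul c g \<in> W \<and> \<not> branch (odd (length (lmul c g))) (b # lmul c g) \<subseteq> U}"
        using g word_openD(3)[OF U lmul_in[OF g(1) c] g(2)] by (simp add: lmul_mul)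
      show "lmul c w \<in> branch (odd (length (lmul c g))) (b # lmul c g)"
        if w: "w \<in> branch (odd (length g)) (b # g)" "b # g \<in> W" "b # lmul c g \<in> W" for b w
      proof -
        obtain u where "w = u @ b # g" using w(1) by (auto simp: branch_def suffix_def)
        then show ?thesis using w(1) step[OF w(2,3), of u] lmul_in[of w, OF _ c]
            even_length_lmul[of c w] even_length_lmul[of c g]
          by (auto simp: branch_def suffix_def)
      qed
    qed (auto simp: branch_def)
  next
    fix g j assume g: "g \<in> W" "j < n" "mul (mul g (lk (LS j))) (lk (LT j)) \<in> ?V"
    show "finite {b. b # g \<in> W \<and> \<not> mbranch g b \<subseteq> ?V}"
    proof (rule tr[of g mbranch, OF g(1)])
      show "finite {b. b # lmul c g \<in> W \<and> \<not> mbranch (lmul c g) b \<subseteq> U}"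
        using g word_openD(4)[OF U lmul_in[OF g(1) c] g(2)] by (simp add: lmul_mul)
      show "lmul c w \<in> mbranch (lmul c g) b"
        if w: "w \<in> mbranch g b" "b # g \<in> W" "b # lmul c g \<in> W" for b w
      proof -
        obtain u where "w = u @ b # g" "w \<in> W" "odd (length u)" "\<not> allbad (u @ [b])"
          using w(1) by (auto simp: mbranch_def)
        then show ?thesis using step[OF w(2,3), of u] lmul_in[OF _ c, of w]
          by (auto simp: mbranch_def)
      qed
    qed (auto simp: mbranch_def)
  next
    fix g j assume g: "g \<in> W" "j < n" "mul (mul g (lk (LB j))) (lk (LC j)) \<in> ?V"
    show "finite {b. b # g \<in> W \<and> \<not> bbranch g b \<subseteq> ?V}"
    proof (rule tr[of g bbranch, OF g(1)])
      show "finite {b. b # lmul c g \<in> W \<and> \<not> bbranch (lmul c g) b \<subseteq> U}"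
        using g word_openD(5)[OF U lmul_in[OF g(1) c] g(2)] by (simp add: lmul_mul)
      show "lmul c w \<in> bbranch (lmul c g) a"
        if w: "w \<in> bbranch g a" "a # g \<in> W" "a # lmul c g \<in> W" for a w
      proof -
        obtain b where b: "b \<in> cl a - {a}" "w \<in> branch (even (length g)) (b # a # g)"
          using w(1) unfolding bbranch_def by blast
        then obtain u where u: "w = u @ b # a # g" "w \<in> W" "b \<in> cl a - {a}"
          "even (length w) = even (length g)"
          unfolding branch_def suffix_def by blast
        have "lmul c w = u @ b # a # lmul c g" using step[OF w(2,3), of "u @ [b]"] u(1) by simp
        then show ?thesis using u lmul_in[OF u(2) c] even_length_lmul[of c w] even_length_lmul[of c g]
          by (auto simp: bbranch_def branch_def suffix_def)
      qed
    qed (auto simp: bbranch_def branch_def)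
  qed auto
qed

lemma homeomorphic_map_lmul:
  assumes "c \<in> topspace A"
  shows "homeomorphic_map Z Z (lmul c)"
proof -
  have "continuous_map Z Z (lmul c)"
    unfolding continuous_map_def using word_open_lmul[OF assms] lmul_in assms by (auto simp: openin_Z)
  then have "homeomorphic_maps Z Z (lmul c) (lmul c)"
    unfolding homeomorphic_maps_def using lmul_lmul by simp
  then show ?thesis by (rule homeomorphic_maps_imp_map)
qed

text \<open>Left multiplications strip the letters of a word one at a time, so every word can be
  moved to the empty word.\<close>

lemma homogeneous_Z: "homogeneous_space Z"
proof -
  have to_nil: "\<exists>h. homeomorphic_map Z Z h \<and> h w = []" if "w \<in> W" for w
    using that
  proof (induction w rule: rev_induct)
    case Nil
    have "homeomorphic_map Z Z id" using homeomorphic_map_id[of Z Z] by blast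
    then show ?case using id_apply by metis
  next
    case (snoc c w)
    then have c: "c \<in> topspace A" and w: "w \<in> W" by (auto simp: W_def distinct_adj_append_iff)
    then obtain h where h: "homeomorphic_map Z Z h" "h w = []" using snoc by blast
    have "homeomorphic_map Z Z (h \<circ> lmul c)"
      using homeomorphic_map_compose[OF homeomorphic_map_lmul[OF c] h(1)] .
    moreover have "(h \<circ> lmul c) (w @ [c]) = []" using h(2) by (simp add: lmul_def)
    ultimately show ?case by blast
  qed
  show ?thesis
    unfolding homogeneous_space_def
  proof (intro ballI)
    fix x y assume "x \<in> topspace Z" "y \<in> topspace Z"
    then have xy: "x \<in> W" "y \<in> W" by auto
    obtain h k where h: "homeomorphic_map Z Z h" "h x = []" and k: "homeomorphic_map Z Z k" "k y = []"
      using to_nil[OF xy(1)] to_nil[OF xy(2)] by blast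
    obtain k' where k': "homeomorphic_maps Z Z k k'" using k(1) homeomorphic_map_maps by blast
    then have "homeomorphic_map Z Z k'" by (metis homeomorphic_maps_map)
    then have "homeomorphic_map Z Z (k' \<circ> h)" by (rule homeomorphic_map_compose[OF h(1)])
    moreover have "(k' \<circ> h) x = y" using h(2) k(2) k' xy(2) by (auto simp: homeomorphic_maps_def)
    ultimately show "\<exists>h. homeomorphic_map Z Z h \<and> h x = y" by blast
  qed
qed

section \<open>A criterion for the openness of sets of even words\<close>

lemma lk_eq [simp]: "lk x = lk y \<longleftrightarrow> x = y"
  using inj_lk by (auto dest: injD)

lemma Nil_or_hd: "b # g \<in> W \<Longrightarrow> mul g b = b # g"
  by (auto simp: mul_def W_Cons)

lemma branch_Cons: "branch p (b # g) \<subseteq> branch p g"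
  unfolding branch_def using suffix_ConsD by auto

lemma branch_self: "y \<in> W \<Longrightarrow> even (length y) = p \<Longrightarrow> y \<in> branch p y"
  by (simp add: branch_def)

lemma mbranch_branch: "mbranch h a \<subseteq> branch (even (length h)) (a # h)"
  by (auto simp: mbranch_def branch_def suffix_def)

lemma bbranch_branch: "bbranch h a \<subseteq> branch (even (length h)) (a # h)"
  unfolding bbranch_def using branch_Cons by blast

text \<open>Outside \<open>T\<close> the set is all or nothing, so only the vertices in \<open>T\<close> and the edges leaving
  \<open>T\<close> have to be inspected.\<close>

lemma word_open_active:
  assumes UE: "U \<subseteq> {w \<in> W. even (length w)}"
    and reg: "\<And>y. y \<in> W \<Longrightarrow> y \<notin> T \<Longrightarrow> branch True y \<subseteq> U \<or> branch True y \<inter> U = {}"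
    and star: "\<And>g. g \<in> W \<Longrightarrow> odd (length g) \<Longrightarrow> g \<in> T \<Longrightarrow> openin A {a \<in> topspace A. mul g a \<in> U}"
    and edge: "\<And>g. g \<in> W \<Longrightarrow> odd (length g) \<Longrightarrow> g \<notin> T \<Longrightarrow> tl g \<in> T \<Longrightarrow>
      tl g \<in> U \<longleftrightarrow> branch True g \<inter> U \<noteq> {}"
    and D: "\<And>g j. g \<in> W \<Longrightarrow> odd (length g) \<Longrightarrow> g \<in> T \<Longrightarrow> j < n \<Longrightarrow> mul g (lk (LD j)) \<in> U \<Longrightarrow>
        finite {b. b # g \<in> W \<and> \<not> branch True (b # g) \<subseteq> U}"
    and S: "\<And>h j. h \<in> W \<Longrightarrow> even (length h) \<Longrightarrow> h \<in> T \<Longrightarrow> j < n \<Longrightarrow>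
        mul (mul h (lk (LS j))) (lk (LT j)) \<in> U \<Longrightarrow> finite {a. a # h \<in> W \<and> \<not> mbranch h a \<subseteq> U}"
    and S': "\<And>g j. lk (LS j) # g \<in> W \<Longrightarrow> odd (length g) \<Longrightarrow> g \<in> T \<Longrightarrow> lk (LS j) # g \<notin> T \<Longrightarrow> j < n \<Longrightarrow>
        mul g (lk (LT j)) \<in> U \<Longrightarrow> branch True (lk (LS j) # g) \<subseteq> U"
    and Bd: "\<And>h j. h \<in> W \<Longrightarrow> even (length h) \<Longrightarrow> h \<in> T \<Longrightarrow> j < n \<Longrightarrow>
        mul (mul h (lk (LB j))) (lk (LC j)) \<in> U \<Longrightarrow> finite {a. a # h \<in> W \<and> \<not> bbranch h a \<subseteq> U}"
    and Bd': "\<And>g j. lk (LB j) # g \<in> W \<Longrightarrow> odd (length g) \<Longrightarrow> g \<in> T \<Longrightarrow> lk (LB j) # g \<notin> T \<Longrightarrow> j < n \<Longrightarrow>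
        mul g (lk (LC j)) \<in> U \<Longrightarrow> branch True (lk (LB j) # g) \<subseteq> U"
  shows "openin Z U"
proof -
  \<comment> \<open>At a centre outside \<open>T\<close> the whole copy is on one side, including
    its one point \<open>h\<close> that does not lie in the branch of the centre.\<close>
  have off: "branch True g \<subseteq> U \<and> (\<forall>a\<in>topspace A. mul g a \<in> U) \<or> (\<forall>a\<in>topspace A. mul g a \<notin> U)"
    if g: "g \<in> W" "odd (length g)" "g \<notin> T" for g
  proof -
    obtain b h where bh: "g = b # h" using g(2) by (cases g) auto
    then have hW: "h \<in> W" using g(1) by (simp add: W_Cons)
    have hE: "h \<in> branch True h" using hW g(2) bh by (intro branch_self) auto
    have ch: "mul g a \<in> branch True g \<or> mul g a = h" if "a \<in> topspace A" for a
      using that g bh mul_in[OF g(1) that] by (auto simp: mul_def branch_def suffix_ConsI)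
    have sub: "branch True g \<subseteq> branch True h" unfolding bh by (rule branch_Cons)
    show ?thesis
    proof (cases "h \<in> U")
      case True
      then have "branch True g \<subseteq> U"
        using reg[OF g(1,3)] edge[OF g] reg[OF hW] hE sub bh by (cases "h \<in> T") auto
      then show ?thesis using ch True by blast
    next
      case False
      then have "branch True g \<inter> U = {}"
        using edge[OF g] reg[OF hW] hE sub bh by (cases "h \<in> T") auto
      then show ?thesis using ch False by blast
    qed
  qed
  \<comment> \<open>If \<open>h = lk \<sigma> # g\<close>, the first multiplication cancels and the
    limit is a point of the copy at \<open>g\<close>. That copy may be active although
    \<open>h\<close> is not, which is why \<open>S'\<close> and \<open>Bd'\<close> are separate
    hypotheses.\<close>
  have two: "branch True h \<subseteq> U"
    if h: "h \<in> W" "even (length h)" "h \<notin> T" "j < n" and m: "mul (mul h (lk \<sigma>)) (lk \<tau>) \<in> U"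
      and st: "\<sigma> \<noteq> \<tau>" "idx \<sigma> = j" "idx \<tau> = j"
      and e: "\<And>g. lk \<sigma> # g \<in> W \<Longrightarrow> odd (length g) \<Longrightarrow> g \<in> T \<Longrightarrow> lk \<sigma> # g \<notin> T \<Longrightarrow>
          mul g (lk \<tau>) \<in> U \<Longrightarrow> branch True (lk \<sigma> # g) \<subseteq> U" for h j \<sigma> \<tau>
  proof (rule ccontr)
    assume "\<not> branch True h \<subseteq> U"
    then have void: "branch True h \<inter> U = {}" using reg[OF h(1,3)] by blast
    have hU: "h \<notin> U" using void branch_self[OF h(1), of True] h(2) by blast
    have lkA: "lk \<sigma> \<in> topspace A" "lk \<tau> \<in> topspace A" using lk_in st h(4) by auto
    show False
    proof (cases "h \<noteq> [] \<and> hd h = lk \<sigma>")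
      case False
      then have "mul (mul h (lk \<sigma>)) (lk \<tau>) = lk \<tau> # lk \<sigma> # h" using st(1) by (auto simp: mul_def)
      moreover have "mul (mul h (lk \<sigma>)) (lk \<tau>) \<in> W" using lkA h(1) by (intro mul_in)
      ultimately have "mul (mul h (lk \<sigma>)) (lk \<tau>) \<in> branch True h"
        using h(2) by (auto simp: branch_def suffix_ConsI)
      then show False using m void by blast
    next
      case True
      then obtain g where hg: "h = lk \<sigma> # g" by (cases h) auto
      then have g: "g \<in> W" "odd (length g)" using h(1,2) by (auto simp: W_Cons)
      have mg: "mul g (lk \<tau>) \<in> U" using m hg by (simp add: mul_def)
      show False
      proof (cases "g \<in> T")
        case True
        then have "branch True h \<subseteq> U" using e[of g] mg hg h(1,3) g(2) by simp
        then show False using hU branch_self[OF h(1), of True] h(2) by blast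
      next
        case False
        then have "mul g (lk \<sigma>) \<in> U" using off[OF g False] mg lkA by blast
        moreover have "mul g (lk \<sigma>) = h" using Nil_or_hd[of "lk \<sigma>" g] h(1) hg by simp
        ultimately show False using hU by simp
      qed
    qed
  qed
  have ev: "even (length w)" if "w \<in> U" for w using UE that by blast
  have "word_open U"
  proof (rule word_openI)
    fix g assume g: "g \<in> W"
    show "openin A {a \<in> topspace A. mul g a \<in> U}"
    proof (cases "even (length g)")
      case True
      then have "mul g a \<notin> U" for a using ev[of "mul g a"] even_length_mul[of g a] by blast
      then have "{a \<in> topspace A. mul g a \<in> U} = {}" by blast
      then show ?thesis by (metis openin_empty)
    next
      case False
      show ?thesis
      proof (cases "g \<in> T")
        case nT: False
        have "{a \<in> topspace A. mul g a \<in> U} = topspace A \<or> {a \<in> topspace A. mul g a \<in> U} = {}"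
          using off[OF g False nT] by blast
        then show ?thesis by (metis openin_topspace openin_empty)
      qed (use star g False in blast)
    qed
  next
    fix g j assume g: "g \<in> W" "j < n" "mul g (lk (LD j)) \<in> U"
    then have o: "odd (length g)" using ev[OF g(3)] by (simp add: even_length_mul)
    show "finite {b. b # g \<in> W \<and> \<not> branch (odd (length g)) (b # g) \<subseteq> U}"
    proof (cases "g \<in> T")
      case False
      have "lk (LD j) \<in> topspace A" using lk_in g(2) by simp
      then have "branch True g \<subseteq> U" using off[OF g(1) o False] g(3) by metis
      then have "branch (odd (length g)) (b # g) \<subseteq> U" for b
        using o branch_Cons[of True b g] by auto
      then show ?thesis by simp
    next
      case True
      then show ?thesis using D[OF g(1) o True g(2,3)] o by simp
    qed
  next
    fix h j assume h: "h \<in> W" "j < n" "mul (mul h (lk (LS j))) (lk (LT j)) \<in> U"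
    then have e: "even (length h)" using ev[OF h(3)] by (simp add: even_length_mul)
    show "finite {a. a # h \<in> W \<and> \<not> mbranch h a \<subseteq> U}"
    proof (cases "h \<in> T")
      case False
      have "branch True h \<subseteq> U" by (rule two[OF h(1) e False h(2,3)]) (use S' h(2) in auto)
      then have "mbranch h a \<subseteq> U" for a
        using mbranch_branch[of h a] branch_Cons[of True a h] e by auto
      then show ?thesis by simp
    next
      case True
      then show ?thesis using S[OF h(1) e True h(2,3)] by simp
    qed
  next
    fix h j assume h: "h \<in> W" "j < n" "mul (mul h (lk (LB j))) (lk (LC j)) \<in> U"
    then have e: "even (length h)" using ev[OF h(3)] by (simp add: even_length_mul)
    show "finite {a. a # h \<in> W \<and> \<not> bbranch h a \<subseteq> U}"
    proof (cases "h \<in> T")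
      case False
      have "branch True h \<subseteq> U" by (rule two[OF h(1) e False h(2,3)]) (use Bd' h(2) in auto)
      then have "bbranch h a \<subseteq> U" for a
        using bbranch_branch[of h a] branch_Cons[of True a h] e by auto
      then show ?thesis by simp
    next
      case True
      then show ?thesis using Bd[OF h(1) e True h(2,3)] by simp
    qed
  qed (use UE in blast)
  then show ?thesis by (simp add: openin_Z)
qed


section \<open>Closures of letters\<close>

lemma in_cl: "b \<in> cl a \<longleftrightarrow> b \<in> topspace A \<and> (\<forall>P. openin A P \<and> b \<in> P \<longrightarrow> a \<in> P)"
  unfolding in_closure_of by auto

lemma self_cl: "a \<in> topspace A \<Longrightarrow> a \<in> cl a"
  unfolding in_cl by blast

lemma cl_trans: "b \<in> cl a \<Longrightarrow> cl b \<subseteq> cl a"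
  unfolding in_cl subset_iff by blast

lemma cl_sub: "cl a \<subseteq> topspace A"
  by (rule closure_of_subset_topspace)

lemma open_cl: "openin A (topspace A - cl a)"
  by (simp add: openin_diff)

lemma lk_cl: "idx l < n \<Longrightarrow> (\<And>j. l \<noteq> LC j) \<Longrightarrow> lk l \<in> cl a \<Longrightarrow> a = lk l"
  using open_lk unfolding in_cl by blast

lemma LC_cl: "j < n \<Longrightarrow> lk (LC j) \<in> cl a \<Longrightarrow> a = lk (LB j) \<or> a = lk (LC j)"
  using open_LC unfolding in_cl by blast

lemma nonlk_cl:
  assumes "b \<notin> Lk" "idx l < n" shows "lk l \<notin> cl b"
proof
  assume l: "lk l \<in> cl b"
  have "b \<in> Lk"
  proof (cases "\<exists>j. l = LC j")
    case True
    then show ?thesis using LC_cl l assms(2) unfolding Lk_def by fastforce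
  next
    case False
    then show ?thesis using lk_cl[OF assms(2) _ l] assms(2) unfolding Lk_def by blast
  qed
  then show False using assms(1) by simp
qed

text \<open>\<open>cl a\<close> is finite and contains the closures of its points; by T0 the closure
  of a point other than \<open>a\<close> does not contain \<open>a\<close>. So a finite union of
  closures remains.\<close>

lemma closed_Diff_cl: "a \<in> topspace A \<Longrightarrow> closedin A (cl a - {a})"
proof -
  assume a: "a \<in> topspace A"
  have "cl a - {a} = (\<Union>b\<in>cl a - {a}. cl b)"
  proof
    show "cl a - {a} \<subseteq> (\<Union>b\<in>cl a - {a}. cl b)" using self_cl cl_sub by blast
    show "(\<Union>b\<in>cl a - {a}. cl b) \<subseteq> cl a - {a}" using cl_trans T0 by blast
  qed
  then show ?thesis using fin_cl[OF a] by (metis (no_types, lifting) closedin_Union finite_Diff finite_imageI imageE closedin_closure_of)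
qed

text \<open>The letters that \<open>h\<close> need not see in the copy in which \<open>h\<close> has the position \<open>a\<close>.\<close>

definition F :: "'l \<Rightarrow> 'l set" where
  "F a = (cl a - {a}) \<union> {lk (LT j) | j. j < n \<and> a = lk (LS j)}"

lemma F_props:
  assumes "a \<in> topspace A"
  shows "finite (F a)" "closedin A (F a)" "a \<notin> F a"
    and "j < n \<Longrightarrow> lk (LS j) \<notin> F a" "j < n \<Longrightarrow> lk (LB j) \<notin> F a"
proof -
  have eq: "{lk (LT j) | j. j < n \<and> a = lk (LS j)} = (\<Union>j\<in>{j. j < n \<and> a = lk (LS j)}. cl (lk (LT j)))"
    using cl_lk by auto
  have fin: "finite {j. j < n \<and> a = lk (LS j)}" by simp
  show "closedin A (F a)" unfolding F_def eq
    using closed_Diff_cl[OF assms] fin by (intro closedin_Un closedin_Union) auto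
  show "finite (F a)" unfolding F_def using fin_cl[OF assms] by auto
  show "a \<notin> F a" unfolding F_def by auto
  show "lk (LS j) \<notin> F a" if "j < n" using lk_cl[of "LS j" a] that unfolding F_def by auto
  show "lk (LB j) \<notin> F a" if "j < n" using lk_cl[of "LB j" a] that unfolding F_def by auto
qed

text \<open>If the branches at a point \<open>h\<close> are cut in infinitely many places, the
  two-letter limits at \<open>h\<close> must be cut off too; otherwise openness would call for
  almost all branches uncut. \<open>LC j\<close> is removed as a bad exit from \<open>LB j\<close>,
  while \<open>LT j\<close> is a good exit from \<open>LS j\<close> and had to be added to
  \<open>F\<close>.\<close>

lemma links_F: "j < n \<Longrightarrow> lk (LT j) \<in> F (lk (LS j))" "j < n \<Longrightarrow> lk (LC j) \<in> F (lk (LB j))"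
  unfolding F_def using cl_LB by auto

lemma branch_nonempty: "g \<in> W \<Longrightarrow> branch p g \<noteq> {}"
proof (cases "even (length g) = p")
  case False
  assume g: "g \<in> W"
  \<comment> \<open>A letter is needed to correct the parity. As \<open>n \<ge> 2\<close>, at least
    one of \<open>LD 0\<close> and \<open>LD 1\<close> does not cancel.\<close>
  obtain j where j: "j < n" "g = [] \<or> lk (LD j) \<noteq> hd g"
  proof (cases "g \<noteq> [] \<and> hd g = lk (LD 0)")
    case True then show ?thesis using that[of 1] n2 by auto
  next
    case False then show ?thesis using that[of 0] n2 by auto
  qed
  then have "lk (LD j) # g \<in> W" using g lk_in[of "LD j"] by (auto simp: W_Cons)
  then have "lk (LD j) # g \<in> branch p g" using False by (auto simp: branch_def suffix_ConsI)
  then show ?thesis by blast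
qed (auto simp: branch_def)

lemma suffix_cmp: "suffix x w \<Longrightarrow> suffix y w \<Longrightarrow> suffix x y \<or> suffix y x"
  by (rule suffix_same_cases)

lemma suffix_eqI: "suffix x y \<Longrightarrow> length y \<le> length x \<Longrightarrow> x = y"
  by (auto simp: suffix_def)

lemma length_mul_le: "length (mul g a) \<le> Suc (length g)"
  by (auto simp: mul_def)

lemma mul_Suc: "length (mul g a) = Suc (length g) \<Longrightarrow> mul g a = a # g"
  by (auto simp: mul_def split: if_splits)

subsection \<open>Open sets of words\<close>

text \<open>A neighbourhood of the part \<open>P\<close> of the copy at \<open>g\<close>, with
  everything beyond it. Over the letters in \<open>R\<close> it misses \<open>Bad (b # g)\<close>:
  these branches are cut behind a first bad step.\<close>

definition fan :: "'l list \<Rightarrow> 'l set \<Rightarrow> 'l set \<Rightarrow> 'l list set" where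
  "fan g P R = {w \<in> W. even (length w) \<and> (\<exists>b\<in>P. suffix (b # g) w \<and>
      (b \<in> R \<longrightarrow> \<not> (\<exists>a. \<exists>c\<in>F a. suffix (c # a # b # g) w)))}"

text \<open>The hypotheses on links keep the limit conditions from demanding more than the fan
  contains. \<open>LD j\<close> in \<open>P\<close> makes almost all branches at \<open>g\<close>
  compulsory, so \<open>P\<close> must be cofinite and nothing may be cut. \<open>LT j\<close> or
  \<open>LC j\<close> in \<open>P\<close> would be a limit for the branches at a neighbouring
  point.\<close>

lemma openin_fan:
  assumes g: "g \<in> W" "odd (length g)" and P: "openin A P" "hd g \<notin> P"
    and PT: "\<And>j. j < n \<Longrightarrow> lk (LT j) \<notin> P" "\<And>j. j < n \<Longrightarrow> lk (LC j) \<notin> P"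
    and PD: "\<And>j. j < n \<Longrightarrow> lk (LD j) \<in> P \<Longrightarrow> finite (topspace A - P) \<and> R = {}"
    and R: "R \<subseteq> P - Lk"
  shows "openin Z (fan g P R)"
proof -
  have PA: "P \<subseteq> topspace A" using P(1) openin_subset by blast
  have g0: "g \<noteq> []" using g(2) by auto
  have len: "length g < length w" if "w \<in> fan g P R" for w
    using that suffix_length_le unfolding fan_def by force
  have tops: "b \<in> P" if "suffix (b # g) w" "w \<in> fan g P R" for w b
  proof -
    obtain b' where b': "b' \<in> P" "suffix (b' # g) w" using \<open>w \<in> fan g P R\<close> unfolding fan_def by blast
    then have "b # g = b' # g" using suffix_cmp[OF that(1) b'(2)] suffix_eqI by fastforce
    then show ?thesis using b'(1) by simp
  qed
  have cmp: "suffix y g \<or> (\<exists>b\<in>P. suffix (b # g) y)" if w: "w \<in> fan g P R" "suffix y w" for y w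
  proof -
    obtain b' where b': "b' \<in> P" "suffix (b' # g) w" using w(1) unfolding fan_def by blast
    then show ?thesis using suffix_cmp[OF w(2) b'(2)] by (auto simp: suffix_Cons)
  qed
  have memg: "b # g \<in> fan g P R \<longleftrightarrow> b \<in> P" for b
  proof
    show "b \<in> P" if "b # g \<in> fan g P R" using tops[OF _ that] by simp
    show "b # g \<in> fan g P R" if "b \<in> P"
    proof -
      have "b # g \<in> W" using that P(2) PA g by (auto simp: W_Cons)
      moreover have "\<not> suffix (c # a # b # g) (b # g)" for a c
        using suffix_length_le by fastforce
      ultimately show ?thesis using that g(2) unfolding fan_def by auto
    qed
  qed
  have full: "branch True y \<subseteq> fan g P R"
    if y: "suffix (b # g) y" "b \<in> P" "b \<notin> R \<or> (\<exists>a. \<exists>c. c \<notin> F a \<and> suffix (c # a # b # g) y)" for y b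
  proof
    fix w assume w: "w \<in> branch True y"
    then have sy: "suffix y w" unfolding branch_def by simp
    have "\<not> (\<exists>a. \<exists>c\<in>F a. suffix (c # a # b # g) w)" if bR: "b \<in> R"
    proof (intro notI, elim exE bexE)
      fix a' c' assume c': "c' \<in> F a'" "suffix (c' # a' # b # g) w"
      obtain a c where c: "c \<notin> F a" "suffix (c # a # b # g) y" using y(3) bR by blast
      have "c # a # b # g = c' # a' # b # g"
        using suffix_cmp[OF c'(2) suffix_order.trans[OF c(2) sy]] suffix_eqI by fastforce
      then show False using c c' by simp
    qed
    then show "w \<in> fan g P R"
      using w suffix_order.trans[OF y(1) sy] y(2) unfolding fan_def branch_def by auto
  qed
  \<comment> \<open>The cuts lie two letters beyond \<open>b # g\<close> with \<open>b\<close> in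
    \<open>R\<close>. Active are therefore the path from \<open>g\<close> back to the empty word,
    these points, and the copies at them.\<close>
  let ?T = "{y. suffix y g} \<union> {b # g | b. b \<in> R} \<union> {a # b # g | a b. b \<in> R}"
  have mulg: "length (mul y a) \<le> length g" if "suffix y g" "y \<noteq> g" for y a
  proof -
    have "length y < length g" using that suffix_eqI by (metis leI)
    then show ?thesis using length_mul_le[of y a] by simp
  qed
  have nLk: "lk l \<notin> R" if "idx l < n" for l using R that unfolding Lk_def by blast
  show ?thesis
  proof (rule word_open_active[where T = ?T])
    show "fan g P R \<subseteq> {w \<in> W. even (length w)}" unfolding fan_def by blast
  next
    fix y assume y: "y \<in> W" "y \<notin> ?T"
    show "branch True y \<subseteq> fan g P R \<or> branch True y \<inter> fan g P R = {}"
    proof (rule disjCI)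
      assume "branch True y \<inter> fan g P R \<noteq> {}"
      then obtain w where w: "w \<in> fan g P R" "suffix y w" unfolding branch_def by blast
      then obtain b where b: "b \<in> P" "suffix (b # g) y" using cmp[OF w] y(2) by blast
      show "branch True y \<subseteq> fan g P R"
      proof (cases "b \<in> R")
        case True
        obtain u where u: "y = u @ b # g" using b(2) by (auto simp: suffix_def)
        then obtain v c a where v: "y = v @ c # a # b # g"
        proof (cases u rule: rev_cases)
          case Nil then show ?thesis using u True y(2) by auto
        next
          case (snoc u' a)
          note s1 = snoc
          show ?thesis
          proof (cases u' rule: rev_cases)
            case Nil then show ?thesis using u snoc True y(2) by auto
          next
            case (snoc u'' c)
            then show ?thesis using that[of u'' c a] u s1 by simp
          qed
        qed
        then have sv: "suffix (c # a # b # g) y" by (auto simp: suffix_def)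
        have "c \<notin> F a"
        proof
          assume "c \<in> F a"
          obtain b' where b': "b' \<in> P" "suffix (b' # g) w" "b' \<in> R \<longrightarrow> \<not> (\<exists>a. \<exists>c\<in>F a. suffix (c # a # b' # g) w)"
            using w(1) unfolding fan_def by blast
          have "suffix (b # g) w" using b(2) w(2) by (rule suffix_order.trans)
          then have "b' # g = b # g" using suffix_cmp[OF b'(2), of "b # g"] suffix_eqI by fastforce
          then show False using b'(3) True \<open>c \<in> F a\<close> suffix_order.trans[OF sv w(2)] by blast
        qed
        then show ?thesis using full[OF b(2,1)] sv by blast
      qed (use full[OF b(2,1)] in blast)
    qed
  next
    fix y assume y: "y \<in> W" "odd (length y)" "y \<in> ?T"
    then consider "y = g" | "suffix y g" "y \<noteq> g" | a b where "b \<in> R" "y = a # b # g"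
      using g(2) by auto
    then show "openin A {a \<in> topspace A. mul y a \<in> fan g P R}"
    proof cases
      case 1
      have "mul g a \<in> fan g P R \<longleftrightarrow> a \<in> P" for a
      proof (cases "a = hd g")
        case True
        then have "length (mul g a) \<le> length g" using g0 by (simp add: mul_def)
        then show ?thesis using len P(2) True by force
      next
        case False
        then show ?thesis using memg by (auto simp: mul_def)
      qed
      then have "{a \<in> topspace A. mul g a \<in> fan g P R} = P" using PA by auto
      then show ?thesis using 1 P(1) by simp
    next
      case 2
      have "mul y a \<notin> fan g P R" for a using mulg[OF 2, of a] len[of "mul y a"] by auto
      then have "{a \<in> topspace A. mul y a \<in> fan g P R} = {}" by blast
      then show ?thesis by (metis openin_empty)
    next
      case 3
      have a: "a \<in> topspace A" "a \<noteq> b" using y(1) 3 by (auto simp: W_Cons)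
      have bP: "b \<in> P" using 3 R by blast
      have "mul y c \<in> fan g P R \<longleftrightarrow> c \<notin> F a" if c: "c \<in> topspace A" for c
      proof (cases "c = a")
        case True
        then show ?thesis using memg[of b] bP F_props(3)[OF a(1)] 3 by (simp add: mul_def)
      next
        case False
        then have m: "mul y c = c # a # b # g" using 3 by (simp add: mul_def)
        then have cW: "c # a # b # g \<in> W" using mul_in[OF y(1) c] by simp
        show ?thesis
        proof
          assume "mul y c \<in> fan g P R"
          then obtain b' where b': "suffix (b' # g) (c # a # b # g)" "b' \<in> R \<longrightarrow> \<not> (\<exists>a'. \<exists>c'\<in>F a'. suffix (c' # a' # b' # g) (c # a # b # g))"
            unfolding m fan_def by blast
          have "b' = b" using b'(1) suffix_length_le[of "b' # g" g] by (auto simp: suffix_Cons)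
          then show "c \<notin> F a" using b'(2) 3 by blast
        next
          assume "c \<notin> F a"
          then have "branch True (c # a # b # g) \<subseteq> fan g P R"
            by (intro full[of b] bP disjI2 exI[of _ a] exI[of _ c]) (auto simp: suffix_Cons)
          then show "mul y c \<in> fan g P R" unfolding m using branch_self[OF cW] g(2) by auto
        qed
      qed
      then have "{c \<in> topspace A. mul y c \<in> fan g P R} = topspace A - F a" by auto
      then show ?thesis using F_props(2)[OF a(1)] by (simp add: openin_diff)
    qed
  next
    fix y assume y: "y \<in> W" "odd (length y)" "y \<notin> ?T" "tl y \<in> ?T"
    then obtain a z where az: "y = a # z" by (cases y) auto
    have z: "suffix z g" "z \<noteq> g"
      using y az g(2) by (auto simp: suffix_Cons)
    have "z \<notin> fan g P R" using len[of z] suffix_length_le[OF z(1)] by auto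
    moreover have "branch True y \<inter> fan g P R = {}"
    proof (rule ccontr)
      assume "branch True y \<inter> fan g P R \<noteq> {}"
      then obtain w where w: "w \<in> fan g P R" "suffix y w" unfolding branch_def by blast
      have "\<not> suffix y g" using y(3) by blast
      then obtain b where "suffix (b # g) y" using cmp[OF w] by blast
      then have "length g \<le> length z" using az suffix_length_le by fastforce
      then show False using suffix_eqI[OF z(1)] z(2) by blast
    qed
    ultimately show "tl y \<in> fan g P R \<longleftrightarrow> branch True y \<inter> fan g P R \<noteq> {}" using az by simp
  next
    fix y j assume y: "y \<in> W" "odd (length y)" "y \<in> ?T" "j < n" "mul y (lk (LD j)) \<in> fan g P R"
    then consider "y = g" | "suffix y g" "y \<noteq> g" | a b where "b \<in> R" "y = a # b # g"
      using g(2) by auto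
    then show "finite {b. b # y \<in> W \<and> \<not> branch True (b # y) \<subseteq> fan g P R}"
    proof cases
      case 1
      then have m: "mul g (lk (LD j)) = lk (LD j) # g" using len[OF y(5)]
        by (intro mul_Suc) (metis length_mul_le le_antisym Suc_leI)
      then have "lk (LD j) \<in> P" using y(5) memg 1 by simp
      then have f: "finite (topspace A - P)" "R = {}" using PD[OF y(4)] by auto
      have "{b. b # y \<in> W \<and> \<not> branch True (b # y) \<subseteq> fan g P R} \<subseteq> topspace A - P"
        using full[of _ "_ # g"] 1 f(2) by (auto simp: W_Cons)
      then show ?thesis using f(1) finite_subset by blast
    next
      case 2
      then show ?thesis using mulg[OF 2, of "lk (LD j)"] len[OF y(5)] by simp
    next
      case 3
      have a: "a \<in> topspace A" using y(1) 3 by (auto simp: W_Cons)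
      have "{c. c # y \<in> W \<and> \<not> branch True (c # y) \<subseteq> fan g P R} \<subseteq> F a"
      proof (intro subsetI, rule ccontr)
        fix c assume c: "c \<in> {c. c # y \<in> W \<and> \<not> branch True (c # y) \<subseteq> fan g P R}" "c \<notin> F a"
        then have "branch True (c # a # b # g) \<subseteq> fan g P R"
          using 3 R by (intro full[of b] disjI2 exI[of _ a] exI[of _ c]) (auto simp: suffix_Cons)
        then show False using c 3 by simp
      qed
      then show ?thesis using F_props(1)[OF a] finite_subset by blast
    qed
  next
    \<comment> \<open>No two-letter limit of an active point lies in the fan: a limit in the copy at
      \<open>g\<close> would need \<open>lk \<tau>\<close> in \<open>P\<close>, and a limit behind a
      point over \<open>R\<close> leaves by the forbidden exit \<open>lk \<tau>\<close>.\<close>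
    have no: False
      if h: "h \<in> W" "even (length h)" "h \<in> ?T" "j < n"
        and m: "mul (mul h (lk \<sigma>)) (lk \<tau>) \<in> fan g P R"
        and st: "idx \<sigma> = j" "idx \<tau> = j" "\<sigma> \<noteq> \<tau>" "lk \<tau> \<notin> P" "lk \<tau> \<in> F (lk \<sigma>)" for h j \<sigma> \<tau>
    proof -
      consider "suffix h g" | b where "b \<in> R" "h = b # g" using h(2,3) g(2) by auto
      then show False
      proof cases
        case 1
        then have "length h < length g" using g(2) h(2) suffix_eqI by (metis leI)
        then have l: "length (mul (mul h (lk \<sigma>)) (lk \<tau>)) \<le> Suc (length g)"
          using length_mul_le[of h "lk \<sigma>"] length_mul_le[of "mul h (lk \<sigma>)" "lk \<tau>"] by simp
        have "length (mul (mul h (lk \<sigma>)) (lk \<tau>)) = Suc (length (mul h (lk \<sigma>)))"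
          using len[OF m] length_mul_le[of "mul h (lk \<sigma>)" "lk \<tau>"] length_mul_le[of h "lk \<sigma>"]
            \<open>length h < length g\<close> by simp
        then have e: "mul (mul h (lk \<sigma>)) (lk \<tau>) = lk \<tau> # mul h (lk \<sigma>)" by (rule mul_Suc)
        obtain b where b: "b \<in> P" "suffix (b # g) (lk \<tau> # mul h (lk \<sigma>))" using m e unfolding fan_def by auto
        then have "b # g = lk \<tau> # mul h (lk \<sigma>)" using l e by (intro suffix_eqI) auto
        then show False using b(1) st(4) by simp
      next
        case 2
        have "b \<noteq> lk \<sigma>" using nLk[of \<sigma>] st h(4) 2 by auto
        then have e: "mul (mul h (lk \<sigma>)) (lk \<tau>) = lk \<tau> # lk \<sigma> # b # g"
          using 2 st(3) by (auto simp: mul_def)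
        obtain b' where b': "suffix (b' # g) (lk \<tau> # lk \<sigma> # b # g)"
            "b' \<in> R \<longrightarrow> \<not> (\<exists>a'. \<exists>c'\<in>F a'. suffix (c' # a' # b' # g) (lk \<tau> # lk \<sigma> # b # g))"
          using m unfolding e fan_def by blast
        have "b' = b" using b'(1) suffix_length_le[of "b' # g" g] by (auto simp: suffix_Cons)
        then show False using b'(2) 2 st(5) by blast
      qed
    qed
    {
      fix h j assume h: "h \<in> W" "even (length h)" "h \<in> ?T" "j < n"
        "mul (mul h (lk (LS j))) (lk (LT j)) \<in> fan g P R"
      have False by (rule no[OF h]) (use PT h(4) links_F in auto)
      then show "finite {a. a # h \<in> W \<and> \<not> mbranch h a \<subseteq> fan g P R}" by blast
    next
      fix h j assume h: "h \<in> W" "even (length h)" "h \<in> ?T" "j < n"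
        "mul (mul h (lk (LB j))) (lk (LC j)) \<in> fan g P R"
      have False by (rule no[OF h]) (use PT h(4) links_F in auto)
      then show "finite {a. a # h \<in> W \<and> \<not> bbranch h a \<subseteq> fan g P R}" by blast
    }
    \<comment> \<open>At \<open>g\<close> the premise fails because \<open>lk \<tau>\<close> is not
      in \<open>P\<close>; in the copies over \<open>R\<close> the exit \<open>lk \<sigma>\<close>
      is never forbidden, so its branch is complete.\<close>
    have ok: "branch True (lk \<sigma> # y) \<subseteq> fan g P R"
      if y: "lk \<sigma> # y \<in> W" "odd (length y)" "y \<in> ?T" "j < n" and m: "mul y (lk \<tau>) \<in> fan g P R"
        and st: "idx \<sigma> = j" "idx \<tau> = j" "lk \<tau> \<notin> P" "\<And>a. a \<in> topspace A \<Longrightarrow> lk \<sigma> \<notin> F a" for y j \<sigma> \<tau>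
    proof -
      consider "suffix y g" | a b where "b \<in> R" "y = a # b # g"
        using g(2) y(2,3) by auto
      then show ?thesis
      proof cases
        case 1
        have "length (mul y (lk \<tau>)) = Suc (length y)"
          using len[OF m] length_mul_le[of y "lk \<tau>"] suffix_length_le[OF 1] by simp
        then have e: "mul y (lk \<tau>) = lk \<tau> # y" by (rule mul_Suc)
        then have "y = g" using len[OF m] suffix_length_le[OF 1] by (intro suffix_eqI 1) auto
        then show ?thesis using e m memg st(3) by simp
      next
        case 2
        have a: "a \<in> topspace A" using y(1) 2 by (auto simp: W_Cons)
        then show ?thesis unfolding 2(2)
          using 2 R st(4)[OF a] by (intro full[of b] disjI2 exI[of _ a] exI[of _ "lk \<sigma>"]) (auto simp: suffix_Cons)
      qed
    qed
    {
      fix y j assume y: "lk (LS j) # y \<in> W" "odd (length y)" "y \<in> ?T" "lk (LS j) # y \<notin> ?T" "j < n"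
        "mul y (lk (LT j)) \<in> fan g P R"
      show "branch True (lk (LS j) # y) \<subseteq> fan g P R"
        by (rule ok[OF y(1-3,5,6)]) (use PT y(5) F_props in auto)
    next
      fix y j assume y: "lk (LB j) # y \<in> W" "odd (length y)" "y \<in> ?T" "lk (LB j) # y \<notin> ?T" "j < n"
        "mul y (lk (LC j)) \<in> fan g P R"
      show "branch True (lk (LB j) # y) \<subseteq> fan g P R"
        by (rule ok[OF y(1-3,5,6)]) (use PT y(5) F_props in auto)
    }
  qed
qed

section \<open>Open sets of words with a good step\<close>

lemma allbad_append: "even (length u) \<Longrightarrow> allbad (u @ v) \<longleftrightarrow> allbad u \<and> allbad v"
  by (induction u rule: allbad.induct) auto

text \<open>Such a link is an isolated letter, hence in the closure of no other letter, and reduced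
  words do not repeat a letter.\<close>

lemma lk_bad:
  assumes "lk \<sigma> # a # y \<in> W" "idx \<sigma> < n" "\<And>j. \<sigma> \<noteq> LC j"
  shows "lk \<sigma> \<notin> cl a"
  using lk_cl[OF assms(2,3), of a] assms(1) by (auto simp: W_Cons)

definition good_part :: "'l list \<Rightarrow> 'l set \<Rightarrow> 'l list set" where
  "good_part h P = (\<Union>a\<in>P. mbranch h a)"

lemma good_part_iff:
  "w \<in> good_part h P \<longleftrightarrow> w \<in> W \<and> (\<exists>v. w = v @ h \<and> even (length v) \<and> v \<noteq> [] \<and> last v \<in> P \<and> \<not> allbad v)"
proof
  assume "w \<in> good_part h P"
  then obtain a u where "a \<in> P" "w = u @ a # h" "w \<in> W" "odd (length u)" "\<not> allbad (u @ [a])"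
    unfolding good_part_def mbranch_def by blast
  then show "w \<in> W \<and> (\<exists>v. w = v @ h \<and> even (length v) \<and> v \<noteq> [] \<and> last v \<in> P \<and> \<not> allbad v)"
    by (intro conjI exI[of _ "u @ [a]"]) auto
next
  assume w: "w \<in> W \<and> (\<exists>v. w = v @ h \<and> even (length v) \<and> v \<noteq> [] \<and> last v \<in> P \<and> \<not> allbad v)"
  then obtain v where v: "w = v @ h" "even (length v)" "v \<noteq> []" "last v \<in> P" "\<not> allbad v" by blast
  then obtain u a where ua: "v = u @ [a]" by (cases v rule: rev_cases) auto
  then show "w \<in> good_part h P" using v w unfolding good_part_def mbranch_def by auto
qed

text \<open>Once a good step has been made, everything beyond belongs to the set. In a copy that is
  entered at \<open>a0\<close> after bad steps only, the exits by a good step form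
  \<open>topspace A - cl a0\<close>, which is open and cofinite. The hypothesis \<open>PS\<close> is
  needed because \<open>LS j\<close> in \<open>P\<close> puts the two-letter limits at
  \<open>h\<close> into the set.\<close>

lemma openin_good_part:
  assumes h: "h \<in> W" "even (length h)"
    and PS: "\<And>j. j < n \<Longrightarrow> lk (LS j) \<in> P \<Longrightarrow> finite (topspace A - P)"
  shows "openin Z (good_part h P)"
proof -
  let ?U = "good_part h P"
  have up: "branch True w \<subseteq> ?U" if w: "w \<in> ?U" for w
  proof
    fix x assume x: "x \<in> branch True w"
    obtain v where v: "w = v @ h" "even (length v)" "v \<noteq> []" "last v \<in> P" "\<not> allbad v"
      using w unfolding good_part_iff by blast
    obtain u where u: "x = u @ w" using x unfolding branch_def suffix_def by blast
    then have "even (length u)" using x v h(2) unfolding branch_def by auto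
    then have "\<not> allbad (u @ v)" using v(5) allbad_append by blast
    then show "x \<in> ?U" using x u v \<open>even (length u)\<close> unfolding good_part_iff branch_def
      by (intro conjI exI[of _ "u @ v"]) auto
  qed
  have len: "length h + 2 \<le> length w" if "w \<in> ?U" for w
  proof -
    obtain v where v: "w = v @ h" "even (length v)" "v \<noteq> []" using \<open>w \<in> ?U\<close> unfolding good_part_iff by blast
    then have "2 \<le> length v" by (cases v) (auto simp: Suc_le_eq intro: gr0I)
    then show ?thesis using v(1) by simp
  qed
  have sfx: "suffix h w" if "w \<in> ?U" for w using that unfolding good_part_iff suffix_def by blast
  have app: "v @ h \<in> ?U \<longleftrightarrow> v @ h \<in> W \<and> even (length v) \<and> v \<noteq> [] \<and> last v \<in> P \<and> \<not> allbad v" for v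
    unfolding good_part_iff by auto
  \<comment> \<open>Points reached from \<open>h\<close> by bad steps only: here and in the copies
    at these points the set is neither everything nor nothing.\<close>
  let ?T2 = "{v @ h | v. even (length v) \<and> allbad v}"
  let ?T = "{y. suffix y h} \<union> ?T2 \<union> {a # y | a y. y \<in> ?T2}"
  have T_odd: "suffix y h \<or> (\<exists>a v. y = a # v @ h \<and> even (length v) \<and> allbad v)" if "odd (length y)" "y \<in> ?T" for y
    using that h(2) by auto
  have T_even: "suffix y h \<or> (\<exists>v. y = v @ h \<and> even (length v) \<and> allbad v)" if "even (length y)" "y \<in> ?T" for y
    using that h(2) by auto
  have small: "length (mul y a) < length h + 2" if "suffix y h" for y a
    using length_mul_le[of y a] suffix_length_le[OF that] by simp
  have memT: "a # a0 # v @ h \<in> ?U \<longleftrightarrow> a # a0 # v @ h \<in> W \<and> last (a0 # v) \<in> P \<and> a \<notin> cl a0"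
    if v: "even (length v)" "allbad v" for a a0 v
    using app[of "a # a0 # v"] v by auto
  show ?thesis
  proof (rule word_open_active[where T = ?T])
    show "?U \<subseteq> {w \<in> W. even (length w)}" using h(2) by (auto simp: good_part_iff)
  next
    fix y assume y: "y \<in> W" "y \<notin> ?T"
    show "branch True y \<subseteq> ?U \<or> branch True y \<inter> ?U = {}"
    proof (rule disjCI)
      assume "branch True y \<inter> ?U \<noteq> {}"
      then obtain w where w: "w \<in> ?U" "suffix y w" unfolding branch_def by blast
      then have "suffix h y" using suffix_cmp[OF sfx[OF w(1)] w(2)] y(2) by blast
      then obtain v where v: "y = v @ h" by (auto simp: suffix_def)
      obtain u where u: "w = u @ y" using w(2) by (auto simp: suffix_def)
      have uv: "even (length (u @ v))" "last (u @ v) \<in> P" "\<not> allbad (u @ v)"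
        using w(1) app[of "u @ v"] u v by auto
      have v0: "v \<noteq> []" using y(2) v by auto
      show "branch True y \<subseteq> ?U"
      proof
        fix x assume x: "x \<in> branch True y"
        then obtain u' where u': "x = u' @ v @ h" "x \<in> W" "even (length x)"
          unfolding branch_def suffix_def v by blast
        have "\<not> allbad (u' @ v)"
        proof (cases "even (length v)")
          case True
          then have "\<not> allbad v" using y(2) v by blast
          then show ?thesis using u' h(2) True allbad_append[of u' v] by auto
        next
          case False
          then obtain a v' where av: "v = a # v'" by (cases v) auto
          then have "\<not> allbad v'" using y(2) v False by auto
          then show ?thesis using u' h(2) False av allbad_append[of "u' @ [a]" v'] by auto
        qed
        then show "x \<in> ?U" using app[of "u' @ v"] u' v0 uv(2) h(2) by auto
      qed
    qed
  next
    fix g assume g: "g \<in> W" "odd (length g)" "g \<in> ?T"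
    from T_odd[OF g(2,3)] show "openin A {a \<in> topspace A. mul g a \<in> ?U}"
    proof (elim disjE exE conjE)
      assume "suffix g h"
      then have "mul g a \<notin> ?U" for a using small[of g a] len[of "mul g a"] by auto
      then have "{a \<in> topspace A. mul g a \<in> ?U} = {}" by blast
      then show ?thesis by (metis openin_empty)
    next
      fix a0 v assume v: "g = a0 # v @ h" "even (length v)" "allbad v"
      have "mul g a \<in> ?U \<longleftrightarrow> a \<notin> cl a0 \<and> last (a0 # v) \<in> P" if a: "a \<in> topspace A" for a
      proof (cases "a = a0")
        case True
        then have "mul g a = v @ h" using v(1) by (simp add: mul_def)
        then show ?thesis using app[of v] v(3) True self_cl[OF a] by simp
      next
        case False
        then have m: "mul g a = a # a0 # v @ h" using v(1) by (simp add: mul_def)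
        then show ?thesis using memT[OF v(2,3)] mul_in[OF g(1) a] by auto
      qed
      then have "{a \<in> topspace A. mul g a \<in> ?U} = (if last (a0 # v) \<in> P then topspace A - cl a0 else {})"
        by auto
      then show ?thesis using open_cl by (metis openin_empty)
    qed
  next
    fix g assume g: "g \<in> W" "odd (length g)" "g \<notin> ?T" "tl g \<in> ?T"
    then obtain a y where ay: "g = a # y" by (cases g) auto
    have nT2: "y \<notin> ?T2" using g(3) ay by blast
    have "even (length y)" "y \<in> ?T" using g(2,4) ay by simp_all
    then have y1: "suffix y h" using T_even[of y] nT2 by blast
    have "y \<noteq> h"
    proof
      assume "y = h"
      then have "y \<in> ?T2" by (intro CollectI exI[of _ "[]"]) simp
      then show False using nT2 by blast
    qed
    note y = y1 this
    have "y \<notin> ?U" using len[of y] suffix_length_le[OF y(1)] by auto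
    moreover have "branch True g \<inter> ?U = {}"
    proof (rule ccontr)
      assume "branch True g \<inter> ?U \<noteq> {}"
      then obtain w where w: "w \<in> ?U" "suffix g w" unfolding branch_def by blast
      then have "suffix h g" using suffix_cmp[OF sfx[OF w(1)] w(2)] g(3) by blast
      then have "suffix h y" using h(2) g(2) ay by (auto simp: suffix_Cons)
      then show False using y suffix_order.antisym by blast
    qed
    ultimately show "tl g \<in> ?U \<longleftrightarrow> branch True g \<inter> ?U \<noteq> {}" using ay by simp
  next
    fix g j assume g: "g \<in> W" "odd (length g)" "g \<in> ?T" "j < n" "mul g (lk (LD j)) \<in> ?U"
    from T_odd[OF g(2,3)] show "finite {b. b # g \<in> W \<and> \<not> branch True (b # g) \<subseteq> ?U}"
    proof (elim disjE exE conjE)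
      assume "suffix g h"
      then show ?thesis using small[of g "lk (LD j)"] len[OF g(5)] by simp
    next
      fix a0 v assume v: "g = a0 # v @ h" "even (length v)" "allbad v"
      have a0: "a0 \<in> topspace A" using g(1) v(1) by (simp add: W_Cons)
      have "lk (LD j) \<noteq> a0" using g(5) v app[of v] by (auto simp: mul_def)
      then have "last (a0 # v) \<in> P" using g(5) v memT[OF v(2,3)] by (simp add: mul_def)
      then have "{b. b # g \<in> W \<and> \<not> branch True (b # g) \<subseteq> ?U} \<subseteq> cl a0"
        using up memT[OF v(2,3)] v(1) by blast
      then show ?thesis using fin_cl[OF a0] finite_subset by blast
    qed
  next
    \<comment> \<open>The links do not cancel at a point reached by bad steps, since
      \<open>lk \<sigma>\<close> is isolated and hence never the exit of a bad step.\<close>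
    have key: "\<exists>v. h' = v @ h \<and> allbad v \<and> even (length v) \<and> lk \<tau> # lk \<sigma> # v @ h \<in> ?U"
      if h': "h' \<in> W" "even (length h')" "h' \<in> ?T" "j < n" and m: "mul (mul h' (lk \<sigma>)) (lk \<tau>) \<in> ?U"
        and st: "idx \<sigma> = j" "\<sigma> \<noteq> \<tau>" "\<And>j. \<sigma> \<noteq> LC j" for h' j \<sigma> \<tau>
    proof -
      have "suffix h h'"
      proof (rule ccontr)
        assume "\<not> suffix h h'"
        then have s: "suffix h' h" using T_even[OF h'(2,3)] by (auto simp: suffix_def)
        then have "length h' < length h" using \<open>\<not> suffix h h'\<close> suffix_eqI[OF s] by (metis leI suffix_order.refl)
        then have "length h' + 2 \<le> length h" using h(2) h'(2) by presburger
        then show False using len[OF m] length_mul_le[of "mul h' (lk \<sigma>)" "lk \<tau>"] length_mul_le[of h' "lk \<sigma>"]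
          by (auto simp: mul_def split: if_splits)
      qed
      then obtain v where v: "h' = v @ h" by (auto simp: suffix_def)
      have vb: "even (length v)" "allbad v"
        using T_even[OF h'(2,3)] v h(2) h'(2) by (auto dest: suffix_length_le)
      have "\<not> (h' \<noteq> [] \<and> hd h' = lk \<sigma>)"
      proof
        assume hd: "h' \<noteq> [] \<and> hd h' = lk \<sigma>"
        show False
        proof (cases v)
          case Nil
          then have "length (mul h' (lk \<sigma>)) < length h" using hd v by (simp add: mul_def)
          then show False using len[OF m] length_mul_le[of "mul h' (lk \<sigma>)" "lk \<tau>"] by simp
        next
          case (Cons s v')
          then obtain a v'' where "v' = a # v''" using vb(1) by (cases v') auto
          then show False using vb(2) hd v Cons lk_bad[of \<sigma> a "v'' @ h"] h'(1,4) st(1,3) by auto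
        qed
      qed
      then have "mul (mul h' (lk \<sigma>)) (lk \<tau>) = lk \<tau> # lk \<sigma> # v @ h" using st(2) v by (auto simp: mul_def)
      then show ?thesis using m v vb by auto
    qed
    {
      fix h' j assume h': "h' \<in> W" "even (length h')" "h' \<in> ?T" "j < n"
        "mul (mul h' (lk (LS j))) (lk (LT j)) \<in> ?U"
      obtain v where v: "h' = v @ h" "allbad v" "even (length v)" "lk (LT j) # lk (LS j) # v @ h \<in> ?U"
        using key[OF h'] by auto
      show "finite {a. a # h' \<in> W \<and> \<not> mbranch h' a \<subseteq> ?U}"
      proof (cases "v = []")
        case True
        then have "lk (LS j) \<in> P" using v(4) memT[of "[]"] by simp
        then have f: "finite (topspace A - P)" using PS h'(4) by blast
        have "{a. a # h' \<in> W \<and> \<not> mbranch h' a \<subseteq> ?U} \<subseteq> topspace A - P"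
          using v(1) True unfolding good_part_def by (auto simp: W_Cons)
        then show ?thesis using f finite_subset by blast
      next
        case False
        then have lv: "last v \<in> P" using v(4) memT[OF v(3,2), of "lk (LT j)" "lk (LS j)"] by simp
        have "mbranch h' a \<subseteq> ?U" for a
        proof
          fix w assume "w \<in> mbranch h' a"
          then obtain u where u: "w = u @ a # h'" "w \<in> W" "odd (length u)" "\<not> allbad (u @ [a])"
            unfolding mbranch_def by blast
          then have "\<not> allbad ((u @ [a]) @ v)" using allbad_append[of "u @ [a]" v] by simp
          then show "w \<in> ?U" using app[of "u @ a # v"] u v False lv by simp
        qed
        then show ?thesis by simp
      qed
    next
      fix h' j assume h': "h' \<in> W" "even (length h')" "h' \<in> ?T" "j < n"
        "mul (mul h' (lk (LB j))) (lk (LC j)) \<in> ?U"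
      obtain v where v: "h' = v @ h" "allbad v" "even (length v)" "lk (LC j) # lk (LB j) # v @ h \<in> ?U"
        using key[OF h'] by auto
      \<comment> \<open>The step from \<open>LB j\<close> to \<open>LC j\<close> is bad, so this
        kind of limit never belongs to the set and demands nothing.\<close>
      then have "lk (LC j) \<notin> cl (lk (LB j))" using memT[OF v(3,2)] by blast
      then show "finite {a. a # h' \<in> W \<and> \<not> bbranch h' a \<subseteq> ?U}" using cl_LB h'(4) by blast
    }
    have ok: "branch True (lk \<sigma> # g) \<subseteq> ?U"
      if g: "lk \<sigma> # g \<in> W" "odd (length g)" "g \<in> ?T" "j < n" and m: "mul g (lk \<tau>) \<in> ?U"
        and st: "idx \<sigma> = j" "\<And>j. \<sigma> \<noteq> LC j" for g j \<sigma> \<tau>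
      using T_odd[OF g(2,3)]
    proof (elim disjE exE conjE)
      assume "suffix g h"
      then show ?thesis using small[of g "lk \<tau>"] len[OF m] by simp
    next
      fix a0 v assume v: "g = a0 # v @ h" "even (length v)" "allbad v"
      have "lk \<tau> \<noteq> a0" using m v app[of v] by (auto simp: mul_def)
      then have "last (a0 # v) \<in> P" using m v memT[OF v(2,3)] by (simp add: mul_def)
      moreover have "lk \<sigma> \<notin> cl a0" using lk_bad[of \<sigma> a0] g(1,4) v(1) st by auto
      ultimately show ?thesis using memT[OF v(2,3)] g(1) v(1) up by auto
    qed
    {
      fix g j assume g: "lk (LS j) # g \<in> W" "odd (length g)" "g \<in> ?T" "lk (LS j) # g \<notin> ?T" "j < n"
        "mul g (lk (LT j)) \<in> ?U"
      show "branch True (lk (LS j) # g) \<subseteq> ?U" by (rule ok[OF g(1-3,5,6)]) auto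
    next
      fix g j assume g: "lk (LB j) # g \<in> W" "odd (length g)" "g \<in> ?T" "lk (LB j) # g \<notin> ?T" "j < n"
        "mul g (lk (LC j)) \<in> ?U"
      show "branch True (lk (LB j) # g) \<subseteq> ?U" by (rule ok[OF g(1-3,5,6)]) auto
    }
  qed
qed

section \<open>Trimming the branches at a point\<close>

definition trim :: "'l list \<Rightarrow> bool \<Rightarrow> ('l \<Rightarrow> 'l set) \<Rightarrow> 'l list set" where
  "trim y \<beta> E = {w \<in> W. even (length w) \<and> (\<beta> \<or> suffix y w) \<and> \<not> (\<exists>a. \<exists>b\<in>E a. suffix (b # a # y) w)}"

text \<open>With \<open>\<beta>\<close> the set extends over the rest of the tree. This fails if
  \<open>hd y\<close> is an \<open>LS\<close> or \<open>LB\<close> link: a limit at \<open>y\<close>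
  then lies in the copy below \<open>y\<close>, belongs to the set, and demands almost all branches
  at \<open>y\<close>. Without \<open>\<beta>\<close> the set stays above \<open>y\<close>, which
  requires \<open>y\<close> to be isolated in the copy below. By \<open>Ef\<close>, either few
  branches are trimmed or the limits behind \<open>y\<close> are trimmed away as well.\<close>

lemma openin_trim:
  assumes y: "y \<in> W" "even (length y)"
    and E: "\<And>a. a \<in> topspace A \<Longrightarrow> finite (E a) \<and> closedin A (E a) \<and> a \<notin> E a"
    and El: "\<And>a j. j < n \<Longrightarrow> lk (LS j) \<notin> E a \<and> lk (LB j) \<notin> E a"
    and Ef: "finite {a. E a \<noteq> {}} \<or> (\<forall>j<n. lk (LT j) \<in> E (lk (LS j)) \<and> lk (LC j) \<in> E (lk (LB j)))"
    and b0: "\<not> \<beta> \<Longrightarrow> y \<noteq> [] \<and> openin A {hd y} \<and>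
        (\<forall>j<n. hd y \<noteq> lk (LD j) \<and> hd y \<noteq> lk (LT j) \<and> hd y \<noteq> lk (LC j))"
    and b1: "\<beta> \<Longrightarrow> y = [] \<or> (\<forall>j<n. hd y \<noteq> lk (LS j) \<and> hd y \<noteq> lk (LB j))"
  shows "openin Z (trim y \<beta> E)"
proof -
  let ?U = "trim y \<beta> E"
  have shorter: "\<not> suffix (b # a # y) w" if "length w < length y + 2" for w a b
    using that suffix_length_le[of "b # a # y" w] by auto
  have mem_short: "w \<in> ?U \<longleftrightarrow> w \<in> W \<and> even (length w) \<and> (\<beta> \<or> suffix y w)" if "length w < length y + 2" for w
    unfolding trim_def using shorter[OF that] by blast
  have mem2: "b # a # y \<in> ?U \<longleftrightarrow> b # a # y \<in> W \<and> b \<notin> E a" for a b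
    unfolding trim_def using y(2) by (auto simp: suffix_Cons dest: suffix_length_le)
  have full2: "branch True (b # a # y) \<subseteq> ?U" if "b \<notin> E a" for a b
  proof
    fix w assume w: "w \<in> branch True (b # a # y)"
    have "\<not> suffix (b' # a' # y) w" if "b' \<in> E a'" for a' b'
    proof
      assume "suffix (b' # a' # y) w"
      then have "b' # a' # y = b # a # y"
        using w suffix_cmp[of "b' # a' # y" w "b # a # y"] suffix_eqI[of _ "b # a # y"] suffix_eqI[of _ "b' # a' # y"]
        unfolding branch_def by fastforce
      then show False using that \<open>b \<notin> E a\<close> by simp
    qed
    then show "w \<in> ?U" using w unfolding trim_def branch_def by (auto dest: suffix_ConsD)
  qed
  have off: "branch True z \<subseteq> ?U" if z: "\<not> suffix z y" "\<not> suffix y z" "\<beta>" for z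
  proof
    fix w assume w: "w \<in> branch True z"
    have "\<not> suffix y w" using suffix_cmp[of z w y] w z unfolding branch_def by blast
    then have "\<not> suffix (b # a # y) w" for a b by (meson suffix_ConsD)
    then show "w \<in> ?U" using w z(3) unfolding trim_def branch_def by auto
  qed
  have off0: "branch True z \<inter> ?U = {}" if z: "\<not> suffix z y" "\<not> suffix y z" "\<not> \<beta>" for z
    using suffix_cmp[of z _ y] z unfolding trim_def branch_def by blast
  have one: "finite {b. suffix (b # g) y}" for g
  proof (rule finite_subset)
    show "{b. suffix (b # g) y} \<subseteq> {y ! (length y - Suc (length g))}" by (auto simp: suffix_def)
  qed simp
  let ?T = "{z. suffix z y} \<union> {a # y | a. True}"
  have T_even: "suffix z y" if "even (length z)" "z \<in> ?T" for z using that y(2) by auto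
  have T_odd: "(suffix z y \<and> length z < length y) \<or> (\<exists>a. z = a # y)" if z: "odd (length z)" "z \<in> ?T" for z
  proof (cases "suffix z y")
    case True
    then have "length z \<noteq> length y" using z(1) y(2) by auto
    then show ?thesis using suffix_length_le[OF True] True by auto
  qed (use that in blast)
  have lenmul: "length (mul z a) < length y + 2" if "length z \<le> length y" for z a
    using length_mul_le[of z a] that by simp
  have hd_mul: "a = hd y \<and> z = tl y" if "length z < length y" "suffix y (mul z a)" for z a
  proof -
    have l: "length (mul z a) = Suc (length z)" "length y = Suc (length z)"
      using length_mul_le[of z a] suffix_length_le[OF that(2)] that(1) by auto
    then have "y = a # z" using mul_Suc[OF l(1)] suffix_eqI[OF that(2)] by simp
    then show ?thesis by simp
  qed
  show ?thesis
  proof (rule word_open_active[where T = ?T])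
    show "?U \<subseteq> {w \<in> W. even (length w)}" unfolding trim_def by blast
  next
    fix z assume z: "z \<in> W" "z \<notin> ?T"
    show "branch True z \<subseteq> ?U \<or> branch True z \<inter> ?U = {}"
    proof (cases "suffix y z")
      case False
      then show ?thesis using off[of z] off0[of z] z(2) by (cases \<beta>) auto
    next
      case True
      then obtain u where u: "z = u @ y" by (auto simp: suffix_def)
      obtain v b a where v: "z = v @ b # a # y"
      proof (cases u rule: rev_cases)
        case Nil then show ?thesis using u z(2) by auto
      next
        case (snoc u' a)
        note s1 = snoc
        show ?thesis
        proof (cases u' rule: rev_cases)
          case Nil then show ?thesis using u snoc z(2) by auto
        next
          case (snoc u'' b)
          then show ?thesis using that[of u'' b a] u s1 by simp
        qed
      qed
      then have sz: "suffix (b # a # y) z" by (auto simp: suffix_def)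
      have sub: "branch True z \<subseteq> branch True (b # a # y)"
        unfolding branch_def using suffix_order.trans[OF sz] by blast
      show ?thesis
      proof (cases "b \<in> E a")
        case True
        then show ?thesis using suffix_order.trans[OF sz] unfolding trim_def branch_def by blast
      next
        case False
        then show ?thesis using full2 sub by blast
      qed
    qed
  next
    fix g assume g: "g \<in> W" "odd (length g)" "g \<in> ?T"
    from T_odd[OF g(2,3)] show "openin A {a \<in> topspace A. mul g a \<in> ?U}"
    proof (elim disjE exE conjE)
      assume s: "suffix g y" "length g < length y"
      have m: "mul g a \<in> ?U \<longleftrightarrow> \<beta> \<or> suffix y (mul g a)" if "a \<in> topspace A" for a
        using mem_short[of "mul g a"] lenmul[of g a] s mul_in[OF g(1) that] even_length_mul[of g a] g(2) by simp
      show ?thesis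
      proof (cases \<beta>)
        case True
        then have "{a \<in> topspace A. mul g a \<in> ?U} = topspace A" using m by blast
        then show ?thesis by simp
      next
        case False
        have y0: "y \<noteq> []" using b0[OF False] by simp
        have "suffix y (mul g a) \<longleftrightarrow> a = hd y \<and> g = tl y" for a
        proof
          assume "a = hd y \<and> g = tl y"
          then have "mul g a = y" using Nil_or_hd[of "hd y" "tl y"] y0 y(1) by simp
          then show "suffix y (mul g a)" by simp
        qed (rule hd_mul[OF s(2)])
        moreover have "hd y \<in> topspace A" using y0 y(1) by (cases y) (auto simp: W_Cons)
        ultimately have "{a \<in> topspace A. mul g a \<in> ?U} = (if g = tl y then {hd y} else {})"
          using m False by auto
        then show ?thesis using b0[OF False] by (metis openin_empty)
      qed
    next
      fix a0 assume a0: "g = a0 # y"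
      then have a0A: "a0 \<in> topspace A" using g(1) by (simp add: W_Cons)
      have "mul g a \<in> ?U \<longleftrightarrow> a \<notin> E a0" if "a \<in> topspace A" for a
      proof (cases "a = a0")
        case True
        then show ?thesis using a0 mem_short[of y] y E[OF a0A] by (simp add: mul_def)
      next
        case False
        then have "mul g a = a # a0 # y" using a0 by (simp add: mul_def)
        then show ?thesis using mem2 mul_in[OF g(1) that] by metis
      qed
      then have "{a \<in> topspace A. mul g a \<in> ?U} = topspace A - E a0" by blast
      then show ?thesis using E[OF a0A] by (simp add: openin_diff)
    qed
  next
    fix g assume g: "g \<in> W" "odd (length g)" "g \<notin> ?T" "tl g \<in> ?T"
    then obtain a z where az: "g = a # z" by (cases g) auto
    have z: "suffix z y" using T_even[of z] g az by simp
    have zy: "z \<noteq> y" using g(3) az by blast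
    then have l: "length z < length y" using suffix_eqI[OF z] by (metis leI)
    have "z \<in> ?U \<longleftrightarrow> \<beta>" using mem_short[of z] l W_suffix[OF z y(1)] g(2) az by (auto dest: suffix_length_le)
    moreover have "\<not> suffix g y" using g(3) by blast
    moreover have "\<not> suffix y g" using az l g(2) y(2) zy z by (auto simp: suffix_Cons dest: suffix_length_le)
    ultimately show "tl g \<in> ?U \<longleftrightarrow> branch True g \<inter> ?U \<noteq> {}"
      using off[of g] off0[of g] branch_nonempty[OF g(1), of True] az by (cases \<beta>) auto
  next
    fix g j assume g: "g \<in> W" "odd (length g)" "g \<in> ?T" "j < n" "mul g (lk (LD j)) \<in> ?U"
    from T_odd[OF g(2,3)] show "finite {b. b # g \<in> W \<and> \<not> branch True (b # g) \<subseteq> ?U}"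
    proof (elim disjE exE conjE)
      assume s: "suffix g y" "length g < length y"
      have \<beta>: "\<beta>"
      proof (rule ccontr)
        assume nb: "\<not> \<beta>"
        then have "suffix y (mul g (lk (LD j)))" using g(5) unfolding trim_def by blast
        then show False using hd_mul[OF s(2)] b0[OF nb] g(4) by metis
      qed
      have "{b. b # g \<in> W \<and> \<not> branch True (b # g) \<subseteq> ?U} \<subseteq> {b. suffix (b # g) y}"
      proof (intro subsetI CollectI, rule ccontr)
        fix b assume b: "b \<in> {b. b # g \<in> W \<and> \<not> branch True (b # g) \<subseteq> ?U}" "\<not> suffix (b # g) y"
        have "\<not> suffix y (b # g)"
        proof
          assume "suffix y (b # g)"
          then have "y = b # g" using s(2) by (intro suffix_eqI) auto
          then show False using b(2) by simp
        qed
        then show False using off[OF b(2) _ \<beta>] b(1) by blast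
      qed
      then show ?thesis using one finite_subset by blast
    next
      fix a0 assume a0: "g = a0 # y"
      then have a0A: "a0 \<in> topspace A" using g(1) by (simp add: W_Cons)
      have "{b. b # g \<in> W \<and> \<not> branch True (b # g) \<subseteq> ?U} \<subseteq> E a0" using full2 a0 by blast
      then show ?thesis using E[OF a0A] finite_subset by blast
    qed
  next
    \<comment> \<open>At \<open>y\<close> a limit can lie in the set only if few branches are
      trimmed. At a point strictly below \<open>y\<close>, all branches but the one towards
      \<open>y\<close> are untouched, provided that \<open>\<beta>\<close> holds.\<close>
    have key: "(h = y \<and> finite {a. E a \<noteq> {}}) \<or> (\<beta> \<and> h \<noteq> y)"
      if h: "h \<in> W" "even (length h)" "h \<in> ?T" "j < n" and m: "mul (mul h (lk \<sigma>)) (lk \<tau>) \<in> ?U"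
        and st: "\<sigma> \<noteq> \<tau>" "\<beta> \<Longrightarrow> y = [] \<or> hd y \<noteq> lk \<sigma>"
          "finite {a. E a \<noteq> {}} \<or> lk \<tau> \<in> E (lk \<sigma>)" "\<not> \<beta> \<Longrightarrow> hd y \<noteq> lk \<tau>" for h j \<sigma> \<tau>
    proof (cases "h = y")
      case True
      have "\<not> (y \<noteq> [] \<and> hd y = lk \<sigma>)"
      proof
        assume hd: "y \<noteq> [] \<and> hd y = lk \<sigma>"
        then have nb: "\<not> \<beta>" using st(2) by blast
        have "mul y (lk \<sigma>) = tl y" using hd by (simp add: mul_def)
        then have "suffix y (mul (tl y) (lk \<tau>))" using m True nb unfolding trim_def by simp
        then show False using hd_mul[of "tl y"] hd st(4)[OF nb] by (metis length_tl diff_less length_greater_0_conv zero_less_one)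
      qed
      then have "mul (mul h (lk \<sigma>)) (lk \<tau>) = lk \<tau> # lk \<sigma> # y" using True st(1) by (auto simp: mul_def)
      then show ?thesis using m mem2 st(3) True by auto
    next
      case False
      then have "length h < length y" using T_even[OF h(2,3)] suffix_eqI by (metis leI)
      then have l: "length h + 2 \<le> length y" using h(2) y(2) by presburger
      have \<beta>
      proof (rule ccontr)
        assume nb: "\<not> \<beta>"
        then have "suffix y (mul (mul h (lk \<sigma>)) (lk \<tau>))" using m unfolding trim_def by blast
        then show False using hd_mul[of "mul h (lk \<sigma>)"] length_mul_le[of h "lk \<sigma>"] l st(4)[OF nb] by fastforce
      qed
      then show ?thesis using False by simp
    qed
    have fin: "finite {a. a # h \<in> W \<and> \<not> Q a \<subseteq> ?U}"
      if c: "(h = y \<and> finite {a. E a \<noteq> {}}) \<or> (\<beta> \<and> h \<noteq> y)"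
        and h: "h \<in> W" "even (length h)" "h \<in> ?T" and Q: "\<And>a. Q a \<subseteq> branch True (a # h)"
      for h and Q :: "'l \<Rightarrow> 'l list set"
      using c
    proof (elim disjE conjE)
      assume a: "h = y" "finite {a. E a \<noteq> {}}"
      have "branch True (a # y) \<subseteq> ?U" if Ea: "E a = {}" for a
      proof
        fix w assume w: "w \<in> branch True (a # y)"
        \<comment> \<open>The parity of \<open>w\<close> forces a further letter \<open>b\<close>
          beyond \<open>a\<close>, to which \<open>full2\<close> applies.\<close>
        obtain u where u: "w = u @ a # y" using w by (auto simp: branch_def suffix_def)
        then obtain u' b where "u = u' @ [b]" using w y(2) by (cases u rule: rev_cases) (auto simp: branch_def)
        then have "w \<in> branch True (b # a # y)" using w u by (auto simp: branch_def suffix_def)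
        then show "w \<in> ?U" using full2[of b a] Ea by blast
      qed
      then have "{a. a # h \<in> W \<and> \<not> Q a \<subseteq> ?U} \<subseteq> {a. E a \<noteq> {}}" using Q a(1) by blast
      then show ?thesis using a(2) finite_subset by blast
    next
      assume a: "\<beta>" "h \<noteq> y"
      have s1: "suffix h y" using T_even[OF h(2,3)] .
      then have s: "suffix h y" "length h < length y" using suffix_eqI[OF s1] a(2) by (auto simp: not_le[symmetric])
      have "{a. a # h \<in> W \<and> \<not> Q a \<subseteq> ?U} \<subseteq> {a. suffix (a # h) y}"
      proof (intro subsetI CollectI, rule ccontr)
        fix b assume b: "b \<in> {a. a # h \<in> W \<and> \<not> Q a \<subseteq> ?U}" "\<not> suffix (b # h) y"
        have "\<not> suffix y (b # h)"
        proof
          assume "suffix y (b # h)"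
          then have "y = b # h" using s(2) by (intro suffix_eqI) auto
          then show False using b(2) by simp
        qed
        then show False using off[OF b(2) _ a(1)] b(1) Q by blast
      qed
      then show ?thesis using one finite_subset by blast
    qed
    {
      fix h j assume h: "h \<in> W" "even (length h)" "h \<in> ?T" "j < n"
        "mul (mul h (lk (LS j))) (lk (LT j)) \<in> ?U"
      have "(h = y \<and> finite {a. E a \<noteq> {}}) \<or> (\<beta> \<and> h \<noteq> y)"
        by (rule key[OF h]) (use b0 b1 Ef h(4) in auto)
      then show "finite {a. a # h \<in> W \<and> \<not> mbranch h a \<subseteq> ?U}"
        using mbranch_branch[of h] h(2) by (intro fin h) auto
    next
      fix h j assume h: "h \<in> W" "even (length h)" "h \<in> ?T" "j < n"
        "mul (mul h (lk (LB j))) (lk (LC j)) \<in> ?U"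
      have "(h = y \<and> finite {a. E a \<noteq> {}}) \<or> (\<beta> \<and> h \<noteq> y)"
        by (rule key[OF h]) (use b0 b1 Ef h(4) in auto)
      then show "finite {a. a # h \<in> W \<and> \<not> bbranch h a \<subseteq> ?U}"
        using bbranch_branch[of h] h(2) by (intro fin h) auto
    }
    have ok: "branch True (lk \<sigma> # g) \<subseteq> ?U"
      if g: "lk \<sigma> # g \<in> W" "odd (length g)" "g \<in> ?T" "lk \<sigma> # g \<notin> ?T" and m: "mul g (lk \<tau>) \<in> ?U"
        and st: "\<And>a. lk \<sigma> \<notin> E a" "\<not> \<beta> \<Longrightarrow> hd y \<noteq> lk \<tau>" for g \<sigma> \<tau>
      using T_odd[OF g(2,3)]
    proof (elim disjE exE conjE)
      assume s: "suffix g y" "length g < length y"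
      have \<beta>
      proof (rule ccontr)
        assume nb: "\<not> \<beta>"
        then have "suffix y (mul g (lk \<tau>))" using m unfolding trim_def by blast
        then show False using hd_mul[OF s(2)] st(2)[OF nb] by metis
      qed
      moreover have n1: "\<not> suffix (lk \<sigma> # g) y" using g(4) by blast
      moreover have "\<not> suffix y (lk \<sigma> # g)"
      proof
        assume "suffix y (lk \<sigma> # g)"
        then have "y = lk \<sigma> # g" using s(2) by (intro suffix_eqI) auto
        then show False using n1 by simp
      qed
      ultimately show ?thesis using off by blast
    next
      fix a0 assume "g = a0 # y"
      then show ?thesis using full2 st(1) by simp
    qed
    {
      fix g j assume g: "lk (LS j) # g \<in> W" "odd (length g)" "g \<in> ?T" "lk (LS j) # g \<notin> ?T" "j < n"
        "mul g (lk (LT j)) \<in> ?U"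
      show "branch True (lk (LS j) # g) \<subseteq> ?U" by (rule ok[OF g(1-4,6)]) (use El b0 g(5) in auto)
    next
      fix g j assume g: "lk (LB j) # g \<in> W" "odd (length g)" "g \<in> ?T" "lk (LB j) # g \<notin> ?T" "j < n"
        "mul g (lk (LC j)) \<in> ?U"
      show "branch True (lk (LB j) # g) \<subseteq> ?U" by (rule ok[OF g(1-4,6)]) (use El b0 g(5) in auto)
    }
  qed
qed


abbreviation FL :: "'l list set \<Rightarrow> bool" where "FL C \<equiv> full_limits n (subtopology Z C)"

lemma lk_Lk: "idx l < n \<Longrightarrow> lk l \<in> Lk"
  unfolding Lk_def by blast

lemma openin_nonLk: "openin A (topspace A - Lk)"
  using open_nonlk unfolding Lk_def .

subsection \<open>Collecting pieces\<close>

definition pick :: "nat \<Rightarrow> (nat \<Rightarrow> link) \<Rightarrow> 'l list \<Rightarrow> nat set" where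
  "pick m f w = (SOME J. J \<subseteq> {..<n} \<and> card J = m \<and> (\<forall>j\<in>J. lk (f j) # w \<in> W))"

text \<open>Of the \<open>n\<close> links \<open>f j\<close> at most one equals the head of
  \<open>w\<close> and would cancel, so \<open>n - 1\<close> are always available.\<close>

lemma pick:
  assumes w: "w \<in> W" and m: "m \<le> n - 1" and f: "\<And>j. idx (f j) = j"
  shows "pick m f w \<subseteq> {..<n}" "card (pick m f w) = m" "\<And>j. j \<in> pick m f w \<Longrightarrow> lk (f j) # w \<in> W"
proof -
  let ?J = "{j \<in> {..<n}. w = [] \<or> lk (f j) \<noteq> hd w}"
  have inj: "f i = f j \<longleftrightarrow> i = j" for i j using f by metis
  have "{..<n} - ?J \<subseteq> {THE j. lk (f j) = hd w}"
  proof
    fix j assume "j \<in> {..<n} - ?J"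
    then have "lk (f j) = hd w" by auto
    then have "(THE j. lk (f j) = hd w) = j" using inj by (intro the_equality) (auto, metis lk_eq)
    then show "j \<in> {THE j. lk (f j) = hd w}" by simp
  qed
  then have "card ({..<n} - ?J) \<le> 1" using card_mono[of "{THE j. lk (f j) = hd w}"] by fastforce
  moreover have "card ({..<n} - ?J) = n - card ?J" by (subst card_Diff_subset) auto
  ultimately have "m \<le> card ?J" using m by simp
  then obtain J where J: "J \<subseteq> ?J" "card J = m" by (meson obtain_subset_with_card_n)
  have "lk (f j) # w \<in> W" if "j \<in> J" for j
    using that J(1) w lk_in[of "f j"] f by (auto simp: W_Cons)
  then have "\<exists>J. J \<subseteq> {..<n} \<and> card J = m \<and> (\<forall>j\<in>J. lk (f j) # w \<in> W)" using J by blast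
  from someI_ex[OF this] show "pick m f w \<subseteq> {..<n}" "card (pick m f w) = m"
      "\<And>j. j \<in> pick m f w \<Longrightarrow> lk (f j) # w \<in> W"
    unfolding pick_def by blast+
qed

section \<open>Limit points at centres and at points\<close>

definition center_limits :: "'l list \<Rightarrow> 'l list set" where
  "center_limits g = (\<lambda>j. lk (LD j) # g) ` pick (n - 1) LD g"

text \<open>\<open>m\<close> is \<open>n - 1\<close> for collections, and \<open>n - 2\<close> in
  \<open>isolated_piece\<close>, where the point itself is the remaining limit.\<close>

definition point_limits :: "nat \<Rightarrow> (nat \<Rightarrow> link) \<Rightarrow> (nat \<Rightarrow> link) \<Rightarrow> 'l list \<Rightarrow> 'l list set" where
  "point_limits m f f' h = (\<lambda>j. lk (f' j) # lk (f j) # h) ` pick m f h"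

lemma center_limitsE:
  assumes "g \<in> W" "x \<in> center_limits g"
  obtains j where "j < n" "x = lk (LD j) # g" "x \<in> W"
  using pick[OF assms(1), of "n - 1" LD] assms(2) unfolding center_limits_def by auto

lemma card_center_limits: "g \<in> W \<Longrightarrow> card (center_limits g) = n - 1"
  using pick[of g "n - 1" LD] unfolding center_limits_def by (subst card_image) (auto simp: inj_on_def)

lemma point_limitsE:
  assumes "h \<in> W" "x \<in> point_limits m f f' h" "m \<le> n - 1"
    "\<And>j. idx (f j) = j" "\<And>j. idx (f' j) = j" "\<And>j. f j \<noteq> f' j"
  obtains j where "j < n" "x = lk (f' j) # lk (f j) # h" "x \<in> W" "lk (f j) # h \<in> W"
proof -
  obtain j where j: "j \<in> pick m f h" "x = lk (f' j) # lk (f j) # h"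
    using assms(2) unfolding point_limits_def by blast
  have "j < n" "lk (f j) # h \<in> W" using pick[OF assms(1,3), of f] assms(4) j(1) by auto
  moreover have "x \<in> W" using calculation lk_in[of "f' j"] assms(5)[of j] assms(6)[of j, symmetric] j(2) by (auto simp: W_Cons)
  ultimately show ?thesis using that j(2) by blast
qed

lemma card_point_limits:
  assumes "h \<in> W" "m \<le> n - 1" "\<And>j. idx (f j) = j"
  shows "card (point_limits m f f' h) = m"
proof -
  have "inj_on (\<lambda>j. lk (f' j) # lk (f j) # h) (pick m f h)"
    by (rule inj_onI) (metis assms(3) list.inject lk_eq)
  then show ?thesis using pick(2)[OF assms] unfolding point_limits_def by (simp add: card_image)
qed

definition isolated_piece :: "'l list \<Rightarrow> 'l list set" where
  "isolated_piece y = insert y (point_limits (n - 2) LB LC y)"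

lemma isolated_piece_branch:
  assumes "y \<in> W" "even (length y)" shows "isolated_piece y \<subseteq> branch True y"
proof
  fix x assume "x \<in> isolated_piece y"
  then consider "x = y" | "x \<in> point_limits (n - 2) LB LC y" unfolding isolated_piece_def by blast
  then show "x \<in> branch True y"
  proof cases
    case 2
    then show ?thesis
      by (rule point_limitsE[OF assms(1)]) (use assms(2) in \<open>auto simp: branch_def suffix_Cons\<close>)
  qed (use assms in \<open>auto simp: branch_def\<close>)
qed

text \<open>Every neighbourhood of one of the points \<open>y \<cdot> LB j \<cdot> LC j\<close> contains \<open>y\<close>.\<close>

lemma FL_isolated_piece:
  assumes y: "y \<in> W" "even (length y)" shows "FL (isolated_piece y)"
  unfolding full_limits_def
proof (intro allI impI)
  let ?Y = "subtopology Z (isolated_piece y)"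
  fix \<U> assume U: "open_ultrafilter ?Y \<U>"
  have tY: "topspace ?Y = isolated_piece y" using isolated_piece_branch[OF y] branch_sub by auto
  have near: "y \<in> P" if P: "openin Z P" "x \<in> P" "x \<in> isolated_piece y" for P x
  proof (cases "x = y")
    case False
    then have "x \<in> point_limits (n - 2) LB LC y" using P(3) unfolding isolated_piece_def by blast
    then obtain j where j: "j < n" "x = lk (LC j) # lk (LB j) # y" "x \<in> W" "lk (LB j) # y \<in> W"
      by (rule point_limitsE[OF y(1)]) auto
    \<comment> \<open>In the copy at \<open>lk (LB j) # y\<close> the point \<open>y\<close> has the
      position \<open>lk (LB j)\<close> and \<open>x\<close> the position \<open>lk (LC j)\<close>,
      which lies in the closure of the former.\<close>
    let ?V = "{a \<in> topspace A. mul (lk (LB j) # y) a \<in> P}"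
    have "openin A ?V" using P(1) word_openD(2) j(4) unfolding openin_Z by blast
    moreover have "lk (LC j) \<in> ?V" using P(2) j lk_in[of "LC j"] by (simp add: mul_def)
    ultimately have "lk (LB j) \<in> ?V" using cl_LB[OF j(1)] in_cl by blast
    then show ?thesis by (simp add: mul_def)
  qed (use P in simp)
  have nearY: "y \<in> P" if "openin ?Y P" "P \<noteq> {}" for P
    using that near unfolding openin_subtopology isolated_piece_def by blast
  have mem: "P \<in> \<U>" if P: "openin ?Y P" "P \<noteq> {}" for P
  proof (rule ccontr)
    assume "P \<notin> \<U>"
    then obtain Q where Q: "Q \<in> \<U>" "P \<inter> Q = {}" using open_ultrafilterD(4)[OF U P(1)] by blast
    have "openin ?Y Q" "Q \<noteq> {}" using open_ultrafilterD(1,2)[OF U] Q(1) by auto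
    then show False using nearY P Q(2) by blast
  qed
  have "lims ?Y \<U> = isolated_piece y" using mem unfolding lims_def tY by blast
  moreover have "y \<notin> point_limits (n - 2) LB LC y" unfolding point_limits_def by auto
  moreover have "card (point_limits (n - 2) LB LC y) = n - 2" using y by (intro card_point_limits) auto
  moreover have "finite (point_limits (n - 2) LB LC y)"
    using pick(1)[OF y(1), of "n - 2" LB] finite_subset unfolding point_limits_def by fastforce
  ultimately show "card (lims ?Y \<U>) = n - 1" using n2 unfolding isolated_piece_def by simp
qed

definition collect :: "'b set \<Rightarrow> 'i set \<Rightarrow> ('i \<Rightarrow> 'b set) \<Rightarrow> 'b set" where
  "collect S T E = (\<Union>i\<in>T. E i) \<union> (if infinite {i\<in>T. E i \<noteq> {}} then S else {})"

lemma FL_collect: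
  assumes "card S = n - 1" "S \<subseteq> W"
    and E: "\<And>i. i \<in> T \<Longrightarrow> FL (E i)" "\<And>i. i \<in> T \<Longrightarrow> E i \<subseteq> W"
    and op: "\<And>i. i \<in> T \<Longrightarrow> \<exists>P. openin Z P \<and> E i \<subseteq> P \<and> P \<inter> S = {} \<and> (\<forall>k\<in>T. k \<noteq> i \<longrightarrow> P \<inter> E k = {})"
    and av: "\<And>i. i \<in> T \<Longrightarrow> \<exists>P. openin Z P \<and> S \<subseteq> P \<and> P \<inter> E i = {}"
    and lk: "\<And>P p. openin Z P \<Longrightarrow> p \<in> S \<Longrightarrow> p \<in> P \<Longrightarrow> finite {i\<in>T. \<not> E i \<subseteq> P}"
  shows "FL (collect S T E)"
proof (rule full_limits_collect[OF n2, where T = T and E = E])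
  let ?S = "if infinite {i\<in>T. E i \<noteq> {}} then S else {}"
  show "collect S T E = (\<Union>i\<in>T. E i) \<union> ?S" by (simp add: collect_def)
  show "collect S T E \<subseteq> topspace Z" using assms(2) E(2) by (auto simp: collect_def split: if_splits)
  show "E i \<inter> E k = {}" if ik: "i \<in> T" "k \<in> T" "i \<noteq> k" for i k
  proof -
    obtain P where "E i \<subseteq> P" "\<forall>k\<in>T. k \<noteq> i \<longrightarrow> P \<inter> E k = {}" using op[OF ik(1)] by blast
    then have "P \<inter> E k = {}" using ik(2,3) by simp
    then show ?thesis using \<open>E i \<subseteq> P\<close> by blast
  qed
  show "\<exists>P. openin Z P \<and> P \<inter> collect S T E = E i" if i: "i \<in> T" "E i \<noteq> {}" for i
  proof -
    obtain P where "openin Z P" "E i \<subseteq> P" "P \<inter> S = {}" "\<forall>k\<in>T. k \<noteq> i \<longrightarrow> P \<inter> E k = {}"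
      using op[OF i(1)] by blast
    then show ?thesis using i(1) by (intro exI[of _ P]) (auto simp: collect_def split: if_splits)
  qed
  show "\<exists>P. openin Z P \<and> ?S \<subseteq> P \<and> P \<inter> E i = {}" if "i \<in> T" for i
    using av[OF that] by auto
  show "finite {i\<in>T. \<not> E i \<subseteq> P}" if "openin Z P" "p \<in> ?S" "p \<in> P" for P p
    using lk[OF that(1)] that(2,3) by (auto split: if_splits)
qed (use assms in auto)

lemma branch_disjoint:
  assumes "length x = length y" "x \<noteq> y" shows "branch p x \<inter> branch q y = {}"
  using assms suffix_cmp suffix_eqI unfolding branch_def by fastforce

lemma closed_TC: "closedin A (\<Union>j\<in>{..<n}. {lk (LT j), lk (LC j)})"
proof -
  have "closedin A {lk (LT j), lk (LC j)}" if "j < n" for j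
  proof -
    have "{lk (LT j), lk (LC j)} = cl (lk (LT j)) \<union> cl (lk (LC j))" using cl_lk that by auto
    then show ?thesis by (simp add: closedin_Un)
  qed
  then show ?thesis by (intro closedin_Union) auto
qed

text \<open>A fan over almost all letters is a neighbourhood of the limits that misses one given
  branch. How the branches are separated from each other depends on the kind of the pieces and is
  left to \<open>sep\<close>.\<close>

lemma FL_center:
  assumes g: "a # h \<in> W" "even (length h)" and T: "T \<subseteq> topspace A - Lk - {a}"
    and v: "\<And>b. b \<in> T \<Longrightarrow> v (b # a # h) \<subseteq> branch True (b # a # h) \<and> FL (v (b # a # h))"
    and sep: "\<And>b. b \<in> T \<Longrightarrow> \<exists>P. openin Z P \<and> v (b # a # h) \<subseteq> P \<and>
       (\<forall>j<n. lk (LD j) # a # h \<notin> P) \<and> (\<forall>b'\<in>T. b' \<noteq> b \<longrightarrow> P \<inter> v (b' # a # h) = {})"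
  shows "FL (collect (center_limits (a # h)) T (\<lambda>b. v (b # a # h)))"
proof (rule FL_collect)
  let ?g = "a # h"
  have a: "a \<in> topspace A" using g(1) by (simp add: W_Cons)
  show "card (center_limits ?g) = n - 1" using card_center_limits[OF g(1)] .
  show "center_limits ?g \<subseteq> W" using center_limitsE[OF g(1)] by blast
  fix b assume b: "b \<in> T"
  show "FL (v (b # ?g))" "v (b # ?g) \<subseteq> W" using v[OF b] branch_sub by auto
  obtain P where P: "openin Z P" "v (b # ?g) \<subseteq> P" "\<forall>j<n. lk (LD j) # ?g \<notin> P"
    "\<forall>b'\<in>T. b' \<noteq> b \<longrightarrow> P \<inter> v (b' # ?g) = {}" using sep[OF b] by blast
  have "P \<inter> center_limits ?g = {}" using P(3) center_limitsE[OF g(1)] by blast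
  then show "\<exists>P. openin Z P \<and> v (b # ?g) \<subseteq> P \<and> P \<inter> center_limits ?g = {} \<and>
      (\<forall>k\<in>T. k \<noteq> b \<longrightarrow> P \<inter> v (k # ?g) = {})" using P by blast
  \<comment> \<open>Finitely many letters are removed, as closed sets, to meet the hypotheses of
    \<open>openin_fan\<close> and to drop \<open>b\<close>. The limit links \<open>LD j\<close>
    survive: they are isolated, differ from \<open>a\<close> because the word is reduced, and from
    \<open>b\<close> because \<open>b\<close> is not a link.\<close>
  let ?O = "topspace A - (cl a \<union> cl b \<union> (\<Union>j\<in>{..<n}. {lk (LT j), lk (LC j)}))"
  have bA: "b \<in> topspace A" "b \<notin> Lk" using b T by auto
  have "openin Z (fan ?g ?O {})"
  proof (rule openin_fan)
    show "openin A ?O" using closed_TC by (intro openin_diff closedin_Un) auto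
    have "finite (cl a \<union> cl b \<union> (\<Union>j\<in>{..<n}. {lk (LT j), lk (LC j)}))"
      using fin_cl[OF a] fin_cl[OF bA(1)] by simp
    moreover have "topspace A - ?O \<subseteq> cl a \<union> cl b \<union> (\<Union>j\<in>{..<n}. {lk (LT j), lk (LC j)})" by blast
    ultimately show "finite (topspace A - ?O) \<and> ({} :: 'l set) = {}"
      using finite_subset by blast
  qed (use g self_cl[OF a] in auto)
  moreover have "center_limits ?g \<subseteq> fan ?g ?O {}"
  proof
    fix x assume "x \<in> center_limits ?g"
    then obtain j where j: "j < n" "x = lk (LD j) # ?g" "x \<in> W" by (rule center_limitsE[OF g(1)])
    have "lk (LD j) \<notin> cl a" using lk_bad[of "LD j" a h] j by auto
    moreover have "lk (LD j) \<notin> cl b" using nonlk_cl[OF bA(2), of "LD j"] j(1) by simp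
    ultimately have "lk (LD j) \<in> ?O" using lk_in[of "LD j"] j(1) by auto
    then show "x \<in> fan ?g ?O {}" using j g(2) unfolding fan_def by auto
  qed
  moreover have "fan ?g ?O {} \<inter> v (b # ?g) = {}"
  proof -
    have "b' = b" if "suffix (b' # ?g) w" "suffix (b # ?g) w" for b' w
      using suffix_cmp[OF that] suffix_eqI[of "b' # ?g" "b # ?g"] suffix_eqI[of "b # ?g" "b' # ?g"] by auto
    then show ?thesis using v[OF b] self_cl[OF bA(1)] unfolding fan_def branch_def by blast
  qed
  ultimately show "\<exists>P. openin Z P \<and> center_limits ?g \<subseteq> P \<and> P \<inter> v (b # ?g) = {}" by blast
next
  fix P p assume P: "openin Z P" "p \<in> center_limits (a # h)" "p \<in> P"
  obtain j where j: "j < n" "p = lk (LD j) # a # h" "p \<in> W" using P(2) by (rule center_limitsE[OF g(1)])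
  have "mul (a # h) (lk (LD j)) = p" using Nil_or_hd[of "lk (LD j)" "a # h"] j by simp
  then have "finite {b. b # a # h \<in> W \<and> \<not> branch (odd (length (a # h))) (b # a # h) \<subseteq> P}"
    using P word_openD(3)[of P "a # h" j] g(1) j(1) unfolding openin_Z by simp
  moreover have "{b \<in> T. \<not> v (b # a # h) \<subseteq> P} \<subseteq> {b. b # a # h \<in> W \<and> \<not> branch (odd (length (a # h))) (b # a # h) \<subseteq> P}"
    using v T g by (auto simp: W_Cons)
  ultimately show "finite {b \<in> T. \<not> v (b # a # h) \<subseteq> P}" by (rule rev_finite_subset)
qed

text \<open>The branches separate themselves: \<open>good_part h {a}\<close> is open and lies in the
  branch over \<open>a\<close>. The entries \<open>LS j\<close> are left out because the limits lie
  in the branches over them.\<close>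

lemma FL_point:
  assumes h: "h \<in> W" "even (length h)"
    and r: "\<And>a. a # h \<in> W \<Longrightarrow> r (a # h) \<subseteq> mbranch h a \<and> FL (r (a # h))"
  shows "FL (collect (point_limits (n - 1) LS LT h) {a. a # h \<in> W \<and> a \<notin> (\<lambda>j. lk (LS j)) ` {..<n}} (\<lambda>a. r (a # h)))"
    (is "FL (collect ?S ?T _)")
    and "collect (point_limits (n - 1) LS LT h) {a. a # h \<in> W \<and> a \<notin> (\<lambda>j. lk (LS j)) ` {..<n}} (\<lambda>a. r (a # h))
      \<subseteq> good_part h (topspace A)"
proof -
  have disj: "mbranch h a \<inter> mbranch h b = {}" if "a \<noteq> b" for a b
    using mbranch_branch branch_disjoint[of "a # h" "b # h"] that by fastforce
  have S: "\<exists>j<n. x = lk (LT j) # lk (LS j) # h \<and> x \<in> mbranch h (lk (LS j))" if "x \<in> ?S" for x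
  proof -
    obtain j where j: "j < n" "x = lk (LT j) # lk (LS j) # h" "x \<in> W"
      using \<open>x \<in> ?S\<close> by (rule point_limitsE[OF h(1)]) auto
    have "lk (LT j) \<notin> cl (lk (LS j))" using cl_lk[of "LS j"] j(1) by simp
    then have "x \<in> mbranch h (lk (LS j))"
      using j unfolding mbranch_def by (intro CollectI exI[of _ "[lk (LT j)]"]) auto
    then show ?thesis using j by blast
  qed
  have SW: "?S \<subseteq> W" using S mbranch_sub by blast
  show "FL (collect ?S ?T (\<lambda>a. r (a # h)))"
  proof (rule FL_collect)
    show "card ?S = n - 1" using card_point_limits[OF h(1)] by simp
    show "?S \<subseteq> W" by (rule SW)
    fix a assume a: "a \<in> ?T"
    show "FL (r (a # h))" "r (a # h) \<subseteq> W" using r[of a] a mbranch_sub by auto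
    have o: "openin Z (good_part h {a})" using a by (intro openin_good_part h) auto
    have "good_part h {a} \<inter> ?S = {}"
    proof -
      have "x \<notin> good_part h {a}" if x: "x \<in> ?S" for x
      proof -
        obtain j where "j < n" "x \<in> mbranch h (lk (LS j))" using S[OF x] by blast
        then show ?thesis using a disj[of a "lk (LS j)"] unfolding good_part_def by blast
      qed
      then show ?thesis by blast
    qed
    moreover have "r (a # h) \<subseteq> good_part h {a}" using r a unfolding good_part_def by blast
    moreover have "good_part h {a} \<inter> r (k # h) = {}" if "k \<in> ?T" "k \<noteq> a" for k
      using r[of k] that disj[of a k] unfolding good_part_def by blast
    ultimately show "\<exists>P. openin Z P \<and> r (a # h) \<subseteq> P \<and> P \<inter> ?S = {} \<and>
        (\<forall>k\<in>?T. k \<noteq> a \<longrightarrow> P \<inter> r (k # h) = {})" using o by (intro exI[of _ "good_part h {a}"]) simp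
    have aA: "a \<in> topspace A" using a by (simp add: W_Cons)
    then have "topspace A - (topspace A - {a}) = {a}" by blast
    then have "openin Z (good_part h (topspace A - {a}))" by (intro openin_good_part h) simp
    moreover have "?S \<subseteq> good_part h (topspace A - {a})"
    proof
      fix x assume "x \<in> ?S"
      then obtain j where j: "j < n" "x \<in> mbranch h (lk (LS j))" using S by blast
      then have "lk (LS j) \<in> topspace A - {a}" using lk_in[of "LS j"] a by auto
      then show "x \<in> good_part h (topspace A - {a})" using j(2) unfolding good_part_def by blast
    qed
    moreover have "good_part h (topspace A - {a}) \<inter> r (a # h) = {}"
      using r[of a] a disj[of _ a] unfolding good_part_def by blast
    ultimately show "\<exists>P. openin Z P \<and> ?S \<subseteq> P \<and> P \<inter> r (a # h) = {}" by blast
  next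
    fix P p assume P: "openin Z P" "p \<in> ?S" "p \<in> P"
    obtain j where j: "j < n" "p = lk (LT j) # lk (LS j) # h" "p \<in> W" "lk (LS j) # h \<in> W"
      using P(2) by (rule point_limitsE[OF h(1)]) auto
    have "mul (mul h (lk (LS j))) (lk (LT j)) = p"
      using Nil_or_hd[of "lk (LS j)" h] Nil_or_hd[of "lk (LT j)" "lk (LS j) # h"] j by simp
    then have "finite {a. a # h \<in> W \<and> \<not> mbranch h a \<subseteq> P}"
      using P word_openD(4)[of P h j] h(1) j(1) unfolding openin_Z by simp
    moreover have "{a \<in> ?T. \<not> r (a # h) \<subseteq> P} \<subseteq> {a. a # h \<in> W \<and> \<not> mbranch h a \<subseteq> P}"
      using r by blast
    ultimately show "finite {a \<in> ?T. \<not> r (a # h) \<subseteq> P}" by (rule rev_finite_subset)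
  qed
  have "r (a # h) \<subseteq> good_part h (topspace A)" if "a # h \<in> W" for a
    using r[OF that] that unfolding good_part_def W_Cons by blast
  moreover have "?S \<subseteq> good_part h (topspace A)"
  proof
    fix x assume "x \<in> ?S"
    then obtain j where "j < n" "x \<in> mbranch h (lk (LS j))" using S by blast
    then show "x \<in> good_part h (topspace A)" using lk_in[of "LS j"] unfolding good_part_def by auto
  qed
  ultimately show "collect ?S ?T (\<lambda>a. r (a # h)) \<subseteq> good_part h (topspace A)"
    unfolding collect_def by auto
qed

text \<open>With the size of \<open>cl b\<close> fixed, the points \<open>b\<close> of \<open>cl a\<close> have neighbourhoods that separate
  them from each other.\<close>

definition bad_pairs :: "nat \<Rightarrow> 'l list \<Rightarrow> ('l \<times> 'l) set" where
  "bad_pairs i y = {(a, b). a # y \<in> W \<and> a \<notin> (\<lambda>j. lk (LB j)) ` {..<n} \<and> b \<in> cl a - {a} \<and> card (cl b) = i}"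

definition Bad :: "'l list \<Rightarrow> 'l list set" where
  "Bad y = {w. \<exists>a. \<exists>c\<in>F a. suffix (c # a # y) w}"

text \<open>To isolate the piece behind \<open>(a, b)\<close>, all of \<open>F\<close> is cut off at
  the entries other than \<open>a\<close>, which removes the other pieces and the limits there; at
  the entry \<open>a\<close> only the rivals of \<open>b\<close> are cut off.\<close>

lemma FL_bad:
  assumes y: "y \<in> W" "even (length y)"
    and q: "\<And>a b. b # a # y \<in> W \<Longrightarrow> q (b # a # y) \<subseteq> branch True (b # a # y) \<and> FL (q (b # a # y))"
  shows "FL (collect (point_limits (n - 1) LB LC y) (bad_pairs i y) (\<lambda>(a, b). q (b # a # y)))" (is "FL (collect ?S ?T ?q)")
proof (rule FL_collect)
  show "card ?S = n - 1" using card_point_limits[OF y(1)] by simp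
  have S: "\<exists>j<n. x = lk (LC j) # lk (LB j) # y \<and> x \<in> W" if "x \<in> ?S" for x
    using that by (rule point_limitsE[OF y(1)]) auto
  then show "?S \<subseteq> W" by blast
  have Tba: "a \<in> topspace A" "b # a # y \<in> W" "b \<in> topspace A" "a \<notin> cl b" if "(a, b) \<in> ?T" for a b
    using that y cl_sub T0[of a b] unfolding bad_pairs_def by (auto simp: W_Cons)
  \<comment> \<open>\<open>\<beta>\<close> fails only if \<open>hd y\<close> is an \<open>LS\<close>
    or \<open>LB\<close> link. These are isolated letters, so one of the two forms of
    \<open>trim\<close> is open at every \<open>y\<close>.\<close>
  define \<beta> where "\<beta> \<longleftrightarrow> y = [] \<or> (\<forall>j<n. hd y \<noteq> lk (LS j) \<and> hd y \<noteq> lk (LB j))"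
  have b0: "y \<noteq> [] \<and> openin A {hd y} \<and> (\<forall>j<n. hd y \<noteq> lk (LD j) \<and> hd y \<noteq> lk (LT j) \<and> hd y \<noteq> lk (LC j))"
    if "\<not> \<beta>" using that open_lk unfolding \<beta>_def by fastforce
  fix p assume p: "p \<in> ?T"
  obtain a b where ab: "p = (a, b)" by (cases p)
  have abT: "(a, b) \<in> ?T" using p ab by simp
  note Tab = Tba[OF abT]
  have bcl: "b \<in> cl a" "b \<noteq> a" "card (cl b) = i" "\<And>j. j < n \<Longrightarrow> a \<noteq> lk (LB j)"
    using abT unfolding bad_pairs_def by auto
  show "FL (?q p)" "?q p \<subseteq> W" using q[OF Tab(2)] branch_sub ab by auto
  have clb: "lk (LS j) \<notin> cl c \<and> lk (LB j) \<notin> cl c" if c: "c \<in> cl a" "c \<noteq> a" "j < n" for c j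
  proof -
    have "lk (LS j) \<notin> cl c"
    proof
      assume "lk (LS j) \<in> cl c"
      then have "c = lk (LS j)" using lk_cl[of "LS j" c] c(3) by simp
      then show False using lk_cl[of "LS j" a] c by simp
    qed
    moreover have "lk (LB j) \<notin> cl c"
    proof
      assume "lk (LB j) \<in> cl c"
      then have "c = lk (LB j)" using lk_cl[of "LB j" c] c(3) by simp
      then show False using lk_cl[of "LB j" a] c by simp
    qed
    ultimately show ?thesis by blast
  qed
  have aS: "a \<noteq> lk (LS j)" if "j < n" for j using bcl(1,2) cl_lk[of "LS j"] that by auto
  \<comment> \<open>The rivals of \<open>b\<close>. Removing their closures leaves \<open>b\<close>
    untouched: if \<open>b\<close> were in \<open>cl c\<close>, then \<open>cl b\<close> and
    \<open>cl c\<close> would be nested finite sets of the same size, hence equal, contrary to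
    T0.\<close>
  define K where "K = {c \<in> cl a. c \<noteq> a \<and> c \<noteq> b \<and> card (cl c) = i}"
  define D where "D a' = (if a' = a then \<Union>c\<in>K. cl c else if a' \<in> topspace A then F a' else {})" for a'
  have fK: "finite K" using fin_cl[OF Tab(1)] unfolding K_def by simp
  have bK: "b \<notin> (\<Union>c\<in>K. cl c)"
  proof
    assume "b \<in> (\<Union>c\<in>K. cl c)"
    then obtain c where c: "c \<in> cl a" "c \<noteq> b" "card (cl c) = i" "b \<in> cl c" unfolding K_def by blast
    have "finite (cl c)" using fin_cl c(1) cl_sub by blast
    then have "cl b = cl c" using cl_trans[OF c(4)] bcl(3) c(3) card_subset_eq by metis
    then show False using T0[OF c(4)] self_cl c(1,2) cl_sub by blast
  qed
  have aK: "a \<notin> (\<Union>c\<in>K. cl c)"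
  proof
    assume "a \<in> (\<Union>c\<in>K. cl c)"
    then obtain c where "c \<in> cl a" "c \<noteq> a" "a \<in> cl c" unfolding K_def by blast
    then show False using T0 by blast
  qed
  have "openin Z (trim y \<beta> D)"
  proof (rule openin_trim[OF y])
    fix a' assume a': "a' \<in> topspace A"
    have "closedin A (\<Union>c\<in>K. cl c)" using fK by (intro closedin_Union) auto
    moreover have "finite (\<Union>c\<in>K. cl c)" using fK fin_cl cl_sub unfolding K_def by blast
    ultimately show "finite (D a') \<and> closedin A (D a') \<and> a' \<notin> D a'"
      using F_props[OF a'] a' aK unfolding D_def by auto
  next
    fix a' j assume "j < n"
    then show "lk (LS j) \<notin> D a' \<and> lk (LB j) \<notin> D a'"
      using clb F_props(4,5)[of a' j] unfolding D_def K_def by auto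
  next
    show "finite {a. D a \<noteq> {}} \<or> (\<forall>j<n. lk (LT j) \<in> D (lk (LS j)) \<and> lk (LC j) \<in> D (lk (LB j)))"
    proof (intro disjI2 allI impI)
      fix j assume j: "j < n"
      have "lk (LS j) \<noteq> a" "lk (LB j) \<noteq> a" using aS[OF j] bcl(4)[OF j] by auto
      then show "lk (LT j) \<in> D (lk (LS j)) \<and> lk (LC j) \<in> D (lk (LB j))"
        using links_F[OF j] lk_in[of "LS j"] lk_in[of "LB j"] j unfolding D_def by simp
    qed
  qed (use b0 in \<open>auto simp: \<beta>_def\<close>)
  moreover have "?q p \<subseteq> trim y \<beta> D"
  proof
    fix w assume "w \<in> ?q p"
    then have w: "w \<in> branch True (b # a # y)" using q[OF Tab(2)] ab by auto
    have "\<not> suffix (b' # a' # y) w" if "b' \<in> D a'" for a' b'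
    proof
      assume "suffix (b' # a' # y) w"
      then have "b' # a' # y = b # a # y" using w suffix_cmp[of "b' # a' # y" w "b # a # y"]
          suffix_eqI[of "b' # a' # y" "b # a # y"] suffix_eqI[of "b # a # y" "b' # a' # y"]
        unfolding branch_def by auto
      then show False using that bK unfolding D_def by auto
    qed
    then show "w \<in> trim y \<beta> D" using w unfolding trim_def branch_def by (auto dest: suffix_ConsD)
  qed
  moreover have "trim y \<beta> D \<inter> ?S = {}"
  proof -
    have "x \<notin> trim y \<beta> D" if x: "x \<in> ?S" for x
    proof -
      obtain j where j: "j < n" "x = lk (LC j) # lk (LB j) # y" using S[OF x] by blast
      have "lk (LC j) \<in> D (lk (LB j))" using links_F(2)[OF j(1)] lk_in[of "LB j"] bcl(4) j(1) unfolding D_def by auto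
      then show ?thesis using j(2) unfolding trim_def by blast
    qed
    then show ?thesis by blast
  qed
  moreover have "trim y \<beta> D \<inter> ?q k = {}" if k: "k \<in> ?T" "k \<noteq> p" for k
  proof -
    obtain a' b' where k': "k = (a', b')" by (cases k)
    have kT: "(a', b') \<in> ?T" using k k' by simp
    have "b' \<in> D a'"
    proof (cases "a' = a")
      case True
      then have "b' \<in> K" using kT k k' ab unfolding K_def bad_pairs_def by auto
      then show ?thesis using True self_cl Tba(3)[OF kT] unfolding D_def by auto
    next
      case False
      then show ?thesis using kT Tba(1)[OF kT] unfolding D_def bad_pairs_def F_def by auto
    qed
    moreover have "?q k \<subseteq> branch True (b' # a' # y)" using q[OF Tba(2)[OF kT]] k' by simp
    ultimately show ?thesis unfolding trim_def branch_def by blast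
  qed
  ultimately show "\<exists>P. openin Z P \<and> ?q p \<subseteq> P \<and> P \<inter> ?S = {} \<and> (\<forall>k\<in>?T. k \<noteq> p \<longrightarrow> P \<inter> ?q k = {})"
    by blast
  \<comment> \<open>To keep the limits away from this one piece, a cut at the single entry
    \<open>a\<close> suffices, so the first alternative of the finiteness hypothesis
    applies.\<close>
  define D' where "D' a' = (if a' = a then cl b else {})" for a'
  have "openin Z (trim y \<beta> D')"
  proof (rule openin_trim[OF y])
    fix a' assume a': "a' \<in> topspace A"
    show "finite (D' a') \<and> closedin A (D' a') \<and> a' \<notin> D' a'"
      using fin_cl[OF Tab(3)] Tab(4) unfolding D'_def by auto
  next
    fix a' j assume "j < n"
    then show "lk (LS j) \<notin> D' a' \<and> lk (LB j) \<notin> D' a'"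
      using clb[OF bcl(1,2)] unfolding D'_def by auto
  next
    have "{a. D' a \<noteq> {}} \<subseteq> {a}" unfolding D'_def by auto
    then show "finite {a. D' a \<noteq> {}} \<or> (\<forall>j<n. lk (LT j) \<in> D' (lk (LS j)) \<and> lk (LC j) \<in> D' (lk (LB j)))"
      using finite_subset by blast
  qed (use b0 in \<open>auto simp: \<beta>_def\<close>)
  moreover have "?S \<subseteq> trim y \<beta> D'"
  proof
    fix x assume "x \<in> ?S"
    then obtain j where j: "j < n" "x = lk (LC j) # lk (LB j) # y" "x \<in> W" using S by blast
    have "\<not> suffix (c # a' # y) x" if "c \<in> D' a'" for a' c
    proof
      assume "suffix (c # a' # y) x"
      then have "c # a' # y = x" using j(2) by (intro suffix_eqI) auto
      then show False using that j(1,2) bcl(4) unfolding D'_def by (auto split: if_splits)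
    qed
    then show "x \<in> trim y \<beta> D'" using j y(2) unfolding trim_def by (auto simp: suffix_Cons)
  qed
  moreover have "trim y \<beta> D' \<inter> ?q p = {}"
    using q[OF Tab(2)] self_cl[OF Tab(3)] ab unfolding trim_def branch_def D'_def by auto
  ultimately show "\<exists>P. openin Z P \<and> ?S \<subseteq> P \<and> P \<inter> ?q p = {}" by blast
next
  fix P p assume P: "openin Z P" "p \<in> ?S" "p \<in> P"
  obtain j where j: "j < n" "p = lk (LC j) # lk (LB j) # y" "p \<in> W" "lk (LB j) # y \<in> W"
    using P(2) by (rule point_limitsE[OF y(1)]) auto
  have "mul (mul y (lk (LB j))) (lk (LC j)) = p"
    using Nil_or_hd[of "lk (LB j)" y] Nil_or_hd[of "lk (LC j)" "lk (LB j) # y"] j by simp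
  then have fin: "finite {a. a # y \<in> W \<and> \<not> bbranch y a \<subseteq> P}" (is "finite ?X")
    using P word_openD(5)[of P y j] y(1) j(1) unfolding openin_Z by simp
  \<comment> \<open>Each of the finitely many exceptional entries \<open>a\<close> accounts for
    finitely many pairs, because \<open>cl a\<close> is finite.\<close>
  have "finite (Sigma ?X cl)" using fin fin_cl by (intro finite_SigmaI) (auto simp: W_Cons)
  moreover have "{k \<in> ?T. \<not> ?q k \<subseteq> P} \<subseteq> Sigma ?X cl"
  proof
    fix k assume k: "k \<in> {k \<in> ?T. \<not> ?q k \<subseteq> P}"
    obtain a b where ab: "k = (a, b)" by (cases k)
    have abT: "a # y \<in> W" "b \<in> cl a - {a}" using k ab unfolding bad_pairs_def by auto
    then have "b # a # y \<in> W" using cl_sub by (auto simp: W_Cons)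
    then have "?q k \<subseteq> branch True (b # a # y)" using q ab by simp
    also have "\<dots> \<subseteq> bbranch y a" using abT(2) y(2) unfolding bbranch_def by auto
    finally show "k \<in> Sigma ?X cl" using k ab abT by auto
  qed
  ultimately show "finite {k \<in> ?T. \<not> ?q k \<subseteq> P}" by (rule rev_finite_subset)
qed


section \<open>Pieces for words reached by bad steps only\<close>

definition bad_step :: "nat \<Rightarrow> ('l list \<Rightarrow> 'l list set) \<Rightarrow> 'l list \<Rightarrow> 'l list set" where
  "bad_step i q y = collect (point_limits (n - 1) LB LC y) (bad_pairs i y) (\<lambda>(a, b). q (b # a # y))"

text \<open>The entries \<open>LB j\<close> do not occur in \<open>bad_pairs\<close>, since the
  limits lie behind them. The only bad exit from \<open>LB j\<close> is \<open>LC j\<close>, so one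
  piece per \<open>j\<close> is enough there.\<close>

definition bad_single :: "nat \<Rightarrow> ('l list \<Rightarrow> 'l list set) \<Rightarrow> 'l list \<Rightarrow> 'l list set" where
  "bad_single j q y = (if lk (LB j) # y \<in> W then q (lk (LC j) # lk (LB j) # y) else {})"

text \<open>The level is the number of bad steps. The closure size \<open>i\<close> can differ from
  step to step, which still leaves countably many families.\<close>

primrec bad_families :: "nat \<Rightarrow> ('l list \<Rightarrow> 'l list set) set" where
  "bad_families 0 = {isolated_piece}"
| "bad_families (Suc k) = (\<Union>i. bad_step i ` bad_families k) \<union> (\<Union>j\<in>{..<n}. bad_single j ` bad_families k)"

lemma countable_bad_families: "countable (bad_families k)"
  by (induction k) auto

lemma branch_Bad:
  assumes "b \<in> cl a - {a}" shows "branch p (b # a # y) \<subseteq> Bad y"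
  using assms unfolding branch_def Bad_def F_def by blast

lemma link_W: "j < n \<Longrightarrow> idx \<tau> = j \<Longrightarrow> \<sigma> \<noteq> \<tau> \<Longrightarrow> lk \<sigma> # y \<in> W \<Longrightarrow> lk \<tau> # lk \<sigma> # y \<in> W"
  using lk_in[of \<tau>] by (auto simp: W_Cons)

lemma LC_bad: "j < n \<Longrightarrow> lk (LC j) \<in> cl (lk (LB j)) - {lk (LB j)}"
  using cl_LB by auto

text \<open>From level 1 on the piece at \<open>y\<close> lies in \<open>Bad y\<close>, which is
  what a fan with the head of \<open>y\<close> in \<open>R\<close> cuts off.\<close>

lemma bad_families_FL: "q \<in> bad_families k \<Longrightarrow> y \<in> W \<Longrightarrow> even (length y) \<Longrightarrow> q y \<subseteq> branch True y \<and> FL (q y) \<and> (k > 0 \<longrightarrow> q y \<subseteq> Bad y)"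
proof (induction k arbitrary: q y)
  case 0
  then show ?case using isolated_piece_branch FL_isolated_piece by simp
next
  case (Suc k)
  have IH: "q' (b # a # y) \<subseteq> branch True (b # a # y) \<and> FL (q' (b # a # y))"
    if "q' \<in> bad_families k" "b # a # y \<in> W" for q' a b
    using Suc.IH[OF that] Suc.prems(3) by simp
  have up: "branch True (b # a # y) \<subseteq> branch True y" for a b using branch_Cons by blast
  consider i q' where "q = bad_step i q'" "q' \<in> bad_families k" | j q' where "j < n" "q = bad_single j q'" "q' \<in> bad_families k"
    using Suc.prems(1) by auto
  then show ?case
  proof cases
    case 1
    have "FL (q y)" unfolding 1(1) bad_step_def using FL_bad[OF Suc.prems(2,3)] IH[OF 1(2)] by blast
    moreover have "q y \<subseteq> branch True y \<inter> Bad y"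
    proof -
      have "q' (b # a # y) \<subseteq> branch True y \<inter> Bad y" if "(a, b) \<in> bad_pairs i y" for a b
      proof -
        have b: "a # y \<in> W" "b \<in> cl a - {a}" using that unfolding bad_pairs_def by auto
        then have "b # a # y \<in> W" using cl_sub by (auto simp: W_Cons)
        then show ?thesis using IH[OF 1(2)] up branch_Bad[OF b(2)] by blast
      qed
      moreover have "point_limits (n - 1) LB LC y \<subseteq> branch True y \<inter> Bad y"
      proof
        fix x assume "x \<in> point_limits (n - 1) LB LC y"
        then obtain j where j: "j < n" "x = lk (LC j) # lk (LB j) # y" "x \<in> W"
          by (rule point_limitsE[OF Suc.prems(2)]) auto
        then have "x \<in> branch True x" using Suc.prems(3) by (intro branch_self) auto
        then show "x \<in> branch True y \<inter> Bad y" using up branch_Bad[OF LC_bad[OF j(1)]] j(2) by blast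
      qed
      ultimately show ?thesis unfolding 1(1) bad_step_def collect_def by auto
    qed
    ultimately show ?thesis by blast
  next
    case 2
    show ?thesis
    proof (cases "lk (LB j) # y \<in> W")
      case True
      then have "lk (LC j) # lk (LB j) # y \<in> W" using 2(1) by (intro link_W) auto
      then have "q' (lk (LC j) # lk (LB j) # y) \<subseteq> branch True (lk (LC j) # lk (LB j) # y)"
        "FL (q' (lk (LC j) # lk (LB j) # y))" using IH[OF 2(3)] by blast+
      moreover have "q y = q' (lk (LC j) # lk (LB j) # y)" using True unfolding 2(2) bad_single_def by simp
      ultimately show ?thesis using up[of "lk (LC j)" "lk (LB j)"] branch_Bad[OF LC_bad[OF 2(1)], of True y]
        by auto
    qed (use full_limits_empty[of n Z] in \<open>simp add: 2(2) bad_single_def\<close>)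
  qed
qed

lemma collectI: "i \<in> T \<Longrightarrow> x \<in> E i \<Longrightarrow> x \<in> collect S T E"
  unfolding collect_def by blast

text \<open>The induction removes the step next to \<open>y\<close>, at the far end of
  \<open>u\<close>, because a family at \<open>y\<close> is built from a family at the points one
  step beyond.\<close>

lemma bad_families_cover:
  "u @ y \<in> W \<Longrightarrow> even (length u) \<Longrightarrow> allbad u \<Longrightarrow> \<exists>q\<in>bad_families (length u div 2). u @ y \<in> q y"
proof (induction "length u" arbitrary: u y rule: less_induct)
  case less
  show ?case
  proof (cases u rule: rev_cases)
    case Nil
    then show ?thesis by (simp add: isolated_piece_def)
  next
    case (snoc u1 a)
    then obtain v b where v: "u = v @ [b, a]" using less.prems(2) by (cases u1 rule: rev_cases) auto
    have ev: "even (length v)" using less.prems(2) v by simp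
    have bad: "allbad v" "b \<in> cl a" using less.prems(3) v allbad_append[OF ev] by auto
    have "v @ b # a # y \<in> W" using less.prems(1) v by simp
    then obtain q where q: "q \<in> bad_families (length v div 2)" "u @ y \<in> q (b # a # y)"
      using less.hyps[of v "b # a # y"] ev bad v by auto
    have k: "length u div 2 = Suc (length v div 2)" using v by simp
    have w: "b # a # y \<in> W" using less.prems(1) v W_suffix[of "b # a # y" "u @ y"] by (auto simp: suffix_def)
    then have ab: "a # y \<in> W" "b \<noteq> a" by (auto simp: W_Cons)
    show ?thesis
    proof (cases "\<exists>j<n. a = lk (LB j)")
      case True
      then obtain j where j: "j < n" "a = lk (LB j)" by blast
      then have "b = lk (LC j)" using bad(2) ab(2) cl_LB by auto
      then have "u @ y \<in> bad_single j q y" using q(2) j ab(1) unfolding bad_single_def by simp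
      moreover have "bad_single j q \<in> bad_families (length u div 2)" using q(1) j(1) unfolding k bad_families.simps by blast
      ultimately show ?thesis by blast
    next
      case False
      then have "(a, b) \<in> bad_pairs (card (cl b)) y" using ab bad(2) unfolding bad_pairs_def by auto
      then have "u @ y \<in> bad_step (card (cl b)) q y" using q(2) unfolding bad_step_def by (auto intro: collectI)
      moreover have "bad_step (card (cl b)) q \<in> bad_families (length u div 2)" using q(1) unfolding k bad_families.simps by blast
      ultimately show ?thesis by blast
    qed
  qed
qed

section \<open>Pieces for words with a good step\<close>

definition star_piece :: "'l list \<Rightarrow> 'l list set" where
  "star_piece g = (\<lambda>b. b # g) ` I (hd g)"

definition center_step :: "('l \<Rightarrow> 'l set) \<Rightarrow> ('l list \<Rightarrow> 'l list set) \<Rightarrow> 'l list \<Rightarrow> 'l list set" where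
  "center_step T v g = collect (center_limits g) (T (hd g)) (\<lambda>b. v (b # g))"

definition center_single :: "('l \<Rightarrow> 'l set) \<Rightarrow> 'l \<Rightarrow> ('l list \<Rightarrow> 'l list set) \<Rightarrow> 'l list \<Rightarrow> 'l list set" where
  "center_single N l v g = (if l # g \<in> W \<and> l \<notin> N (hd g) then v (l # g) else {})"

definition point_step :: "('l list \<Rightarrow> 'l list set) \<Rightarrow> 'l list \<Rightarrow> 'l list set" where
  "point_step r h = collect (point_limits (n - 1) LS LT h) {a. a # h \<in> W \<and> a \<notin> (\<lambda>j. lk (LS j)) ` {..<n}} (\<lambda>a. r (a # h))"

definition point_single :: "nat \<Rightarrow> ('l list \<Rightarrow> 'l list set) \<Rightarrow> 'l list \<Rightarrow> 'l list set" where
  "point_single j r h = (if lk (LS j) # h \<in> W then r (lk (LS j) # h) else {})"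

text \<open>Meant for words whose first step is good and whose later steps are all bad. With no
  later step, the exit lies in \<open>B\<close> (the star piece) or outside it (isolated pieces);
  with later steps the bad families apply. Exits that are links form families of their own, of which
  there are finitely many for each bad family.\<close>

definition base_families :: "('l list \<Rightarrow> 'l list set) set" where
  "base_families = {star_piece, center_step (\<lambda>a. topspace A - Lk - B - cl a) isolated_piece} \<union>
     (\<Union>k. center_step (\<lambda>a. topspace A - Lk - cl a) ` bad_families (Suc k)) \<union>
     (\<Union>l\<in>Lk. \<Union>k. center_single cl l ` bad_families k)"

definition point_families :: "('l list \<Rightarrow> 'l list set) set \<Rightarrow> ('l list \<Rightarrow> 'l list set) set" where
  "point_families R = point_step ` R \<union> (\<Union>j\<in>{..<n}. point_single j ` R)"

primrec center_families :: "nat \<Rightarrow> ('l list \<Rightarrow> 'l list set) set" where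
  "center_families 0 = base_families"
| "center_families (Suc k) = center_step (\<lambda>a. topspace A - Lk - {a}) ` point_families (center_families k) \<union>
     (\<Union>l\<in>Lk. center_single (\<lambda>a. {}) l ` point_families (center_families k))"

lemma finite_Lk: "finite Lk"
proof -
  have "{l. idx l < n} \<subseteq> LD ` {..<n} \<union> LS ` {..<n} \<union> LT ` {..<n} \<union> LB ` {..<n} \<union> LC ` {..<n}"
  proof
    fix l assume "l \<in> {l. idx l < n}"
    then show "l \<in> LD ` {..<n} \<union> LS ` {..<n} \<union> LT ` {..<n} \<union> LB ` {..<n} \<union> LC ` {..<n}"
      by (cases l) auto
  qed
  then show ?thesis unfolding Lk_def by (meson finite_UnI finite_imageI finite_lessThan finite_subset)
qed

lemma countable_center_families: "countable (center_families k)"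
proof (induction k)
  case 0
  show ?case unfolding center_families.simps base_families_def
    using countable_bad_families countable_finite[OF finite_Lk]
    by (intro countable_Un countable_UN countable_image) auto
next
  case (Suc k)
  then have "countable (point_families (center_families k))" unfolding point_families_def by auto
  then show ?case using countable_finite[OF finite_Lk] by auto
qed

definition good_center :: "('l list \<Rightarrow> 'l list set) \<Rightarrow> bool" where
  "good_center r \<longleftrightarrow> (\<forall>a h. a # h \<in> W \<longrightarrow> even (length h) \<longrightarrow> r (a # h) \<subseteq> mbranch h a \<and> FL (r (a # h)))"

definition good_point :: "('l list \<Rightarrow> 'l list set) \<Rightarrow> bool" where
  "good_point v \<longleftrightarrow> (\<forall>h\<in>W. even (length h) \<longrightarrow> v h \<subseteq> good_part h (topspace A) \<and> FL (v h))"

lemma branch_mbranch: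
  assumes "b \<notin> cl a" "even (length h)"
  shows "branch True (b # a # h) \<subseteq> mbranch h a"
proof
  fix w assume w: "w \<in> branch True (b # a # h)"
  then obtain u where u: "w = u @ b # a # h" by (auto simp: branch_def suffix_def)
  then have "even (length u)" using w assms(2) unfolding branch_def by auto
  then show "w \<in> mbranch h a" using u w assms(1) allbad_append[of u "[b, a]"] unfolding mbranch_def branch_def
    by (intro CollectI exI[of _ "u @ [b]"]) auto
qed

lemma good_part_mbranch:
  assumes "even (length h)" shows "good_part (b # a # h) P \<subseteq> mbranch h a"
proof
  fix w assume "w \<in> good_part (b # a # h) P"
  then obtain v where v: "w = v @ b # a # h" "w \<in> W" "even (length v)" "\<not> allbad v"
    unfolding good_part_iff by blast
  then show "w \<in> mbranch h a" using allbad_append[of v "[b, a]"] unfolding mbranch_def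
    by (intro CollectI exI[of _ "v @ [b]"]) auto
qed

lemma good_part_branch: "even (length y) \<Longrightarrow> good_part y P \<subseteq> branch True y"
  using mbranch_branch[of y] branch_Cons[of True _ y] unfolding good_part_def by auto

lemma good_center_step:
  assumes T: "\<And>a. a \<in> topspace A \<Longrightarrow> T a \<subseteq> topspace A - Lk - {a}"
    and v: "\<And>a h b. a # h \<in> W \<Longrightarrow> even (length h) \<Longrightarrow> b \<in> T a \<Longrightarrow>
      v (b # a # h) \<subseteq> branch True (b # a # h) \<and> v (b # a # h) \<subseteq> mbranch h a \<and> FL (v (b # a # h))"
    and sep: "\<And>a h b. a # h \<in> W \<Longrightarrow> even (length h) \<Longrightarrow> b \<in> T a \<Longrightarrow>
      \<exists>P. openin Z P \<and> v (b # a # h) \<subseteq> P \<and> (\<forall>j<n. lk (LD j) # a # h \<notin> P) \<and>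
        (\<forall>b'\<in>T a. b' \<noteq> b \<longrightarrow> P \<inter> v (b' # a # h) = {})"
  shows "good_center (center_step T v)"
  unfolding good_center_def center_step_def
proof (intro allI impI conjI)
  fix a h assume g: "a # h \<in> W" "even (length h)"
  have a: "a \<in> topspace A" using g(1) by (simp add: W_Cons)
  show "FL (collect (center_limits (a # h)) (T (hd (a # h))) (\<lambda>b. v (b # a # h)))"
    using FL_center[OF g T[OF a], of v] v[OF g] sep[OF g] by simp
  have "center_limits (a # h) \<subseteq> mbranch h a"
  proof
    fix x assume "x \<in> center_limits (a # h)"
    then obtain j where j: "j < n" "x = lk (LD j) # a # h" "x \<in> W" by (rule center_limitsE[OF g(1)])
    have "lk (LD j) \<notin> cl a" using lk_bad[of "LD j" a h] j by auto
    then show "x \<in> mbranch h a" using branch_mbranch[of "lk (LD j)" a h] branch_self[OF j(3), of True] g(2) j(2) by auto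
  qed
  then show "collect (center_limits (a # h)) (T (hd (a # h))) (\<lambda>b. v (b # a # h)) \<subseteq> mbranch h a"
    using v[OF g] unfolding collect_def by auto
qed

lemma good_center_single:
  assumes l: "l \<in> Lk"
    and v: "\<And>a h. l # a # h \<in> W \<Longrightarrow> even (length h) \<Longrightarrow> l \<notin> N a \<Longrightarrow> v (l # a # h) \<subseteq> mbranch h a \<and> FL (v (l # a # h))"
  shows "good_center (center_single N l v)"
  unfolding good_center_def center_single_def using v full_limits_empty by auto

lemma fan_LD:
  assumes "P \<inter> Lk = {}" "j < n" shows "lk (LD j) # g \<notin> fan g P R"
proof
  assume "lk (LD j) # g \<in> fan g P R"
  then obtain b where "b \<in> P" "suffix (b # g) (lk (LD j) # g)" unfolding fan_def by blast
  then have "lk (LD j) \<in> P" using suffix_eqI[of "b # g" "lk (LD j) # g"] by auto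
  then show False using assms lk_Lk[of "LD j"] by auto
qed

lemma openin_fan':
  assumes "a # h \<in> W" "even (length h)" "openin A P" "P \<inter> Lk = {}" "P \<inter> cl a = {}" "R \<subseteq> P"
  shows "openin Z (fan (a # h) P R)"
proof (rule openin_fan)
  have "a \<in> topspace A" using assms(1) by (simp add: W_Cons)
  then show "hd (a # h) \<notin> P" using self_cl assms(5) by auto
  show "lk (LT j) \<notin> P" "lk (LC j) \<notin> P" if "j < n" for j
    using lk_Lk[of "LT j"] lk_Lk[of "LC j"] that assms(4) by auto
  show "finite (topspace A - P) \<and> R = {}" if "j < n" "lk (LD j) \<in> P" for j
    using lk_Lk[of "LD j"] that assms(4) by auto
qed (use assms in auto)

lemma branch_fan:
  assumes "b \<in> P" "b \<notin> R" shows "branch True (b # g) \<subseteq> fan g P R"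
  using assms unfolding branch_def fan_def by auto

text \<open>The map is continuous by the definition of the topology on words. Its inverse is
  continuous because a fan cuts out any prescribed open set of letters, as long as the links and
  \<open>cl a\<close> are left out.\<close>

lemma homeomorphic_map_star:
  assumes g: "a # h \<in> W" "even (length h)" and S: "S \<subseteq> topspace A - Lk - cl a"
  shows "homeomorphic_map (subtopology A S) (subtopology Z ((\<lambda>b. b # a # h) ` S)) (\<lambda>b. b # a # h)"
proof (rule homeomorphic_maps_imp_map)
  let ?g = "a # h" and ?S = "(\<lambda>b. b # a # h) ` S"
  have a: "a \<in> topspace A" using g(1) by (simp add: W_Cons)
  have Ia: "b \<in> topspace A" "b \<notin> cl a" "b \<notin> Lk" "b \<noteq> a" "b # ?g \<in> W" if "b \<in> S" for b
    using S that self_cl[OF a] g by (auto simp: W_Cons)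
  have SW: "?S \<subseteq> W" using Ia by auto
  have IA: "S \<subseteq> topspace A" using Ia by blast
  show "homeomorphic_maps (subtopology A S) (subtopology Z ?S) (\<lambda>b. b # ?g) hd"
    unfolding homeomorphic_maps_def
  proof (intro conjI)
    have "continuous_map (subtopology A S) Z (\<lambda>b. b # ?g)"
      unfolding continuous_map_def
    proof (intro conjI allI impI)
      fix U assume U: "openin Z U"
      have "{b \<in> topspace (subtopology A S). b # ?g \<in> U} = {b \<in> topspace A. mul ?g b \<in> U} \<inter> S"
        using IA Ia(4) by (force simp: mul_def)
      moreover have "openin A {b \<in> topspace A. mul ?g b \<in> U}"
        using U word_openD(2) g(1) unfolding openin_Z by blast
      ultimately show "openin (subtopology A S) {b \<in> topspace (subtopology A S). b # ?g \<in> U}"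
        unfolding openin_subtopology by blast
    qed (use Ia in auto)
    then show "continuous_map (subtopology A S) (subtopology Z ?S) (\<lambda>b. b # ?g)"
      by (auto simp: continuous_map_in_subtopology)
    have "continuous_map (subtopology Z ?S) A hd"
      unfolding continuous_map_def
    proof (intro conjI allI impI)
      fix P assume P: "openin A P"
      let ?P = "P \<inter> (topspace A - Lk) \<inter> (topspace A - cl a)"
      have "openin Z (fan ?g ?P {})"
        using P openin_nonLk open_cl by (intro openin_fan' g openin_Int) auto
      moreover have "{x \<in> topspace (subtopology Z ?S). hd x \<in> P} = fan ?g ?P {} \<inter> ?S"
      proof -
        have "b # ?g \<in> fan ?g ?P {} \<longleftrightarrow> b \<in> P" if b: "b \<in> S" for b
        proof
          assume "b # ?g \<in> fan ?g ?P {}"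
          then obtain b' where "b' \<in> ?P" "suffix (b' # ?g) (b # ?g)" unfolding fan_def by blast
          then show "b \<in> P" using suffix_eqI[of "b' # ?g" "b # ?g"] by auto
        next
          assume "b \<in> P"
          then show "b # ?g \<in> fan ?g ?P {}" using Ia[OF b] g(2) unfolding fan_def by auto
        qed
        then show ?thesis using SW by auto
      qed
      ultimately show "openin (subtopology Z ?S) {x \<in> topspace (subtopology Z ?S). hd x \<in> P}"
        unfolding openin_subtopology by blast
    qed (use IA in auto)
    then show "continuous_map (subtopology Z ?S) (subtopology A S) hd"
      by (auto simp: continuous_map_in_subtopology)
  qed auto
qed

lemma good_star_piece: "good_center star_piece"
  unfolding good_center_def
proof (intro allI impI conjI)
  fix a h assume g: "a # h \<in> W" "even (length h)"
  have a: "a \<in> topspace A" using g(1) by (simp add: W_Cons)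
  have Ia: "I a \<subseteq> topspace A - Lk - cl a" using I_sub[OF a] unfolding Lk_def .
  show "star_piece (a # h) \<subseteq> mbranch h a"
  proof
    fix w assume "w \<in> star_piece (a # h)"
    then obtain b where b: "b \<in> I a" "w = b # a # h" unfolding star_piece_def by auto
    then have "b \<notin> cl a" "w \<in> branch True (b # a # h)"
      using Ia self_cl[OF a] g by (auto simp: branch_def W_Cons)
    then show "w \<in> mbranch h a" using branch_mbranch[OF _ g(2)] by blast
  qed
  show "FL (star_piece (a # h))"
    using full_limits_homeomorphic_map[OF homeomorphic_map_star[OF g Ia] I_full[OF a]]
    unfolding star_piece_def by simp
qed

text \<open>A letter \<open>b\<close> outside \<open>B\<close> has the neighbourhood
  \<open>insert b B\<close>, which contains no other letter outside \<open>B\<close>; the fan over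
  it meets no other piece.\<close>

lemma good_center_step_isolated_piece: "good_center (center_step (\<lambda>a. topspace A - Lk - B - cl a) isolated_piece)"
proof (rule good_center_step)
  fix a assume "a \<in> topspace A"
  then show "topspace A - Lk - B - cl a \<subseteq> topspace A - Lk - {a}" using self_cl by auto
next
  fix a h b assume g: "a # h \<in> W" "even (length h)" and b: "b \<in> topspace A - Lk - B - cl a"
  have a: "a \<in> topspace A" using g(1) by (simp add: W_Cons)
  have W: "b' # a # h \<in> W" if "b' \<in> topspace A - Lk - B - cl a" for b'
    using g(1) that self_cl[OF a] by (auto simp: W_Cons)
  have br: "isolated_piece (b' # a # h) \<subseteq> branch True (b' # a # h)" if "b' \<in> topspace A - Lk - B - cl a" for b'
    using isolated_piece_branch[OF W[OF that]] g(2) by simp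
  show "isolated_piece (b # a # h) \<subseteq> branch True (b # a # h) \<and> isolated_piece (b # a # h) \<subseteq> mbranch h a \<and> FL (isolated_piece (b # a # h))"
    using br[OF b] branch_mbranch[of b a h] b g(2) FL_isolated_piece[OF W[OF b]] by auto
  let ?P = "insert b B \<inter> (topspace A - cl a)"
  have "openin A (insert b B)" using open_insert_B b unfolding Lk_def by blast
  then have P: "openin A ?P" using open_cl by (rule openin_Int)
  have PL: "?P \<inter> Lk = {}" using b B_sub unfolding Lk_def by blast
  have "fan (a # h) ?P {} \<inter> isolated_piece (b' # a # h) = {}"
    if b': "b' \<in> topspace A - Lk - B - cl a" "b' \<noteq> b" for b'
  proof (rule ccontr)
    assume "fan (a # h) ?P {} \<inter> isolated_piece (b' # a # h) \<noteq> {}"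
    then obtain w c where w: "c \<in> ?P" "suffix (c # a # h) w" "suffix (b' # a # h) w"
      using br[OF b'(1)] unfolding fan_def branch_def by blast
    then have "c = b'" using suffix_cmp[OF w(2,3)] suffix_eqI[of "c # a # h"] suffix_eqI[of "b' # a # h"] by fastforce
    then show False using w(1) b' by blast
  qed
  moreover have "isolated_piece (b # a # h) \<subseteq> fan (a # h) ?P {}"
    using br[OF b] branch_fan[of b ?P "{}" "a # h"] b by blast
  ultimately show "\<exists>P. openin Z P \<and> isolated_piece (b # a # h) \<subseteq> P \<and> (\<forall>j<n. lk (LD j) # a # h \<notin> P) \<and>
        (\<forall>b'\<in>topspace A - Lk - B - cl a. b' \<noteq> b \<longrightarrow> P \<inter> isolated_piece (b' # a # h) = {})"
    using openin_fan'[OF g P PL, of "{}"] fan_LD[OF PL] by (intro exI[of _ "fan (a # h) ?P {}"]) auto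
qed

text \<open>The neighbours of \<open>b\<close> cannot be kept out of the fan. Instead their branches
  are cut behind a first bad step, which is where their pieces lie, while the branch over
  \<open>b\<close> stays complete.\<close>

lemma good_center_step_bad_families:
  assumes q: "q \<in> bad_families (Suc k)" shows "good_center (center_step (\<lambda>a. topspace A - Lk - cl a) q)"
proof (rule good_center_step)
  fix a assume "a \<in> topspace A"
  then show "topspace A - Lk - cl a \<subseteq> topspace A - Lk - {a}" using self_cl by auto
next
  fix a h b assume g: "a # h \<in> W" "even (length h)" and b: "b \<in> topspace A - Lk - cl a"
  have a: "a \<in> topspace A" using g(1) by (simp add: W_Cons)
  have qb: "q (b' # a # h) \<subseteq> branch True (b' # a # h) \<and> FL (q (b' # a # h)) \<and> q (b' # a # h) \<subseteq> Bad (b' # a # h)"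
    if "b' \<in> topspace A - Lk - cl a" for b'
  proof -
    have "b' # a # h \<in> W" using g(1) that self_cl[OF a] by (auto simp: W_Cons)
    then show ?thesis using bad_families_FL[OF q, of "b' # a # h"] g(2) by simp
  qed
  show "q (b # a # h) \<subseteq> branch True (b # a # h) \<and> q (b # a # h) \<subseteq> mbranch h a \<and> FL (q (b # a # h))"
    using qb[OF b] branch_mbranch[of b a h] b g(2) by auto
  let ?P = "(topspace A - Lk) \<inter> (topspace A - cl a)"
  have P: "openin A ?P" using open_cl openin_nonLk by (intro openin_Int) auto
  have PL: "?P \<inter> Lk = {}" by blast
  have "fan (a # h) ?P (?P - {b}) \<inter> q (b' # a # h) = {}"
    if b': "b' \<in> topspace A - Lk - cl a" "b' \<noteq> b" for b'
  proof (rule ccontr)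
    assume "fan (a # h) ?P (?P - {b}) \<inter> q (b' # a # h) \<noteq> {}"
    then obtain w where w: "w \<in> fan (a # h) ?P (?P - {b})" "w \<in> q (b' # a # h)" by blast
    then obtain c where c: "suffix (c # a # h) w"
      "c \<in> ?P - {b} \<longrightarrow> \<not> (\<exists>a'. \<exists>c'\<in>F a'. suffix (c' # a' # c # a # h) w)"
      unfolding fan_def by blast
    have w': "suffix (b' # a # h) w" "w \<in> Bad (b' # a # h)" using qb[OF b'(1)] w(2) unfolding branch_def by auto
    then have "c = b'" using suffix_cmp[OF c(1) w'(1)] suffix_eqI[of "c # a # h"] suffix_eqI[of "b' # a # h"] by fastforce
    then show False using c(2) b' w'(2) unfolding Bad_def by blast
  qed
  moreover have "q (b # a # h) \<subseteq> fan (a # h) ?P (?P - {b})"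
    using qb[OF b] branch_fan[of b ?P "?P - {b}" "a # h"] b by blast
  ultimately show "\<exists>P. openin Z P \<and> q (b # a # h) \<subseteq> P \<and> (\<forall>j<n. lk (LD j) # a # h \<notin> P) \<and>
        (\<forall>b'\<in>topspace A - Lk - cl a. b' \<noteq> b \<longrightarrow> P \<inter> q (b' # a # h) = {})"
    using openin_fan'[OF g P PL, of "?P - {b}"] fan_LD[OF PL]
    by (intro exI[of _ "fan (a # h) ?P (?P - {b})"]) auto
qed

text \<open>\<open>good_part (b # a # h) (topspace A)\<close> is an open set within the branch over
  \<open>b\<close> and contains the piece, so no neighbourhood of the letter \<open>b\<close> is
  involved.\<close>

lemma good_center_step_v:
  assumes v: "good_point v" shows "good_center (center_step (\<lambda>a. topspace A - Lk - {a}) v)"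
proof (rule good_center_step)
  fix a h b assume g: "a # h \<in> W" "even (length h)" and b: "b \<in> topspace A - Lk - {a}"
  have W: "b' # a # h \<in> W" if "b' \<in> topspace A - Lk - {a}" for b' using g that by (auto simp: W_Cons)
  have vb: "v (b' # a # h) \<subseteq> good_part (b' # a # h) (topspace A) \<and> FL (v (b' # a # h))" if "b' \<in> topspace A - Lk - {a}" for b'
    using v W[OF that] g(2) unfolding good_point_def by simp
  have good_part: "good_part (b' # a # h) (topspace A) \<subseteq> branch True (b' # a # h)" for b'
    using g(2) by (intro good_part_branch) simp
  show "v (b # a # h) \<subseteq> branch True (b # a # h) \<and> v (b # a # h) \<subseteq> mbranch h a \<and> FL (v (b # a # h))"
    using vb[OF b] good_part[of b] good_part_mbranch[OF g(2)] by blast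
  have "openin Z (good_part (b # a # h) (topspace A))"
    using W[OF b] g(2) by (intro openin_good_part) auto
  moreover have "lk (LD j) # a # h \<notin> good_part (b # a # h) (topspace A)" for j
  proof
    assume "lk (LD j) # a # h \<in> good_part (b # a # h) (topspace A)"
    then obtain u where "lk (LD j) # a # h = u @ b # a # h" "u \<noteq> []" unfolding good_part_iff by blast
    then have "length (lk (LD j) # a # h) = length (u @ b # a # h)" "length u > 0" by simp_all
    then show False by simp
  qed
  moreover have "good_part (b # a # h) (topspace A) \<inter> v (b' # a # h) = {}"
    if "b' \<in> topspace A - Lk - {a}" "b' \<noteq> b" for b'
    using vb[OF that(1)] good_part[of b] good_part[of b'] branch_disjoint[of "b # a # h" "b' # a # h" True True] that(2) by auto
  ultimately show "\<exists>P. openin Z P \<and> v (b # a # h) \<subseteq> P \<and> (\<forall>j<n. lk (LD j) # a # h \<notin> P) \<and>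
        (\<forall>b'\<in>topspace A - Lk - {a}. b' \<noteq> b \<longrightarrow> P \<inter> v (b' # a # h) = {})"
    using vb[OF b] by (intro exI[of _ "good_part (b # a # h) (topspace A)"]) auto
qed simp

lemma good_base_families: "r \<in> base_families \<Longrightarrow> good_center r"
proof -
  assume "r \<in> base_families"
  then consider "r = star_piece" | "r = center_step (\<lambda>a. topspace A - Lk - B - cl a) isolated_piece"
    | k q where "q \<in> bad_families (Suc k)" "r = center_step (\<lambda>a. topspace A - Lk - cl a) q"
    | l k q where "l \<in> Lk" "q \<in> bad_families k" "r = center_single cl l q"
    unfolding base_families_def by blast
  then show ?thesis
  proof cases
    case 4
    show ?thesis unfolding 4(3)
    proof (rule good_center_single[OF 4(1)])
      fix a h assume h: "l # a # h \<in> W" "even (length h)" "l \<notin> cl a"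
      then show "q (l # a # h) \<subseteq> mbranch h a \<and> FL (q (l # a # h))"
        using bad_families_FL[OF 4(2) h(1)] branch_mbranch[OF h(3,2)] by auto
    qed
  qed (use good_star_piece good_center_step_isolated_piece good_center_step_bad_families in auto)
qed

lemma good_point_families:
  assumes R: "\<And>r. r \<in> R \<Longrightarrow> good_center r" and v: "v \<in> point_families R"
  shows "good_point v"
proof -
  consider r where "r \<in> R" "v = point_step r" | j r where "j < n" "r \<in> R" "v = point_single j r"
    using v unfolding point_families_def by blast
  then show ?thesis
  proof cases
    case 1
    show ?thesis unfolding good_point_def 1(2) point_step_def
      using FL_point[of _ r] R[OF 1(1)] unfolding good_center_def by blast
  next
    case 2
    have sub: "mbranch h (lk (LS j)) \<subseteq> good_part h (topspace A)" for h
      using lk_in[of "LS j"] 2(1) unfolding good_part_def by auto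
    show ?thesis unfolding good_point_def
    proof (intro ballI impI)
      fix h assume h: "h \<in> W" "even (length h)"
      show "v h \<subseteq> good_part h (topspace A) \<and> FL (v h)"
      proof (cases "lk (LS j) # h \<in> W")
        case True
        then have "r (lk (LS j) # h) \<subseteq> mbranch h (lk (LS j)) \<and> FL (r (lk (LS j) # h))"
          using R[OF 2(2)] h(2) unfolding good_center_def by blast
        then show ?thesis using sub[of h] True unfolding 2(3) point_single_def by auto
      qed (use full_limits_empty[of n Z] in \<open>simp add: 2(3) point_single_def\<close>)
    qed
  qed
qed

lemma good_center_families: "r \<in> center_families k \<Longrightarrow> good_center r"
proof (induction k arbitrary: r)
  case 0
  then show ?case using good_base_families by simp
next
  case (Suc k)
  have gv: "good_point v" if "v \<in> point_families (center_families k)" for v using good_point_families[OF Suc.IH that] .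
  consider v where "v \<in> point_families (center_families k)" "r = center_step (\<lambda>a. topspace A - Lk - {a}) v"
    | l v where "l \<in> Lk" "v \<in> point_families (center_families k)" "r = center_single (\<lambda>a. {}) l v"
    using Suc.prems by auto
  then show ?case
  proof cases
    case 2
    show ?thesis unfolding 2(3)
    proof (rule good_center_single[OF 2(1)])
      fix a h assume h: "l # a # h \<in> W" "even (length h)"
      then show "v (l # a # h) \<subseteq> mbranch h a \<and> FL (v (l # a # h))"
        using gv[OF 2(2)] good_part_mbranch[OF h(2), of l a "topspace A"] unfolding good_point_def by fastforce
    qed
  qed (use good_center_step_v gv in auto)
qed

section \<open>Covering the space of words\<close>

lemma point_families_cover:
  assumes r: "r \<in> R" "x \<in> r (a # h)" and a: "a # h \<in> W"
  shows "\<exists>v\<in>point_families R. x \<in> v h"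
proof (cases "a \<in> (\<lambda>j. lk (LS j)) ` {..<n}")
  case True
  then obtain j where j: "j < n" "a = lk (LS j)" by auto
  then have "x \<in> point_single j r h" using r(2) a unfolding point_single_def by simp
  then show ?thesis using r(1) j(1) unfolding point_families_def by blast
next
  case False
  then have "x \<in> point_step r h" using r(2) a unfolding point_step_def by (intro collectI[of a]) auto
  then show ?thesis using r(1) unfolding point_families_def by blast
qed

text \<open>Induction on the step next to \<open>h\<close>. If a good step comes later, the rest of
  the word is already covered one step further out. Otherwise this step is the only good one, and
  the case analysis is that of \<open>base_families\<close>.\<close>

lemma point_families_cover_all:
  "u @ h \<in> W \<Longrightarrow> even (length u) \<Longrightarrow> \<not> allbad u \<Longrightarrow> \<exists>k. \<exists>v\<in>point_families (center_families k). u @ h \<in> v h"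
proof (induction "length u" arbitrary: u h rule: less_induct)
  case less
  show ?case
  proof (cases u rule: rev_cases)
    case Nil
    then show ?thesis using less.prems(3) by simp
  next
    case (snoc u1 a)
    then obtain v b where v: "u = v @ [b, a]" using less.prems(2) by (cases u1 rule: rev_cases) auto
    have ev: "even (length v)" using less.prems(2) v by simp
    have vW: "v @ b # a # h \<in> W" using less.prems(1) v by simp
    have w: "b # a # h \<in> W" using vW W_suffix[of "b # a # h" "v @ b # a # h"] by (auto simp: suffix_def)
    then have ah: "a # h \<in> W" "b \<noteq> a" "b \<in> topspace A" by (auto simp: W_Cons)
    have a: "a \<in> topspace A" using ah(1) by (simp add: W_Cons)
    have "\<exists>k. \<exists>r\<in>center_families k. u @ h \<in> r (a # h)"
    proof (cases "allbad v")
      case False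
      then obtain k x where x: "x \<in> point_families (center_families k)" "u @ h \<in> x (b # a # h)"
        using less.hyps[of v "b # a # h"] vW ev v by auto
      show ?thesis
      proof (cases "b \<in> Lk")
        case True
        then have "center_single (\<lambda>a. {}) b x \<in> center_families (Suc k)" using x(1) by auto
        moreover have "u @ h \<in> center_single (\<lambda>a. {}) b x (a # h)" using x(2) w unfolding center_single_def by simp
        ultimately show ?thesis by blast
      next
        case False
        have "center_step (\<lambda>a. topspace A - Lk - {a}) x \<in> center_families (Suc k)" using x(1) by auto
        moreover have "u @ h \<in> center_step (\<lambda>a. topspace A - Lk - {a}) x (a # h)"
          using x(2) ah False unfolding center_step_def by (intro collectI[of b]) auto
        ultimately show ?thesis by blast
      qed
    next
      case True
      then have b: "b \<notin> cl a" using less.prems(3) v allbad_append[OF ev] by auto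
      obtain q where q: "q \<in> bad_families (length v div 2)" "u @ h \<in> q (b # a # h)"
        using bad_families_cover[OF vW ev True] v by auto
      have "\<exists>r\<in>base_families. u @ h \<in> r (a # h)"
      proof (cases "b \<in> Lk")
        case True
        then have "u @ h \<in> center_single cl b q (a # h)" using q(2) w b unfolding center_single_def by simp
        then show ?thesis using q(1) True unfolding base_families_def by blast
      next
        case nL: False
        show ?thesis
        proof (cases "length v div 2")
          case (Suc k)
          have "u @ h \<in> center_step (\<lambda>a. topspace A - Lk - cl a) q (a # h)"
            using q(2) ah nL b unfolding center_step_def by (intro collectI[of b]) auto
          moreover have "center_step (\<lambda>a. topspace A - Lk - cl a) q \<in> base_families"
            using q(1) unfolding base_families_def Suc by blast
          ultimately show ?thesis by blast
        next
          case 0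
          \<comment> \<open>No further step follows, so the word is a point of the copy at
            \<open>a # h\<close> itself.\<close>
          then have v0: "v = []" using ev by auto
          show ?thesis
          proof (cases "b \<in> B")
            case True
            then have "b \<in> I a" using B_I[OF a] b by blast
            then have "u @ h \<in> star_piece (a # h)" using v v0 unfolding star_piece_def by simp
            then show ?thesis unfolding base_families_def by blast
          next
            case False
            have "u @ h \<in> center_step (\<lambda>a. topspace A - Lk - B - cl a) isolated_piece (a # h)"
              using ah nL b False v v0 unfolding center_step_def by (intro collectI[of b]) (auto simp: isolated_piece_def)
            then show ?thesis unfolding base_families_def by blast
          qed
        qed
      qed
      then show ?thesis by (intro exI[of _ 0]) simp
    qed
    then show ?thesis using point_families_cover[OF _ _ ah(1)] by meson
  qed
qed

text \<open>Words without a good step acquire one under left multiplication, and words of odd length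
  become even.\<close>

lemma countable_cover_Z: "\<exists>\<C>. countable \<C> \<and> \<Union>\<C> = W \<and> (\<forall>C\<in>\<C>. FL C)"
proof -
  define \<V> where "\<V> = (\<Union>k. (\<lambda>v. v []) ` point_families (center_families k))"
  have cV: "countable \<V>" unfolding \<V>_def point_families_def using countable_center_families by auto
  have FV: "FL C \<and> C \<subseteq> W" if C: "C \<in> \<V>" for C
  proof -
    obtain k v where v: "C = v []" "v \<in> point_families (center_families k)" using C unfolding \<V>_def by blast
    have "good_point v" using good_point_families[OF good_center_families v(2)] .
    then have "FL (v []) \<and> v [] \<subseteq> good_part [] (topspace A)" unfolding good_point_def by simp
    then show ?thesis using v(1) mbranch_sub unfolding good_part_def by blast
  qed
  \<comment> \<open>\<open>d\<close> and \<open>e\<close> are isolated closed letters, neither in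
    the closure of the other; multiplication by \<open>f\<close> changes the parity.\<close>
  define d e f where "d = lk (LD 0)" and "e = lk (LD 1)" and "f = lk (LS 0)"
  have deA: "d \<in> topspace A" "e \<in> topspace A" "f \<in> topspace A"
    unfolding d_def e_def f_def using lk_in n2 by auto
  have cov: "w \<in> \<Union>\<V>" if w: "w \<in> W" "even (length w)" "\<not> allbad w" for w
    using point_families_cover_all[of w "[]"] w unfolding \<V>_def by auto
  have imgFL: "FL (lmul c ` C) \<and> lmul c ` C \<subseteq> W" if c: "c \<in> topspace A" "FL C" "C \<subseteq> W" for c C
  proof
    have "homeomorphic_map (subtopology Z C) (subtopology Z (lmul c ` C)) (lmul c)"
      using homeomorphic_map_subtopologies[OF homeomorphic_map_lmul[OF c(1)], of C "lmul c ` C"] c(3)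
      lmul_in[OF _ c(1)] by (auto simp: Int_absorb1 image_subset_iff subset_iff)
    then show "FL (lmul c ` C)" using c(2) by (rule full_limits_homeomorphic_map)
    show "lmul c ` C \<subseteq> W" using c lmul_in by blast
  qed
  define \<V>1 where "\<V>1 = \<V> \<union> (\<lambda>C. lmul e ` lmul d ` C) ` \<V>"
  define \<V>2 where "\<V>2 = \<V>1 \<union> (\<lambda>C. lmul f ` C) ` \<V>1"
  have F1: "FL C \<and> C \<subseteq> W" if C: "C \<in> \<V>1" for C
  proof -
    consider "C \<in> \<V>" | D where "D \<in> \<V>" "C = lmul e ` lmul d ` D" using C unfolding \<V>1_def by blast
    then show ?thesis
    proof cases
      case 2
      then have "FL (lmul d ` D) \<and> lmul d ` D \<subseteq> W" using FV[OF 2(1)] imgFL[OF deA(1)] by blast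
      then show ?thesis using imgFL[OF deA(2)] 2(2) by blast
    qed (use FV in blast)
  qed
  have F2: "FL C \<and> C \<subseteq> W" if C: "C \<in> \<V>2" for C
  proof -
    consider "C \<in> \<V>1" | D where "D \<in> \<V>1" "C = lmul f ` D" using C unfolding \<V>2_def by blast
    then show ?thesis using F1 imgFL[OF deA(3)] by cases blast+
  qed
  have cov1: "w \<in> \<Union>\<V>1" if w: "w \<in> W" "even (length w)" for w
  proof (cases "allbad w")
    case False
    then show ?thesis using cov[OF w] unfolding \<V>1_def by blast
  next
    case True
    have ne: "last w \<noteq> e" if w0: "w \<noteq> []"
    proof
      assume l: "last w = e"
      then obtain u1 where "w = u1 @ [e]" using w0 by (cases w rule: rev_cases) simp_all
      then obtain u b where u: "w = u @ [b, e]" using w(2) by (cases u1 rule: rev_cases) auto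
      have "b \<in> cl e" using True u w(2) allbad_append[of u "[b, e]"] by auto
      then have "b = e" using cl_lk[of "LD 1"] n2 unfolding e_def by auto
      then show False using w(1) u unfolding W_def by (auto simp: distinct_adj_append_iff)
    qed
    \<comment> \<open>Adds a first step from \<open>d\<close> to \<open>e\<close>, which is good
      because \<open>cl d = {d}\<close>.\<close>
    let ?w = "w @ [e, d]"
    have ed: "e \<noteq> d" unfolding e_def d_def by simp
    have m: "lmul d (lmul e w) = ?w" using ne ed by (auto simp: lmul_def)
    have "e \<notin> cl d" using cl_lk[of "LD 0"] n2 ed unfolding d_def e_def by auto
    then have "\<not> allbad ?w" using allbad_append[of w "[e, d]"] w(2) by simp
    moreover have "?w \<in> W" using m lmul_in w(1) deA by metis
    ultimately obtain C where C: "C \<in> \<V>" "?w \<in> C" using cov[of ?w] w(2) by auto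
    have "lmul d ?w = lmul e w" using lmul_lmul[OF lmul_in[OF w(1) deA(2)], of d] m by simp
    then have "lmul e (lmul d ?w) = w" using lmul_lmul[OF w(1)] by simp
    then have "w \<in> lmul e ` lmul d ` C" using C(2) by (metis imageI)
    then show ?thesis using C(1) unfolding \<V>1_def by blast
  qed
  have cov2: "w \<in> \<Union>\<V>2" if w: "w \<in> W" for w
  proof (cases "even (length w)")
    case True
    then show ?thesis using cov1[OF w] unfolding \<V>2_def by blast
  next
    case False
    then have "lmul f w \<in> \<Union>\<V>1" using cov1[OF lmul_in[OF w deA(3)]] even_length_lmul[of f w] by simp
    then obtain C where "C \<in> \<V>1" "lmul f w \<in> C" by blast
    then have "w \<in> lmul f ` C" using lmul_lmul[OF w] by (metis imageI)
    then show ?thesis using \<open>C \<in> \<V>1\<close> unfolding \<V>2_def by blast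
  qed
  have "\<Union>\<V>2 = W" using cov2 F2 by blast
  moreover have "countable \<V>2" using cV unfolding \<V>2_def \<V>1_def by auto
  ultimately show ?thesis using F2 by blast
qed

text \<open>The open sets above consist of even words, so the copy used has a centre of odd length:
  the one-letter word \<open>LD 0\<close>, whose closure contains no letter of
  \<open>S\<close>.\<close>

lemma embedding_map_letters:
  assumes "S \<subseteq> topspace A - Lk"
  shows "embedding_map (subtopology A S) Z (\<lambda>b. [b, lk (LD 0)])"
proof -
  have "lk (LD 0) \<in> topspace A" "cl (lk (LD 0)) \<subseteq> Lk"
    using lk_in[of "LD 0"] cl_lk[of "LD 0"] lk_Lk[of "LD 0"] n2 by auto
  then have "homeomorphic_map (subtopology A S) (subtopology Z ((\<lambda>b. [b, lk (LD 0)]) ` S)) (\<lambda>b. [b, lk (LD 0)])"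
    using assms by (intro homeomorphic_map_star) (auto simp: W_Cons)
  moreover have "topspace (subtopology A S) = S" using assms by auto
  ultimately show ?thesis unfolding embedding_map_def by simp
qed

end

section \<open>The letters of an \<open>n\<close>-Hausdorff space\<close>

text \<open>\<open>New U j\<close> is an additional limit of the open ultrafilter \<open>U\<close>,
  with number \<open>j\<close>.\<close>

datatype 'a letter = Base 'a | New "'a set set" nat | Link link

text \<open>Every neighbourhood of each of these points contains \<open>x\<close>; if there were
  infinitely many, no choice of neighbourhoods would have an empty intersection.\<close>

lemma n_Hausdorff_finite_specializations:
  assumes X: "n_Hausdorff n X" and "n > 0"
  shows "finite {y \<in> topspace X. \<forall>P. openin X P \<and> y \<in> P \<longrightarrow> x \<in> P}"
proof (rule ccontr)
  let ?C = "{y \<in> topspace X. \<forall>P. openin X P \<and> y \<in> P \<longrightarrow> x \<in> P}"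
  assume inf: "infinite ?C"
  have "?C \<subseteq> topspace X \<and> (infinite ?C \<or> n \<le> card ?C)" using inf by blast
  note X[unfolded n_Hausdorff_iff, THEN spec, THEN mp, OF this]
  then obtain U where U: "\<forall>a\<in>?C. openin X (U a) \<and> a \<in> U a" "topspace X \<inter> (\<Inter>a\<in>?C. U a) = {}"
    by (elim exE conjE)
  have xU: "x \<in> U a" if "a \<in> ?C" for a using U(1) that by blast
  obtain y where y: "y \<in> ?C" using infinite_imp_nonempty[OF inf] unfolding ex_in_conv[symmetric] by (rule exE)
  have "x \<in> topspace X" using xU[OF y] U(1) y openin_subset by blast
  then show False using xU U(2) by blast
qed

locale T0_space =
  fixes X :: "'a topology" and n :: nat
  assumes n2: "n \<ge> 2" and X: "n_Hausdorff n X"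
    and T0: "x \<in> X closure_of {y} \<Longrightarrow> y \<in> X closure_of {x} \<Longrightarrow> x = y"
begin

text \<open>Fewer than \<open>n\<close> new limits of one ultrafilter are used at a time. With
  \<open>2 * n\<close> of them, they can always be chosen different from a given letter.\<close>

definition letter_set :: "'a letter set" where
  "letter_set = Base ` topspace X \<union> {New U j | U j. open_ultrafilter X U \<and> j < 2 * n} \<union> Link ` {l. idx l < n}"

text \<open>The last condition puts \<open>Link (LC j)\<close> into the closure of
  \<open>Link (LB j)\<close>, which makes the step between them bad.\<close>

definition letter_open :: "'a letter set \<Rightarrow> bool" where
  "letter_open P \<longleftrightarrow> P \<subseteq> letter_set \<and> openin X {x. Base x \<in> P} \<and>
     (\<forall>U j. New U j \<in> P \<longrightarrow> {x. Base x \<in> P} \<in> U) \<and> (\<forall>j. Link (LC j) \<in> P \<longrightarrow> Link (LB j) \<in> P)"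

definition L :: "'a letter topology" where "L = topology letter_open"

lemma New_letter_set: "New U j \<in> letter_set \<longleftrightarrow> open_ultrafilter X U \<and> j < 2 * n"
  and Base_letter_set: "Base x \<in> letter_set \<longleftrightarrow> x \<in> topspace X"
  and Link_letter_set: "Link l \<in> letter_set \<longleftrightarrow> idx l < n"
  unfolding letter_set_def by auto

lemma istopology_letter_open: "istopology letter_open"
  unfolding istopology_def
proof (intro conjI allI impI)
  fix S T assume ST: "letter_open S" "letter_open T"
  have e: "{x. Base x \<in> S \<inter> T} = {x. Base x \<in> S} \<inter> {x. Base x \<in> T}" by blast
  show "letter_open (S \<inter> T)"
    unfolding letter_open_def e
  proof (intro conjI allI impI)
    fix U j assume "New U j \<in> S \<inter> T"
    then have "{x. Base x \<in> S} \<in> U" "{x. Base x \<in> T} \<in> U" "open_ultrafilter X U"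
      using ST New_letter_set[of U j] unfolding letter_open_def by blast+
    then show "{x. Base x \<in> S} \<inter> {x. Base x \<in> T} \<in> U" using open_ultrafilterD(3) by blast
  qed (use ST in \<open>auto simp: letter_open_def\<close>)
next
  fix \<K> assume K: "\<forall>K\<in>\<K>. letter_open K"
  have e: "{x. Base x \<in> \<Union>\<K>} = (\<Union>K\<in>\<K>. {x. Base x \<in> K})" by blast
  have op: "openin X {x. Base x \<in> \<Union>\<K>}" unfolding e using K unfolding letter_open_def by blast
  show "letter_open (\<Union>\<K>)"
    unfolding letter_open_def
  proof (intro conjI allI impI)
    fix U j assume "New U j \<in> \<Union>\<K>"
    then obtain K where k: "K \<in> \<K>" "New U j \<in> K" by blast
    then have "letter_open K" using K by simp
    then have "{x. Base x \<in> K} \<in> U" "open_ultrafilter X U"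
      using k(2) New_letter_set[of U j] unfolding letter_open_def by blast+
    note U = this
    have "{x. Base x \<in> K} \<subseteq> {x. Base x \<in> \<Union>\<K>}" using k(1) by blast
    from open_ultrafilter_upward[OF U(2,1) this op] show "{x. Base x \<in> \<Union>\<K>} \<in> U" .
  next
    fix j assume "Link (LC j) \<in> \<Union>\<K>"
    then show "Link (LB j) \<in> \<Union>\<K>" using K unfolding letter_open_def by blast
  qed (use K op in \<open>auto simp: letter_open_def\<close>)
qed

lemma openin_L: "openin L P \<longleftrightarrow> letter_open P"
  unfolding L_def by (simp add: topology_inverse'[OF istopology_letter_open])

lemma topspace_L [simp]: "topspace L = letter_set"
proof -
  have e: "{x. Base x \<in> letter_set} = topspace X" by (auto simp: Base_letter_set)
  have "letter_open letter_set" unfolding letter_open_def e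
    using open_ultrafilter_topspace by (auto simp: New_letter_set Link_letter_set)
  then have "letter_set \<subseteq> topspace L" using openin_subset[of L letter_set] openin_L by blast
  moreover have "topspace L \<subseteq> letter_set" using openin_L[of "topspace L"] unfolding letter_open_def by simp
  ultimately show ?thesis by (rule subset_antisym[rotated])
qed

lemma open_Base: "openin X V \<Longrightarrow> openin L (Base ` V)"
proof -
  assume V: "openin X V"
  have "{x. Base x \<in> Base ` V} = V" by auto
  then show ?thesis using V openin_subset[OF V] unfolding openin_L letter_open_def by (auto simp: Base_letter_set)
qed

lemma open_New:
  assumes "open_ultrafilter X U" "j < 2 * n" "V \<in> U"
  shows "openin L (insert (New U j) (Base ` V))"
proof -
  have "{x. Base x \<in> insert (New U j) (Base ` V)} = V" by auto
  moreover have "openin X V" using open_ultrafilterD(1)[OF assms(1,3)] .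
  ultimately show ?thesis using assms openin_subset[of X V]
    unfolding openin_L letter_open_def by (auto simp: Base_letter_set New_letter_set)
qed

lemma open_Link: "S \<subseteq> {l. idx l < n} \<Longrightarrow> (\<And>j. LC j \<in> S \<Longrightarrow> LB j \<in> S) \<Longrightarrow> openin L (Link ` S)"
proof -
  assume S: "S \<subseteq> {l. idx l < n}" "\<And>j. LC j \<in> S \<Longrightarrow> LB j \<in> S"
  have e: "{x. Base x \<in> Link ` S} = {}" by auto
  show ?thesis using S unfolding openin_L letter_open_def e by (auto simp: Link_letter_set)
qed

section \<open>Closures in the letter space\<close>

lemma in_cl: "b \<in> L closure_of {a} \<longleftrightarrow> b \<in> letter_set \<and> (\<forall>P. openin L P \<and> b \<in> P \<longrightarrow> a \<in> P)"
  unfolding in_closure_of by auto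

lemma in_cl_X: "y \<in> X closure_of {x} \<longleftrightarrow> y \<in> topspace X \<and> (\<forall>P. openin X P \<and> y \<in> P \<longrightarrow> x \<in> P)"
  unfolding in_closure_of by auto

lemma cl_New: assumes "New U j \<in> letter_set" shows "L closure_of {New U j} = {New U j}"
proof -
  have "b = New U j" if b: "b \<in> L closure_of {New U j}" for b
  proof (cases b)
    case (Base y)
    then show ?thesis using b open_Base[OF openin_topspace] unfolding in_cl by (auto simp: Base_letter_set)
  next
    case (New U' j')
    then have "open_ultrafilter X U'" "j' < 2 * n" using b unfolding in_cl by (auto simp: New_letter_set)
    then have "openin L (insert (New U' j') (Base ` topspace X))" by (simp add: open_New open_ultrafilter_topspace)
    then show ?thesis using b New unfolding in_cl by auto
  next
    case (Link l)
    have "openin L (Link ` {l. idx l < n})" by (intro open_Link) auto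
    then show ?thesis using b Link unfolding in_cl by (auto simp: Link_letter_set)
  qed
  moreover have "New U j \<in> L closure_of {New U j}" using assms unfolding in_cl by blast
  ultimately show ?thesis by blast
qed

lemma cl_Link_sub:
  assumes b: "b \<in> L closure_of {Link l}"
  shows "\<exists>l'. b = Link l' \<and> idx l' < n \<and> (l' = l \<or> (\<exists>j. l = LB j \<and> l' = LC j))"
proof (cases b)
  case (Base y)
  then show ?thesis using b open_Base[OF openin_topspace] unfolding in_cl by (auto simp: Base_letter_set)
next
  case (New U' j')
  then have "open_ultrafilter X U'" "j' < 2 * n" using b unfolding in_cl by (auto simp: New_letter_set)
  then have "openin L (insert (New U' j') (Base ` topspace X))" by (simp add: open_New open_ultrafilter_topspace)
  then show ?thesis using b New unfolding in_cl by auto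
next
  case (Link l')
  have l': "idx l' < n" using b Link unfolding in_cl by (simp add: Link_letter_set)
  show ?thesis
  proof (cases "\<exists>j. l' = LC j")
    case True
    then obtain j where j: "l' = LC j" by blast
    have "openin L (Link ` {LB j, LC j})" using l' j by (intro open_Link) auto
    then show ?thesis using b Link j l' unfolding in_cl by blast
  next
    case False
    have "openin L (Link ` {l'})" using l' False by (intro open_Link) auto
    then show ?thesis using b Link l' unfolding in_cl by blast
  qed
qed

lemma cl_Base:
  "Base y \<in> L closure_of {Base x} \<longleftrightarrow> y \<in> X closure_of {x}"
proof
  assume b: "Base y \<in> L closure_of {Base x}"
  show "y \<in> X closure_of {x}"
    unfolding in_cl_X
  proof (intro conjI allI impI)
    fix P assume "openin X P \<and> y \<in> P"
    then show "x \<in> P" using b open_Base[of P] unfolding in_cl by blast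
  qed (use b in \<open>auto simp: in_cl Base_letter_set\<close>)
next
  assume y: "y \<in> X closure_of {x}"
  show "Base y \<in> L closure_of {Base x}"
    unfolding in_cl
  proof (intro conjI allI impI)
    fix P assume "openin L P \<and> Base y \<in> P"
    then have "openin X {x. Base x \<in> P}" "y \<in> {x. Base x \<in> P}" unfolding openin_L letter_open_def by auto
    then show "Base x \<in> P" using y unfolding in_cl_X by blast
  qed (use y in \<open>auto simp: in_cl_X Base_letter_set\<close>)
qed

text \<open>If all members of \<open>U\<close> contain \<open>x\<close>, then no open neighbourhood
  of \<open>x\<close> has a disjoint member, so \<open>U\<close> is the system of all of them. As
  \<open>x\<close> determines \<open>U\<close>, only finitely many new letters lie in the closure of
  a base letter.\<close>

lemma cl_Base_New:
  assumes b: "New U j \<in> L closure_of {Base x}"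
  shows "j < 2 * n" "V \<in> U \<Longrightarrow> x \<in> V" "U = {V. openin X V \<and> x \<in> V}"
proof -
  have U: "open_ultrafilter X U" and j: "j < 2 * n" using b unfolding in_cl by (auto simp: New_letter_set)
  show "j < 2 * n" by (rule j)
  show V: "x \<in> V" if "V \<in> U" for V
    using b open_New[OF U j that] unfolding in_cl by auto
  show "U = {V. openin X V \<and> x \<in> V}"
    using V open_ultrafilterD(1,4)[OF U] by blast
qed

lemma not_Base_cl: "Base y \<notin> L closure_of {Link l}" "New U j \<in> letter_set \<Longrightarrow> Base y \<notin> L closure_of {New U j}"
  using cl_Link_sub[of "Base y" l] cl_New by auto

lemma fin_cl_L: assumes "a \<in> letter_set" shows "finite (L closure_of {a})"
proof (cases a)
  case (Base x)
  have "finite (X closure_of {x})"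
  proof -
    have "X closure_of {x} = {y \<in> topspace X. \<forall>P. openin X P \<and> y \<in> P \<longrightarrow> x \<in> P}"
      by (rule set_eqI) (simp add: in_cl_X)
    moreover have "finite \<dots>" by (rule n_Hausdorff_finite_specializations[OF X]) (use n2 in simp)
    ultimately show ?thesis by (rule ssubst)
  qed
  moreover have "L closure_of {a} \<subseteq> Base ` (X closure_of {x}) \<union> New {V. openin X V \<and> x \<in> V} ` {..<2 * n}"
  proof
    fix b assume b: "b \<in> L closure_of {a}"
    show "b \<in> Base ` (X closure_of {x}) \<union> New {V. openin X V \<and> x \<in> V} ` {..<2 * n}"
    proof (cases b)
      case (Base y) then show ?thesis using b \<open>a = Base x\<close> cl_Base by auto
    next
      case (New U j)
      have "New U j \<in> L closure_of {Base x}" using b \<open>a = Base x\<close> New by (simp only:)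
      note U = cl_Base_New(1,3)[OF this]
      have "b = New {V. openin X V \<and> x \<in> V} j" using New by (subst U(2)[symmetric])
      then show ?thesis using U(1) by blast
    next
      case (Link l)
      have "openin L (Link ` {l. idx l < n})" by (intro open_Link) auto
      then show ?thesis using b Link \<open>a = Base x\<close> unfolding in_cl by (auto simp: Link_letter_set)
    qed
  qed
  ultimately show ?thesis by (meson finite_UnI finite_imageI finite_lessThan finite_subset)
next
  case (New U j)
  then show ?thesis using cl_New assms by simp
next
  case (Link l)
  have "L closure_of {a} \<subseteq> {Link l} \<union> (case l of LB j \<Rightarrow> {Link (LC j)} | _ \<Rightarrow> {})"
    using cl_Link_sub Link by fastforce
  moreover have "finite ({Link l} \<union> (case l of LB j \<Rightarrow> {Link (LC j)} | _ \<Rightarrow> {}))" by (cases l) auto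
  ultimately show ?thesis by (rule finite_subset)
qed

lemma T0_L: assumes ab: "a \<in> L closure_of {b}" "b \<in> L closure_of {a}" shows "a = b"
proof (cases a)
  case a: (Base x)
  show ?thesis
  proof (cases b)
    case (Base y)
    then show ?thesis using ab a T0 cl_Base by auto
  next
    case (New U j)
    then have "New U j \<in> letter_set" using ab(2) unfolding in_cl by blast
    then show ?thesis using ab(1) cl_New New by auto
  next
    case (Link l)
    then show ?thesis using ab(1) cl_Link_sub a by fastforce
  qed
next
  case (New U j)
  then have "New U j \<in> letter_set" using ab(1) unfolding in_cl by blast
  then show ?thesis using ab(2) cl_New New by auto
next
  case (Link l)
  then obtain l' where "b = Link l'" using ab(2) cl_Link_sub by blast
  then show ?thesis using cl_Link_sub[of a l'] cl_Link_sub[of b l] ab Link by auto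
qed

text \<open>The closure of a new letter or of a link contains no base letter, so only base letters
  require something to be removed.\<close>

definition avoid :: "'a letter \<Rightarrow> 'a set" where
  "avoid a = (case a of Base x \<Rightarrow> topspace X - X closure_of {x} | _ \<Rightarrow> topspace X)"

text \<open>The offset keeps \<open>a\<close> out of the completion of \<open>avoid a\<close>.\<close>

definition offset :: "'a letter \<Rightarrow> nat" where
  "offset a = (case a of New U j \<Rightarrow> if j < n then n else 0 | _ \<Rightarrow> 0)"

text \<open>The subtraction is exact: in an \<open>n\<close>-Hausdorff space an open ultrafilter has
  at most \<open>n - 1\<close> limits.\<close>

definition completion :: "'a set \<Rightarrow> nat \<Rightarrow> 'a letter set" where
  "completion Y k = Base ` Y \<union> {New U (k + j) | U j. open_ultrafilter X U \<and> Y \<in> U \<and> j < n - 1 - card (lims X U \<inter> Y)}"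

text \<open>The new points supply the limits that an open ultrafilter concentrated on \<open>Y\<close> lacks.\<close>

lemma full_limits_completion:
  assumes Y: "openin X Y" and k: "k \<le> n"
  shows "full_limits n (subtopology L (completion Y k))"
  unfolding full_limits_def
proof (intro allI impI)
  let ?S = "subtopology L (completion Y k)"
  fix \<U> assume U: "open_ultrafilter ?S \<U>"
  have sub: "completion Y k \<subseteq> letter_set"
    using openin_subset[OF Y] k unfolding completion_def by (auto simp: Base_letter_set New_letter_set)
  then have tS: "topspace ?S = completion Y k" by auto
  have oB: "openin ?S (Base ` (V \<inter> Y))" if "openin X V" for V
  proof -
    have "openin L (Base ` (V \<inter> Y))" using that Y by (intro open_Base openin_Int)
    moreover have "Base ` (V \<inter> Y) = Base ` (V \<inter> Y) \<inter> completion Y k" unfolding completion_def by auto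
    ultimately show ?thesis unfolding openin_subtopology by blast
  qed
  have pre: "openin X {x. Base x \<in> P}" if P: "openin ?S P" for P
  proof -
    obtain P' where P': "openin L P'" "P = P' \<inter> completion Y k" using P unfolding openin_subtopology by blast
    have "{x. Base x \<in> P} = {x. Base x \<in> P'} \<inter> Y" unfolding P'(2) completion_def by auto
    then show ?thesis using P'(1) Y unfolding openin_L letter_open_def by (simp add: openin_Int)
  qed
  have preN: "{x. Base x \<in> P} \<in> V" if P: "openin ?S P" "New V i \<in> P" for P V i
  proof -
    obtain P' where P': "openin L P'" "P = P' \<inter> completion Y k" using P unfolding openin_subtopology by blast
    have e: "{x. Base x \<in> P} = {x. Base x \<in> P'} \<inter> Y" unfolding P'(2) completion_def by auto
    have V: "open_ultrafilter X V" "Y \<in> V" using P(2) unfolding P'(2) completion_def by auto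
    have "{x. Base x \<in> P'} \<in> V" using P' P(2) unfolding openin_L letter_open_def by blast
    then show ?thesis unfolding e using open_ultrafilterD(3)[OF V(1)] V(2) by blast
  qed
  define V where "V = {P. openin X P \<and> Base ` (P \<inter> Y) \<in> \<U>}"
  \<comment> \<open>The base letters are dense in the completion: a neighbourhood of a new point
    contains those of a member of its ultrafilter. So \<open>\<U>\<close> lives on the base letters
    and induces the open ultrafilter \<open>V\<close> of \<open>X\<close>.\<close>
  have BY: "Base ` Y \<in> \<U>"
  proof (rule ccontr)
    assume "Base ` Y \<notin> \<U>"
    then obtain Q where Q: "Q \<in> \<U>" "Base ` Y \<inter> Q = {}"
      using open_ultrafilterD(4)[OF U, of "Base ` Y"] oB[OF Y] by auto
    have oQ: "openin ?S Q" "Q \<noteq> {}" using open_ultrafilterD(1,2)[OF U] Q(1) by auto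
    then obtain q where q: "q \<in> Q" "q \<in> completion Y k" using openin_subset tS by blast
    then obtain U' j where q': "q = New U' j" "open_ultrafilter X U'" using Q(2) unfolding completion_def by auto
    have "{x. Base x \<in> Q} \<in> U'" using preN[OF oQ(1)] q q' by blast
    moreover have "{x. Base x \<in> Q} = {}"
    proof -
      have "Base x \<in> Base ` Y" if "Base x \<in> Q" for x
        using that openin_subset[OF oQ(1)] tS unfolding completion_def by auto
      then show ?thesis using Q(2) by blast
    qed
    ultimately show False using open_ultrafilterD(2)[OF q'(2)] by simp
  qed
  have toV: "{x. Base x \<in> P} \<in> V" if "P \<in> \<U>" for P
  proof -
    have "Base ` ({x. Base x \<in> P} \<inter> Y) = P \<inter> Base ` Y" by auto
    then show ?thesis using open_ultrafilterD(3)[OF U that BY] pre[OF open_ultrafilterD(1)[OF U that]]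
      unfolding V_def by simp
  qed
  have V: "open_ultrafilter X V"
    unfolding open_ultrafilter_def
  proof (intro conjI ballI allI impI)
    show "{} \<notin> V" using open_ultrafilterD(2)[OF U] unfolding V_def by simp
  next
    fix P Q assume "P \<in> V" "Q \<in> V"
    then have "Base ` (P \<inter> Y) \<inter> Base ` (Q \<inter> Y) \<in> \<U>" "openin X (P \<inter> Q)"
      using open_ultrafilterD(3)[OF U] unfolding V_def by auto
    moreover have "Base ` (P \<inter> Y) \<inter> Base ` (Q \<inter> Y) = Base ` (P \<inter> Q \<inter> Y)" by auto
    ultimately show "P \<inter> Q \<in> V" unfolding V_def by simp
  next
    fix P assume P: "openin X P"
    show "P \<in> V \<or> (\<exists>Q\<in>V. P \<inter> Q = {})"
    proof (cases "Base ` (P \<inter> Y) \<in> \<U>")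
      case False
      then obtain Q where Q: "Q \<in> \<U>" "Base ` (P \<inter> Y) \<inter> Q = {}"
        using open_ultrafilterD(4)[OF U oB[OF P]] by blast
      have "Q \<inter> Base ` Y \<in> \<U>" using open_ultrafilterD(3)[OF U Q(1) BY] .
      then have "{x. Base x \<in> Q \<inter> Base ` Y} \<in> V" by (rule toV)
      moreover have "P \<inter> {x. Base x \<in> Q \<inter> Base ` Y} = {}" using Q(2) by auto
      ultimately show ?thesis by blast
    qed (use P in \<open>auto simp: V_def\<close>)
  qed (auto simp: V_def)
  have YV: "Y \<in> V" using Y BY unfolding V_def by simp
  have fromV: "P \<in> \<U>" if P: "openin ?S P" "{x. Base x \<in> P} \<in> V" for P
  proof -
    have "Base ` ({x. Base x \<in> P} \<inter> Y) \<in> \<U>" using P(2) unfolding V_def by blast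
    then show ?thesis using open_ultrafilter_upward[OF U _ _ P(1)] by blast
  qed
  let ?m = "n - 1 - card (lims X V \<inter> Y)"
  have "lims ?S \<U> = Base ` (lims X V \<inter> Y) \<union> (\<lambda>j. New V (k + j)) ` {..<?m}"
  proof
    show "lims ?S \<U> \<subseteq> Base ` (lims X V \<inter> Y) \<union> (\<lambda>j. New V (k + j)) ` {..<?m}"
    proof
      fix q assume q: "q \<in> lims ?S \<U>"
      then have "q \<in> completion Y k" unfolding lims_def tS by blast
      then consider y where "q = Base y" "y \<in> Y"
        | V' j where "q = New V' (k + j)" "open_ultrafilter X V'" "Y \<in> V'" "j < n - 1 - card (lims X V' \<inter> Y)"
        unfolding completion_def by blast
      then show "q \<in> Base ` (lims X V \<inter> Y) \<union> (\<lambda>j. New V (k + j)) ` {..<?m}"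
      proof cases
        case 1
        have "P \<in> V" if P: "openin X P" "y \<in> P" for P
          using q 1 oB[OF P(1)] P unfolding lims_def V_def by auto
        then show ?thesis using 1 openin_subset[OF Y] unfolding lims_def by auto
      next
        case 2
        \<comment> \<open>If a new point is a limit of \<open>\<U>\<close>, the members of its
          ultrafilter \<open>V'\<close> must occur in \<open>V\<close>, and maximality identifies
          the two.\<close>
        have "V' \<subseteq> V"
        proof
          fix P assume P: "P \<in> V'"
          then have PY: "P \<inter> Y \<in> V'" using open_ultrafilterD(3)[OF 2(2)] 2(3) by blast
          have "openin L (insert q (Base ` (P \<inter> Y)))" unfolding 2(1)
            using k 2(4) by (intro open_New 2(2) PY) auto
          moreover have "insert q (Base ` (P \<inter> Y)) = insert q (Base ` (P \<inter> Y)) \<inter> completion Y k"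
            using \<open>q \<in> completion Y k\<close> unfolding completion_def by auto
          ultimately have "openin ?S (insert q (Base ` (P \<inter> Y)))" unfolding openin_subtopology by blast
          then have "insert q (Base ` (P \<inter> Y)) \<in> \<U>" using q unfolding lims_def by blast
          then have "{x. Base x \<in> insert q (Base ` (P \<inter> Y))} \<in> V" by (rule toV)
          moreover have "{x. Base x \<in> insert q (Base ` (P \<inter> Y))} = P \<inter> Y" using 2(1) by auto
          ultimately show "P \<in> V"
            using open_ultrafilter_upward[OF V, of "P \<inter> Y" P] open_ultrafilterD(1)[OF 2(2) P] by auto
        qed
        then have "V' = V" using open_ultrafilter_maximal[OF 2(2) V] by blast
        then show ?thesis using 2 by auto
      qed
    qed
    show "Base ` (lims X V \<inter> Y) \<union> (\<lambda>j. New V (k + j)) ` {..<?m} \<subseteq> lims ?S \<U>"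
    proof
      fix q assume "q \<in> Base ` (lims X V \<inter> Y) \<union> (\<lambda>j. New V (k + j)) ` {..<?m}"
      then consider y where "q = Base y" "y \<in> lims X V" "y \<in> Y" | j where "j < ?m" "q = New V (k + j)" by auto
      then show "q \<in> lims ?S \<U>"
      proof cases
        case 1
        have "P \<in> \<U>" if P: "openin ?S P" "q \<in> P" for P
          using fromV[OF P(1)] pre[OF P(1)] P(2) 1 unfolding lims_def by blast
        moreover have "q \<in> completion Y k" using 1 unfolding completion_def by blast
        ultimately show ?thesis unfolding lims_def tS by blast
      next
        case 2
        have "P \<in> \<U>" if P: "openin ?S P" "q \<in> P" for P
          using fromV[OF P(1)] preN[OF P(1)] P(2) 2 by blast
        moreover have "q \<in> completion Y k" using 2 V YV unfolding completion_def by blast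
        ultimately show ?thesis unfolding lims_def tS by blast
      qed
    qed
  qed
  moreover have "card (Base ` (lims X V \<inter> Y) \<union> (\<lambda>j. New V (k + j)) ` {..<?m}) = card (lims X V \<inter> Y) + ?m"
  proof -
    have "finite (lims X V)" using card_lims_less[OF X V] n2 by simp
    then show ?thesis by (subst card_Un_disjoint) (auto simp: card_image inj_on_def)
  qed
  moreover have "card (lims X V \<inter> Y) \<le> n - 1"
  proof -
    have "finite (lims X V)" "card (lims X V) < n" using card_lims_less[OF X V] n2 by auto
    then show ?thesis using card_mono[of "lims X V" "lims X V \<inter> Y"] by auto
  qed
  ultimately show "card (lims ?S \<U>) = n - 1" by simp
qed

sublocale letters L n Link "Base ` topspace X" "\<lambda>a. completion (avoid a) (offset a)"
proof
  show "2 \<le> n" by (rule n2)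
  show "inj Link" by (auto simp: inj_def)
  show "Link l \<in> topspace L" if "idx l < n" for l using that by (simp add: Link_letter_set)
  show "openin L {Link l}" if "idx l < n" "\<And>j. l \<noteq> LC j" for l
    using open_Link[of "{l}"] that by auto
  show "openin L {Link (LB j), Link (LC j)}" if "j < n" for j
    using open_Link[of "{LB j, LC j}"] that by auto
  have self: "a \<in> L closure_of {a}" if "a \<in> letter_set" for a using that unfolding in_cl by blast
  show "L closure_of {Link l} = {Link l}" if l: "idx l < n" "\<And>j. l \<noteq> LB j" for l
  proof
    show "L closure_of {Link l} \<subseteq> {Link l}" using cl_Link_sub l(2) by blast
    show "{Link l} \<subseteq> L closure_of {Link l}" using self[of "Link l"] l(1) by (simp add: Link_letter_set)
  qed
  show "L closure_of {Link (LB j)} = {Link (LB j), Link (LC j)}" if j: "j < n" for j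
  proof
    show "L closure_of {Link (LB j)} \<subseteq> {Link (LB j), Link (LC j)}" using cl_Link_sub[of _ "LB j"] by blast
    have "Link (LC j) \<in> L closure_of {Link (LB j)}"
      using j unfolding in_cl openin_L letter_open_def by (simp add: Link_letter_set)
    then show "{Link (LB j), Link (LC j)} \<subseteq> L closure_of {Link (LB j)}"
      using self[of "Link (LB j)"] j by (simp add: Link_letter_set)
  qed
  have nl: "letter_set - Link ` {l. idx l < n} = Base ` topspace X \<union> {New U j | U j. open_ultrafilter X U \<and> j < 2 * n}"
    unfolding letter_set_def by auto
  have N: "{x. Base x \<in> Base ` topspace X \<union> {New U j | U j. open_ultrafilter X U \<and> j < 2 * n}} = topspace X" by auto
  show "openin L (topspace L - Link ` {l. idx l < n})"
    unfolding topspace_L nl openin_L letter_open_def N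
    using open_ultrafilter_topspace by (auto simp: letter_set_def)
  show "finite (L closure_of {a})" if "a \<in> topspace L" for a using fin_cl_L that by simp
  show "a = b" if "a \<in> L closure_of {b}" "b \<in> L closure_of {a}" for a b using T0_L[OF that] .
  show "Base ` topspace X \<subseteq> topspace L - Link ` {l. idx l < n}" by (auto simp: Base_letter_set)
  show "openin L (insert b (Base ` topspace X))" if b: "b \<in> topspace L - Link ` {l. idx l < n}" for b
  proof (cases b)
    case (Base x)
    then have "insert b (Base ` topspace X) = Base ` topspace X" using b by (auto simp: Base_letter_set)
    then show ?thesis using open_Base[OF openin_topspace] by simp
  next
    case (New U j)
    then show ?thesis using b open_New[of U j "topspace X"] open_ultrafilter_topspace[of X U] by (auto simp: New_letter_set)
  next
    case (Link l)
    then show ?thesis using b by (auto simp: Link_letter_set)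
  qed
  fix a assume a: "a \<in> topspace L"
  have oa: "openin X (avoid a)" unfolding avoid_def by (cases a) (auto simp: openin_diff)
  have ka: "offset a \<le> n" unfolding offset_def by (cases a) auto
  show "full_limits n (subtopology L (completion (avoid a) (offset a)))" using full_limits_completion[OF oa ka] .
  show "Base ` topspace X - L closure_of {a} \<subseteq> completion (avoid a) (offset a)"
    unfolding completion_def avoid_def by (cases a) (auto simp: cl_Base)
  have "b \<in> letter_set \<and> b \<notin> Link ` {l. idx l < n} \<and> b \<notin> L closure_of {a}" if b: "b \<in> completion (avoid a) (offset a)" for b
  proof -
    consider y where "b = Base y" "y \<in> avoid a" | U j where "b = New U (offset a + j)" "open_ultrafilter X U"
        "avoid a \<in> U" "j < n - 1"
      using b unfolding completion_def by force
    then show ?thesis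
    proof cases
      case 1
      have "y \<in> topspace X" using 1(2) openin_subset[OF oa] by blast
      moreover have "Base y \<notin> L closure_of {a}"
        using 1(2) a not_Base_cl(1)[of y] not_Base_cl(2)[of _ _ y] unfolding avoid_def by (cases a) (auto simp: cl_Base)
      ultimately show ?thesis using 1(1) by (auto simp: Base_letter_set)
    next
      case 2
      have bL: "b \<in> letter_set" using 2 ka by (simp add: New_letter_set)
      \<comment> \<open>For a base letter \<open>x\<close>, the member \<open>avoid a\<close> of
        \<open>U\<close> does not contain \<open>x\<close>. A new letter has only itself in its
        closure, and the offset makes the numbers differ. The closure of a link consists of
        links.\<close>
      have "b \<notin> L closure_of {a}"
      proof
        assume c: "b \<in> L closure_of {a}"
        show False
        proof (cases a)
          case (Base x)
          then have xa: "x \<in> avoid a" using cl_Base_New(2)[of U "offset a + j" x "avoid a"] c 2 by simp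
          have "x \<in> topspace X" using a Base by (simp add: Base_letter_set)
          then have "x \<in> X closure_of {x}" unfolding in_cl_X by blast
          then show False using xa Base unfolding avoid_def by simp
        next
          case (New U' j')
          then have "b = a" using cl_New[of U' j'] a c by simp
          then have "j' = offset a + j" using 2(1) New by simp
          then show False using New 2(4) unfolding offset_def by (auto split: if_splits)
        next
          case (Link l)
          then show False using cl_Link_sub[of b l] c 2(1) by auto
        qed
      qed
      then show ?thesis using bL 2(1) by auto
    qed
  qed
  then show "completion (avoid a) (offset a) \<subseteq> topspace L - Link ` {l. idx l < n} - L closure_of {a}"
    by auto
qed

lemma embedding_map_Base: "embedding_map X Z (\<lambda>x. [Base x, Link (LD 0)])"
proof -
  have "homeomorphic_map X (subtopology L (Base ` topspace X)) Base"
    unfolding homeomorphic_map_maps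
  proof (intro exI)
    let ?f = "\<lambda>b. case b of Base x \<Rightarrow> x"
    have sub: "topspace (subtopology L (Base ` topspace X)) = Base ` topspace X" by (auto simp: Base_letter_set)
    show "homeomorphic_maps X (subtopology L (Base ` topspace X)) Base ?f"
      unfolding homeomorphic_maps_def
    proof (intro conjI)
      have "continuous_map X L Base"
        unfolding continuous_map_def
      proof (intro conjI allI impI)
        fix P assume P: "openin L P"
        then have "{x. Base x \<in> P} = {x \<in> topspace X. Base x \<in> P}"
          unfolding openin_L letter_open_def by (auto simp: Base_letter_set dest: openin_subset)
        then show "openin X {x \<in> topspace X. Base x \<in> P}" using P unfolding openin_L letter_open_def by metis
      qed (auto simp: Base_letter_set)
      then show "continuous_map X (subtopology L (Base ` topspace X)) Base"
        by (auto simp: continuous_map_in_subtopology)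
      show "continuous_map (subtopology L (Base ` topspace X)) X ?f"
        unfolding continuous_map_def
      proof (intro conjI allI impI)
        fix P assume P: "openin X P"
        have "{x \<in> topspace (subtopology L (Base ` topspace X)). ?f x \<in> P} = Base ` P \<inter> Base ` topspace X"
          unfolding sub by auto
        then show "openin (subtopology L (Base ` topspace X)) {x \<in> topspace (subtopology L (Base ` topspace X)). ?f x \<in> P}"
          using open_Base[OF P] unfolding openin_subtopology by blast
      qed (use sub in auto)
    qed (use sub in auto)
  qed
  then have "embedding_map X Z ((\<lambda>b. [b, Link (LD 0)]) \<circ> Base)"
  proof -
    assume h: "homeomorphic_map X (subtopology L (Base ` topspace X)) Base"
    have "embedding_map (subtopology L (Base ` topspace X)) Z (\<lambda>b. [b, Link (LD 0)])"
      using B_sub unfolding Lk_def[symmetric] by (rule embedding_map_letters)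
    have "embedding_map X (subtopology L (Base ` topspace X)) Base"
      using h unfolding embedding_map_def by (simp add: subtopology_subtopology)
    then show ?thesis using \<open>embedding_map (subtopology L _) Z _\<close> by (rule embedding_map_compose)
  qed
  then show ?thesis by (simp add: comp_def)
qed

end

section \<open>Blowing up points to indiscrete countable sets\<close>

text \<open>The product of \<open>Z\<close> with the indiscrete space on the natural numbers,
  transported along \<open>\<phi>\<close>, which also moves it to the required type of
  points.\<close>

definition blow_up :: "('b \<times> nat \<Rightarrow> 'c) \<Rightarrow> 'b topology \<Rightarrow> 'c topology" where
  "blow_up \<phi> Z = topology (\<lambda>P. \<exists>U. openin Z U \<and> P = \<phi> ` (U \<times> UNIV))"

context
  fixes \<phi> :: "'b \<times> nat \<Rightarrow> 'c" and Z :: "'b topology"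
  assumes inj: "inj \<phi>"
begin

lemma openin_blow_up: "openin (blow_up \<phi> Z) P \<longleftrightarrow> (\<exists>U. openin Z U \<and> P = \<phi> ` (U \<times> UNIV))"
proof -
  have "istopology (\<lambda>P. \<exists>U. openin Z U \<and> P = \<phi> ` (U \<times> UNIV))"
    unfolding istopology_def
  proof (intro conjI allI impI)
    fix S T assume "\<exists>U. openin Z U \<and> S = \<phi> ` (U \<times> UNIV)" "\<exists>U. openin Z U \<and> T = \<phi> ` (U \<times> UNIV)"
    then obtain U V where "openin Z U" "S = \<phi> ` (U \<times> UNIV)" "openin Z V" "T = \<phi> ` (V \<times> UNIV)" by blast
    then have "openin Z (U \<inter> V)" "S \<inter> T = \<phi> ` ((U \<inter> V) \<times> UNIV)"
      using inj by (auto simp: image_Int[symmetric])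
    then show "\<exists>U. openin Z U \<and> S \<inter> T = \<phi> ` (U \<times> UNIV)" by blast
  next
    fix \<K> assume "\<forall>K\<in>\<K>. \<exists>U. openin Z U \<and> K = \<phi> ` (U \<times> UNIV)"
    then obtain U where U: "\<And>K. K \<in> \<K> \<Longrightarrow> openin Z (U K) \<and> K = \<phi> ` (U K \<times> UNIV)" by metis
    then have "openin Z (\<Union>(U ` \<K>))" by blast
    moreover have "\<Union>\<K> = \<phi> ` (\<Union>(U ` \<K>) \<times> UNIV)"
    proof -
      have "\<Union>\<K> = (\<Union>K\<in>\<K>. \<phi> ` (U K \<times> UNIV))" using U by auto
      then show ?thesis by blast
    qed
    ultimately show "\<exists>U. openin Z U \<and> \<Union>\<K> = \<phi> ` (U \<times> UNIV)" by blast
  qed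
  then show ?thesis unfolding blow_up_def by (simp add: topology_inverse')
qed

lemma topspace_blow_up: "topspace (blow_up \<phi> Z) = \<phi> ` (topspace Z \<times> UNIV)"
proof
  have "openin (blow_up \<phi> Z) (topspace (blow_up \<phi> Z))" by simp
  then obtain U where "openin Z U" "topspace (blow_up \<phi> Z) = \<phi> ` (U \<times> UNIV)"
    unfolding openin_blow_up by blast
  then show "topspace (blow_up \<phi> Z) \<subseteq> \<phi> ` (topspace Z \<times> UNIV)" using openin_subset by blast
  have "openin (blow_up \<phi> Z) (\<phi> ` (topspace Z \<times> UNIV))" unfolding openin_blow_up by blast
  then show "\<phi> ` (topspace Z \<times> UNIV) \<subseteq> topspace (blow_up \<phi> Z)" by (rule openin_subset)
qed

lemma mem_blow_up: "\<phi> (z, i) \<in> \<phi> ` (U \<times> UNIV) \<longleftrightarrow> z \<in> U"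
  using inj by (auto dest: injD)

text \<open>\<open>f\<close> has to induce the topology of \<open>Y\<close> but need not be
  injective; \<open>g\<close> tells apart the points that \<open>f\<close> identifies, at no
  topological cost because the fibres are indiscrete.\<close>

lemma homeomorphic_map_blow_up:
  assumes h: "\<And>P. P \<subseteq> topspace Y \<Longrightarrow> openin Y P \<longleftrightarrow> (\<exists>U. openin Z U \<and> P = {x \<in> topspace Y. f x \<in> U})"
    and f: "f ` topspace Y \<subseteq> topspace Z" and i: "inj_on (\<lambda>x. (f x, g x)) (topspace Y)"
  shows "homeomorphic_map Y (subtopology (blow_up \<phi> Z) ((\<lambda>x. \<phi> (f x, g x)) ` topspace Y)) (\<lambda>x. \<phi> (f x, g x))"
proof (rule bijective_open_imp_homeomorphic_map)
  let ?e = "\<lambda>x. \<phi> (f x, g x)"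
  have sub: "?e ` topspace Y \<subseteq> topspace (blow_up \<phi> Z)"
    unfolding topspace_blow_up using f by blast
  have ts: "topspace (subtopology (blow_up \<phi> Z) (?e ` topspace Y)) = ?e ` topspace Y"
    using sub by auto
  have "continuous_map Y (blow_up \<phi> Z) ?e"
    unfolding continuous_map_def
  proof (intro conjI allI impI)
    fix P assume "openin (blow_up \<phi> Z) P"
    then obtain U where U: "openin Z U" "P = \<phi> ` (U \<times> UNIV)" unfolding openin_blow_up by blast
    have "{x \<in> topspace Y. ?e x \<in> P} = {x \<in> topspace Y. f x \<in> U}" unfolding U(2) mem_blow_up ..
    then show "openin Y {x \<in> topspace Y. ?e x \<in> P}" using U(1) by (subst h) auto
  qed (use sub in blast)
  then show "continuous_map Y (subtopology (blow_up \<phi> Z) (?e ` topspace Y)) ?e"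
    by (auto simp: continuous_map_in_subtopology)
  show "open_map Y (subtopology (blow_up \<phi> Z) (?e ` topspace Y)) ?e"
    unfolding open_map_def
  proof (intro allI impI)
    fix P assume P: "openin Y P"
    have PY: "P \<subseteq> topspace Y" using openin_subset[OF P] .
    then obtain U where U: "openin Z U" "P = {x \<in> topspace Y. f x \<in> U}" using h P by blast
    have "?e ` P = \<phi> ` (U \<times> UNIV) \<inter> ?e ` topspace Y"
      unfolding U(2) using mem_blow_up by blast
    moreover have "openin (blow_up \<phi> Z) (\<phi> ` (U \<times> UNIV))" unfolding openin_blow_up using U(1) by blast
    ultimately show "openin (subtopology (blow_up \<phi> Z) (?e ` topspace Y)) (?e ` P)"
      unfolding openin_subtopology by blast
  qed
  show "inj_on ?e (topspace Y)" using i inj unfolding inj_on_def by blast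
  show "?e ` topspace Y = topspace (subtopology (blow_up \<phi> Z) (?e ` topspace Y))" using ts by simp
qed

lemma homogeneous_blow_up:
  assumes Z: "homogeneous_space Z" shows "homogeneous_space (blow_up \<phi> Z)"
  unfolding homogeneous_space_def
proof (intro ballI)
  fix x y assume "x \<in> topspace (blow_up \<phi> Z)" "y \<in> topspace (blow_up \<phi> Z)"
  then obtain z i w j where xy: "x = \<phi> (z, i)" "z \<in> topspace Z" "y = \<phi> (w, j)" "w \<in> topspace Z"
    unfolding topspace_blow_up by auto
  obtain h where h: "homeomorphic_map Z Z h" "h z = w" using Z xy unfolding homogeneous_space_def by blast
  obtain h' where h': "homeomorphic_maps Z Z h h'" using h(1) homeomorphic_map_maps by blast
  \<comment> \<open>Every permutation of the fibre coordinate is continuous; the transposition of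
    \<open>i\<close> and \<open>j\<close> combines with \<open>h\<close> to carry \<open>x\<close>
    to \<open>y\<close>.\<close>
  define t where "t k = (if k = i then j else if k = j then i else k)" for k
  have tt: "t (t k) = k" for k unfolding t_def by simp
  define lift where "lift f p = \<phi> (f (fst (inv \<phi> p)), t (snd (inv \<phi> p)))" for f and p
  have lift: "lift f (\<phi> (a, k)) = \<phi> (f a, t k)" for f a k unfolding lift_def using inj by simp
  have cont: "continuous_map (blow_up \<phi> Z) (blow_up \<phi> Z) (lift f)" if f: "continuous_map Z Z f" for f
    unfolding continuous_map_def
  proof (intro conjI allI impI)
    show "lift f \<in> topspace (blow_up \<phi> Z) \<rightarrow> topspace (blow_up \<phi> Z)"
      unfolding topspace_blow_up using lift f unfolding continuous_map_def by auto
    fix P assume "openin (blow_up \<phi> Z) P"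
    then obtain U where U: "openin Z U" "P = \<phi> ` (U \<times> UNIV)" unfolding openin_blow_up by blast
    have "{p \<in> topspace (blow_up \<phi> Z). lift f p \<in> P} = \<phi> ` ({a \<in> topspace Z. f a \<in> U} \<times> UNIV)"
      unfolding topspace_blow_up U(2) using lift mem_blow_up by (auto simp: inj_eq[OF inj])
    moreover have "openin Z {a \<in> topspace Z. f a \<in> U}" using openin_continuous_map_preimage[OF f U(1)] .
    ultimately show "openin (blow_up \<phi> Z) {p \<in> topspace (blow_up \<phi> Z). lift f p \<in> P}"
      unfolding openin_blow_up by blast
  qed
  have "homeomorphic_maps (blow_up \<phi> Z) (blow_up \<phi> Z) (lift h) (lift h')"
    unfolding homeomorphic_maps_def topspace_blow_up
    using cont h' lift tt unfolding homeomorphic_maps_def by auto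
  then have "homeomorphic_map (blow_up \<phi> Z) (blow_up \<phi> Z) (lift h)" by (rule homeomorphic_maps_imp_map)
  moreover have "lift h x = y" using lift h(2) xy unfolding t_def by simp
  ultimately show "\<exists>h. homeomorphic_map (blow_up \<phi> Z) (blow_up \<phi> Z) h \<and> h x = y" by blast
qed

text \<open>Each slice of a piece at a fixed second coordinate is homeomorphic to the piece, and
  there are countably many slices.\<close>

lemma cover_blow_up:
  assumes C: "countable \<C>" "\<Union>\<C> = topspace Z" "\<forall>C\<in>\<C>. full_limits n (subtopology Z C)"
  shows "\<exists>\<D>. countable \<D> \<and> \<Union>\<D> = topspace (blow_up \<phi> Z) \<and> (\<forall>D\<in>\<D>. full_limits n (subtopology (blow_up \<phi> Z) D))"
proof (intro exI conjI ballI)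
  let ?D = "(\<lambda>(C, i). (\<lambda>z. \<phi> (z, i)) ` C) ` (\<C> \<times> UNIV)"
  show "countable ?D" using C(1) by auto
  show "\<Union>?D = topspace (blow_up \<phi> Z)" unfolding topspace_blow_up C(2)[symmetric] by auto
  fix D assume "D \<in> ?D"
  then obtain K i where D: "K \<in> \<C>" "D = (\<lambda>z. \<phi> (z, i)) ` K" by auto
  have K: "topspace (subtopology Z K) = K" using C(2) D(1) by auto
  have "homeomorphic_map (subtopology Z K)
      (subtopology (blow_up \<phi> Z) ((\<lambda>x. \<phi> (x, i)) ` topspace (subtopology Z K))) (\<lambda>x. \<phi> (x, i))"
  proof (rule homeomorphic_map_blow_up[where f = "\<lambda>x. x"])
    show "openin (subtopology Z K) P \<longleftrightarrow> (\<exists>U. openin Z U \<and> P = {x \<in> topspace (subtopology Z K). x \<in> U})" for P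
      unfolding openin_subtopology K by (auto simp: Int_def conj_commute)
  qed (auto simp: inj_on_def)
  then show "full_limits n (subtopology (blow_up \<phi> Z) D)"
    using full_limits_homeomorphic_map C(3)[rule_format, OF D(1)] D(2) K by metis
qed

end

section \<open>Coding words\<close>

text \<open>The numbers are stored in a singleton with a positive number; the members of
  \<open>U\<close> are marked by the number 0, so that they cannot be mistaken for it.\<close>

definition code :: "nat \<Rightarrow> nat \<Rightarrow> 'a set set \<Rightarrow> ('a + nat) set set" where
  "code i j U = insert {Inr (Suc (prod_encode (i, j)))} ((\<lambda>V. insert (Inr 0) (Inl ` V)) ` U)"

lemma code_inject: "code i j U = code i' j' U' \<longleftrightarrow> i = i' \<and> j = j' \<and> U = U'"
proof
  assume e: "code i j U = code i' j' U'"
  have D: "U = {V. insert (Inr 0) (Inl ` V) \<in> code i j U}" for i j and U :: "'a set set"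
  proof -
    have "insert (Inr 0) (Inl ` V) \<in> code i j U \<longleftrightarrow> V \<in> U" for V
    proof
      assume "insert (Inr 0) (Inl ` V) \<in> code i j U"
      then obtain V' where "V' \<in> U" "insert (Inr (0::nat)) (Inl ` V) = insert (Inr 0) (Inl ` V')"
        unfolding code_def by auto
      moreover have "{x. Inl x \<in> insert (Inr (0::nat)) (Inl ` V)} = V" for V :: "'a set" by auto
      ultimately show "V \<in> U" by metis
    qed (auto simp: code_def)
    then show ?thesis by blast
  qed
  have "U = {V. insert (Inr 0) (Inl ` V) \<in> code i j U}" by (rule D)
  also have "\<dots> = {V. insert (Inr 0) (Inl ` V) \<in> code i' j' U'}" by (simp only: e)
  also have "\<dots> = U'" by (rule D[symmetric])
  finally have U: "U = U'" .
  have "{Inr (Suc (prod_encode (i, j)))} \<in> code i j U" unfolding code_def by (rule insertI1)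
  then have "{Inr (Suc (prod_encode (i, j)))} \<in> code i' j' U'" by (simp only: e)
  then have "prod_encode (i, j) = prod_encode (i', j')" unfolding code_def by auto
  then have "(i, j) = (i', j')" by (metis prod_encode_inverse)
  then show "i = i' \<and> j = j' \<and> U = U'" using U by simp
qed simp

fun link_code :: "link \<Rightarrow> nat" where
  "link_code (LD j) = 5 * j" | "link_code (LS j) = 5 * j + 1" | "link_code (LT j) = 5 * j + 2"
| "link_code (LB j) = 5 * j + 3" | "link_code (LC j) = 5 * j + 4"

lemma link_code_inject: "link_code l = link_code l' \<longleftrightarrow> l = l'"
  by (cases l; cases l') (simp_all, presburger+)

text \<open>The second number is zero, odd, or even and positive according to the kind of the
  letter.\<close>

fun letter_code :: "nat \<Rightarrow> 'a letter \<Rightarrow> ('a + nat) set set" where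
  "letter_code i (Base x) = code i 0 {{x}}"
| "letter_code i (New U j) = code i (Suc (2 * j)) U"
| "letter_code i (Link l) = code i (Suc (Suc (2 * link_code l))) {}"

lemma letter_code_inject: "letter_code i a = letter_code i' a' \<longleftrightarrow> i = i' \<and> a = a'"
  by (cases a; cases a') (auto simp: code_inject link_code_inject, presburger+)

text \<open>Letters carry their position, starting at 1, so a set remembers their order; the number
  0 is reserved for the fibre coordinate. The outer singleton brings the code to the type
  \<open>'a ambient\<close>.\<close>

definition word_code :: "'a letter list \<times> nat \<Rightarrow> 'a ambient" where
  "word_code p = {insert (code 0 (snd p) {}) ((\<lambda>i. letter_code (Suc i) (fst p ! i)) ` {..<length (fst p)})}"

lemma inj_word_code: "inj word_code"
proof (rule injI)
  fix p q :: "'a letter list \<times> nat" assume e: "word_code p = word_code q"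
  have c0: "code 0 k {} \<noteq> letter_code (Suc i) a" for k i and a :: "'a letter"
    by (cases a) (simp_all add: code_inject)
  have mem: "code 0 k {} \<in> \<Union>(word_code p) \<longleftrightarrow> k = snd p" for k and p :: "'a letter list \<times> nat"
    unfolding word_code_def using c0 by (auto simp: code_inject)
  have lets: "letter_code (Suc i) a \<in> \<Union>(word_code p) \<longleftrightarrow> i < length (fst p) \<and> fst p ! i = a"
    for i a and p :: "'a letter list \<times> nat"
    unfolding word_code_def using c0[symmetric] by (auto simp: letter_code_inject)
  have s: "snd p = snd q" using mem[of _ p] mem[of _ q] e by blast
  have l: "i < length (fst p) \<and> fst p ! i = a \<longleftrightarrow> i < length (fst q) \<and> fst q ! i = a" for i a
    using lets[of i a p] lets[of i a q] e by simp
  have "\<not> length (fst p) < length (fst q)" "\<not> length (fst q) < length (fst p)" using l by blast+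
  then have "fst p = fst q" using l by (intro nth_equalityI) auto
  then show "p = q" using s by (simp add: prod_eq_iff)
qed

section \<open>The embedding theorem\<close>

theorem theorem4p12:
  fixes n :: nat and X :: "'a topology"
  assumes "n \<ge> 2" and "n_Hausdorff n X"
  shows "\<exists>(Z :: 'a ambient topology) e \<C>.
           embedding_map X Z e \<and>
           homogeneous_space Z \<and>
           countable \<C> \<and>
           \<Union>\<C> = topspace Z \<and>
           (\<forall>C\<in>\<C>. n_H_closed n (subtopology Z C))"
proof -
  \<comment> \<open>Classes of points that lie in the same open sets. \<open>rep\<close> depends on
    the class alone, and the subspace of representatives is T0.\<close>
  define tw where "tw x = {y \<in> topspace X. \<forall>P. openin X P \<longrightarrow> (x \<in> P \<longleftrightarrow> y \<in> P)}" for x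
  define rep where "rep x = (SOME y. y \<in> tw x)" for x
  have rep: "rep x \<in> tw x" if "x \<in> topspace X" for x
    unfolding rep_def by (rule someI[of _ x]) (use that in \<open>simp add: tw_def\<close>)
  have repX: "rep x \<in> topspace X" if "x \<in> topspace X" for x using rep[OF that] unfolding tw_def by blast
  have rep_open: "rep x \<in> P \<longleftrightarrow> x \<in> P" if "x \<in> topspace X" "openin X P" for x P
    using rep[OF that(1)] that(2) unfolding tw_def by blast
  have rep_eq: "rep x = rep y" if "\<And>P. openin X P \<Longrightarrow> x \<in> P \<longleftrightarrow> y \<in> P" for x y
  proof -
    have "tw x = tw y" using that unfolding tw_def by blast
    then show ?thesis unfolding rep_def by simp
  qed
  let ?R = "rep ` topspace X"
  let ?X = "subtopology X ?R"
  have tX: "topspace ?X = ?R" using repX by auto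
  have "n_Hausdorff n ?X"
    by (rule n_Hausdorff_injective_preimage[OF assms(2), of ?X id]) (auto simp: continuous_map_from_subtopology)
  moreover have "x = y" if xy: "x \<in> ?X closure_of {y}" "y \<in> ?X closure_of {x}" for x y
  proof -
    have R: "x \<in> ?R" "y \<in> ?R" using xy tX by (auto simp: in_closure_of)
    then obtain x' y' where x': "x = rep x'" "x' \<in> topspace X" "y = rep y'" "y' \<in> topspace X" by blast
    have o: "x \<in> P \<longleftrightarrow> y \<in> P" if "openin X P" for P
    proof -
      have "openin ?X (P \<inter> ?R)" using that unfolding openin_subtopology by blast
      then have "x \<in> P \<inter> ?R \<Longrightarrow> y \<in> P \<inter> ?R" "y \<in> P \<inter> ?R \<Longrightarrow> x \<in> P \<inter> ?R"
        using xy unfolding in_closure_of by (metis singletonD)+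
      then show ?thesis using R by blast
    qed
    have "x' \<in> P \<longleftrightarrow> y' \<in> P" if "openin X P" for P using o[OF that] rep_open that x' by simp
    then show ?thesis using rep_eq x' by blast
  qed
  ultimately interpret T0_space ?X n using assms(1) by unfold_locales auto
  define f where "f x = [Base (rep x), Link (LD 0)]" for x
  \<comment> \<open>Numbers the points of one class. The classes are finite, so each fits into one
    fibre of the blown up space.\<close>
  define k where "k x = to_nat_on {y \<in> topspace X. rep y = rep x} x" for x
  have cnt: "countable {y \<in> topspace X. rep y = rep x}" if x: "x \<in> topspace X" for x
  proof -
    have "{y \<in> topspace X. rep y = rep x} \<subseteq> {y \<in> topspace X. \<forall>P. openin X P \<and> y \<in> P \<longrightarrow> x \<in> P}"
    proof (intro subsetI CollectI conjI allI impI)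
      fix y P assume y: "y \<in> {y \<in> topspace X. rep y = rep x}" and P: "openin X P \<and> y \<in> P"
      then show "x \<in> P" using rep_open[of y P] rep_open[OF x, of P] by simp
    qed simp
    moreover have "finite {y \<in> topspace X. \<forall>P. openin X P \<and> y \<in> P \<longrightarrow> x \<in> P}"
      by (rule n_Hausdorff_finite_specializations[OF assms(2)]) (use assms(1) in simp)
    ultimately show ?thesis using countable_finite finite_subset by blast
  qed
  have inj: "inj_on (\<lambda>x. (f x, k x)) (topspace X)"
  proof (rule inj_onI)
    fix x y assume xy: "x \<in> topspace X" "y \<in> topspace X" "(f x, k x) = (f y, k y)"
    then have r: "rep x = rep y" "k x = k y" unfolding f_def by auto
    then have "to_nat_on {z \<in> topspace X. rep z = rep x} x = to_nat_on {z \<in> topspace X. rep z = rep x} y"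
      unfolding k_def by simp
    then show "x = y" using inj_on_to_nat_on[OF cnt[OF xy(1)]] xy r by (auto dest: inj_onD)
  qed
  have emb: "homeomorphic_map ?X (subtopology Z ((\<lambda>x. [Base x, Link (LD 0)]) ` ?R)) (\<lambda>x. [Base x, Link (LD 0)])"
    using embedding_map_Base unfolding embedding_map_def tX .
  have fZ: "f ` topspace X \<subseteq> topspace Z"
    using homeomorphic_imp_surjective_map[OF emb] tX unfolding f_def by auto
  \<comment> \<open>\<open>f\<close> induces the topology of \<open>X\<close>, because an open set
    contains \<open>x\<close> exactly if it contains \<open>rep x\<close>.\<close>
  have op: "openin X P \<longleftrightarrow> (\<exists>U. openin Z U \<and> P = {x \<in> topspace X. f x \<in> U})" if P: "P \<subseteq> topspace X" for P
  proof
    assume oP: "openin X P"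
    then have "openin ?X (P \<inter> ?R)" unfolding openin_subtopology by blast
    then have "openin (subtopology Z ((\<lambda>x. [Base x, Link (LD 0)]) ` ?R)) ((\<lambda>x. [Base x, Link (LD 0)]) ` (P \<inter> ?R))"
      using homeomorphic_map_openness[OF emb, of "P \<inter> ?R"] tX by auto
    then obtain U where U: "openin Z U"
        "(\<lambda>x. [Base x, Link (LD 0)]) ` (P \<inter> ?R) = U \<inter> (\<lambda>x. [Base x, Link (LD 0)]) ` ?R"
      unfolding openin_subtopology by (elim exE conjE)
    have "f x \<in> U \<longleftrightarrow> x \<in> P" if x: "x \<in> topspace X" for x
    proof -
      have "f x \<in> U \<longleftrightarrow> f x \<in> (\<lambda>x. [Base x, Link (LD 0)]) ` (P \<inter> ?R)"
        unfolding U(2) using x unfolding f_def by simp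
      also have "\<dots> \<longleftrightarrow> rep x \<in> P" using x unfolding f_def by auto
      finally show ?thesis using rep_open[OF x oP] by simp
    qed
    then have "P = {x \<in> topspace X. f x \<in> U}" using P by blast
    then show "\<exists>U. openin Z U \<and> P = {x \<in> topspace X. f x \<in> U}" using U(1) by blast
  next
    assume "\<exists>U. openin Z U \<and> P = {x \<in> topspace X. f x \<in> U}"
    then obtain U where U: "openin Z U" "P = {x \<in> topspace X. f x \<in> U}" by blast
    have "continuous_map ?X Z (\<lambda>x. [Base x, Link (LD 0)])"
      using homeomorphic_imp_continuous_map[OF emb] by (simp add: continuous_map_in_subtopology)
    then have "openin ?X {y \<in> ?R. [Base y, Link (LD 0)] \<in> U}"
      using openin_continuous_map_preimage[OF _ U(1)] tX by fastforce
    then obtain V where V: "openin X V" "{y \<in> ?R. [Base y, Link (LD 0)] \<in> U} = V \<inter> ?R"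
      unfolding openin_subtopology by blast
    have "f x \<in> U \<longleftrightarrow> x \<in> V" if x: "x \<in> topspace X" for x
      using V(2) rep_open[OF x V(1)] x unfolding f_def by blast
    then have "P = V" using U(2) openin_subset[OF V(1)] by auto
    then show "openin X P" using V(1) by simp
  qed
  let ?Z = "blow_up word_code Z"
  obtain \<C> where \<C>: "countable \<C>" "\<Union>\<C> = topspace Z" "\<forall>C\<in>\<C>. full_limits n (subtopology Z C)"
    using countable_cover_Z by auto
  obtain \<D> where "countable \<D>" "\<Union>\<D> = topspace ?Z" "\<forall>D\<in>\<D>. full_limits n (subtopology ?Z D)"
    using cover_blow_up[OF inj_word_code \<C>] by (elim exE conjE) (rule that)
  moreover have "embedding_map X ?Z (\<lambda>x. word_code (f x, k x))"
    unfolding embedding_map_def by (rule homeomorphic_map_blow_up[OF inj_word_code op fZ inj])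
  moreover have "homogeneous_space ?Z" by (rule homogeneous_blow_up[OF inj_word_code homogeneous_Z])
  moreover have "\<forall>D\<in>\<D>. n_H_closed n (subtopology ?Z D)"
    using calculation(3) full_limits_imp_n_H_closed[OF _ assms(1)] by blast
  ultimately show ?thesis
    by (intro exI[of _ ?Z] exI[of _ "\<lambda>x. word_code (f x, k x)"] exI[of _ \<D>]) simp
qed

end
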